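(* Let $(\gamma_t)$ be an ancient, embedded, convex solution to the curve shortening flow on the unit sphere $S^2$. Then there is an equator $\gamma_{-\infty}$ such that $\gamma_t\to\gamma_{-\infty}$ in $C^\infty$, up to diffeomorphism, as $t\to-\infty$.
   Context: $S^2$ is the round unit sphere. A closed embedded smooth curve $\gamma\subset S^2$ divides $S^2$ into two open regions. If one has area strictly less than $2\pi$ it is called the interior of $\gamma$; if both have area $2\pi$, a smooth unit normal field is chosen (continuously in $t$ along a family) and designated interior pointing. Let $\nu$ be the interior pointing unit normal, $\tau$ the unit tangent, and $\kappa$ the geodesic curvature, defined by $\nabla_\tau\tau=\kappa\nu$. A solution to the curve shortening flow is a smooth family of smooth embeddings $F_t:S^1\to S^2$ with $\gamma_t=F_t(S^1)$ and $\partial_t F_t=\kappa\nu$. It is ancient if its maximal interval of existence is $(-\infty,T)$; if $T\neq\infty$, time is translated so that $T=0$. It is convex if $\kappa\ge 0$ on every $\gamma_t$. An equator is a great circle of $S^2$. Convergence in $C^\infty$ up to diffeomorphism means: there are diffeomorphisms $\varphi_t$ of $S^1$ such that $F_t\circ\varphi_t$ converges in $C^\infty$ to a smooth embedding of $S^1$ with image $\gamma_{-\infty}$. *)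

theory Defs
  imports "HOL-Analysis.Analysis"
begin

abbreviation S1 :: "complex set" where "S1 \<equiv> sphere 0 1"
abbreviation S2 :: "(real^3) set" where "S2 \<equiv> sphere 0 1"

section \<open>Smooth maps\<close>

text \<open>\<open>Ck_on k U f\<close> is meant for open \<open>U\<close>: \<open>f\<close> is \<open>k\<close> times continuously differentiable,
  expressed through iterated directional derivatives.\<close>

primrec Ck_on ::
  "nat \<Rightarrow> 'a::real_normed_vector set \<Rightarrow> ('a \<Rightarrow> 'b::real_normed_vector) \<Rightarrow> bool" where
  "Ck_on 0 U f \<longleftrightarrow> continuous_on U f"
| "Ck_on (Suc k) U f \<longleftrightarrow>
     (\<forall>x\<in>U. f differentiable (at x)) \<and>
     (\<forall>v. Ck_on k U (\<lambda>x. frechet_derivative f (at x) v))"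

definition smooth_on :: "'a::real_normed_vector set \<Rightarrow> ('a \<Rightarrow> 'b::real_normed_vector) \<Rightarrow> bool" where
  "smooth_on U f \<longleftrightarrow> (\<forall>k. Ck_on k U f)"

text \<open>A function on the circle \<open>S1\<close> is a function on \<^typ>\<open>complex\<close> of which only the values
  on \<^term>\<open>S1\<close> matter. It is smooth iff its pullback under the covering map \<^term>\<open>cis\<close> is.
  \<open>circle_deriv\<close> is the derivative along the unit speed rotation field of the circle.\<close>

definition circle_smooth :: "(complex \<Rightarrow> 'b::real_normed_vector) \<Rightarrow> bool" where
  "circle_smooth f \<longleftrightarrow> smooth_on UNIV (\<lambda>u::real. f (cis u))"

definition circle_deriv :: "(complex \<Rightarrow> 'b::real_normed_vector) \<Rightarrow> complex \<Rightarrow> 'b" where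
  "circle_deriv f z = vector_derivative (\<lambda>u::real. f (z * cis u)) (at 0)"

definition circle_diffeo :: "(complex \<Rightarrow> complex) \<Rightarrow> bool" where
  "circle_diffeo \<phi> \<longleftrightarrow>
     bij_betw \<phi> S1 S1 \<and> circle_smooth \<phi> \<and> circle_smooth (inv_into S1 \<phi>)"

text \<open>An injective immersion of the circle is automatically a homeomorphism onto its image,
  by compactness.\<close>

definition smooth_embedding :: "(complex \<Rightarrow> real^3) \<Rightarrow> bool" where
  "smooth_embedding f \<longleftrightarrow>
     circle_smooth f \<and> f ` S1 \<subseteq> S2 \<and> inj_on f S1 \<and> (\<forall>z\<in>S1. circle_deriv f z \<noteq> 0)"

section \<open>Area and regions on the sphere\<close>

text \<open>Surface measure on the unit sphere. In polar coordinates \<open>dx = r\<^sup>2 dr d\<sigma>\<close>, so the solid cone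
  over \<open>A\<close> has volume \<open>\<sigma>(A) / 3\<close>. The lemmas \<open>sphere_area_S2\<close> and
  \<open>sphere_area_orthogonal\<close> below verify the total mass and the rotation invariance, which
  determine this measure.\<close>

definition sphere_area :: "(real^3) set \<Rightarrow> real" where
  "sphere_area A = 3 * measure lebesgue {r *\<^sub>R x | r x. 0 < r \<and> r < 1 \<and> x \<in> A}"

definition regions :: "(complex \<Rightarrow> real^3) \<Rightarrow> (real^3) set set" where
  "regions f = components (S2 - f ` S1)"

definition is_interior :: "(complex \<Rightarrow> real^3) \<Rightarrow> (real^3) set \<Rightarrow> bool" where
  "is_interior f \<Omega> \<longleftrightarrow> \<Omega> \<in> regions f \<and> sphere_area \<Omega> < 2 * pi"

definition bisects_area :: "(complex \<Rightarrow> real^3) \<Rightarrow> bool" where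
  "bisects_area f \<longleftrightarrow> (\<forall>\<Omega>\<in>regions f. sphere_area \<Omega> = 2 * pi)"

text \<open>For a unit tangent vector \<open>v\<close> at \<open>p\<close>, \<open>s \<mapsto> cos s p + sin s v\<close> is the geodesic of the sphere
  issuing from \<open>p\<close> in direction \<open>v\<close>.\<close>

definition points_into :: "(real^3) set \<Rightarrow> real^3 \<Rightarrow> real^3 \<Rightarrow> bool" where
  "points_into \<Omega> p v \<longleftrightarrow> (\<forall>\<^sub>F s in at_right (0::real). cos s *\<^sub>R p + sin s *\<^sub>R v \<in> \<Omega>)"

definition is_equator :: "(real^3) set \<Rightarrow> bool" where
  "is_equator E \<longleftrightarrow> (\<exists>n. n \<noteq> 0 \<and> E = {x \<in> S2. n \<bullet> x = 0})"

section \<open>Geometry of curves on the sphere\<close>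

definition unit_tangent :: "(complex \<Rightarrow> real^3) \<Rightarrow> complex \<Rightarrow> real^3" where
  "unit_tangent f z = circle_deriv f z /\<^sub>R norm (circle_deriv f z)"

definition tangential_part :: "real^3 \<Rightarrow> real^3 \<Rightarrow> real^3" where
  "tangential_part p w = w - (w \<bullet> p) *\<^sub>R p"

text \<open>\<open>nabla_tau f X\<close> is the covariant derivative of the vector field \<open>X\<close> along \<open>f\<close> in the direction
  of the unit tangent. The Levi-Civita connection of the round sphere is the tangential part of the
  Euclidean derivative.\<close>

definition nabla_tau :: "(complex \<Rightarrow> real^3) \<Rightarrow> (complex \<Rightarrow> real^3) \<Rightarrow> complex \<Rightarrow> real^3" where
  "nabla_tau f X z = tangential_part (f z) (circle_deriv X z /\<^sub>R norm (circle_deriv f z))"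

definition unit_normal_field :: "(complex \<Rightarrow> real^3) \<Rightarrow> (complex \<Rightarrow> real^3) \<Rightarrow> bool" where
  "unit_normal_field f \<nu> \<longleftrightarrow> circle_smooth \<nu> \<and>
     (\<forall>z\<in>S1. norm (\<nu> z) = 1 \<and> \<nu> z \<bullet> f z = 0 \<and> \<nu> z \<bullet> circle_deriv f z = 0)"

definition geodesic_curvature ::
  "(complex \<Rightarrow> real^3) \<Rightarrow> (complex \<Rightarrow> real^3) \<Rightarrow> complex \<Rightarrow> real" where
  "geodesic_curvature f \<nu> z = (THE k. nabla_tau f (unit_tangent f) z = k *\<^sub>R \<nu> z)"

section \<open>Curve shortening flow\<close>

text \<open>If some region has area less than \<open>2 \<pi>\<close>, the normal is forced to point into it. At the
  times when the curve bisects the area of the sphere, it is a free choice of a smooth unit normal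
  field, subject to continuity in time.\<close>

definition interior_normal ::
  "real set \<Rightarrow> (real \<Rightarrow> complex \<Rightarrow> real^3) \<Rightarrow> (real \<Rightarrow> complex \<Rightarrow> real^3) \<Rightarrow> bool" where
  "interior_normal I F \<nu> \<longleftrightarrow>
     (\<forall>t\<in>I. unit_normal_field (F t) (\<nu> t) \<and>
        (\<forall>\<Omega>. is_interior (F t) \<Omega> \<longrightarrow> (\<forall>z\<in>S1. points_into \<Omega> (F t z) (\<nu> t z)))) \<and>
     continuous_on ({t \<in> I. bisects_area (F t)} \<times> S1) (\<lambda>(t, z). \<nu> t z)"

definition curve_shortening_flow ::
  "real set \<Rightarrow> (real \<Rightarrow> complex \<Rightarrow> real^3) \<Rightarrow> (real \<Rightarrow> complex \<Rightarrow> real^3) \<Rightarrow> bool" where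
  "curve_shortening_flow I F \<nu> \<longleftrightarrow>
     smooth_on (I \<times> UNIV) (\<lambda>(t, u::real). F t (cis u)) \<and>
     (\<forall>t\<in>I. smooth_embedding (F t)) \<and>
     interior_normal I F \<nu> \<and>
     (\<forall>t\<in>I. \<forall>z\<in>S1.
        ((\<lambda>s. F s z) has_vector_derivative geodesic_curvature (F t) (\<nu> t) z *\<^sub>R \<nu> t z) (at t))"

definition before :: "ereal \<Rightarrow> real set" where
  "before T = {t. ereal t < T}"

text \<open>The second conjunct says that \<open>(-\<infinity>, T)\<close> is the maximal interval of existence; the third
  one normalises a finite final time to \<open>0\<close>.\<close>

definition ancient_solution ::
  "ereal \<Rightarrow> (real \<Rightarrow> complex \<Rightarrow> real^3) \<Rightarrow> (real \<Rightarrow> complex \<Rightarrow> real^3) \<Rightarrow> bool" where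
  "ancient_solution T F \<nu> \<longleftrightarrow>
     curve_shortening_flow (before T) F \<nu> \<and>
     (\<forall>T' > T. \<not> (\<exists>F' \<nu>'. curve_shortening_flow (before T') F' \<nu>' \<and>
                         (\<forall>t\<in>before T. \<forall>z\<in>S1. F' t z = F t z))) \<and>
     (T \<noteq> \<infinity> \<longrightarrow> T = 0)"

definition convex_solution ::
  "ereal \<Rightarrow> (real \<Rightarrow> complex \<Rightarrow> real^3) \<Rightarrow> (real \<Rightarrow> complex \<Rightarrow> real^3) \<Rightarrow> bool" where
  "convex_solution T F \<nu> \<longleftrightarrow>
     (\<forall>t\<in>before T. \<forall>z\<in>S1. geodesic_curvature (F t) (\<nu> t) z \<ge> 0)"

definition Cinf_limit ::
  "('t \<Rightarrow> complex \<Rightarrow> real^3) \<Rightarrow> (complex \<Rightarrow> real^3) \<Rightarrow> 't filter \<Rightarrow> bool" where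
  "Cinf_limit H G A \<longleftrightarrow>
     (\<forall>k. uniform_limit S1 (\<lambda>t. (circle_deriv ^^ k) (H t)) ((circle_deriv ^^ k) G) A)"

definition Cinf_limit_up_to_diffeo_at_bot ::
  "ereal \<Rightarrow> (real \<Rightarrow> complex \<Rightarrow> real^3) \<Rightarrow> (real^3) set \<Rightarrow> bool" where
  "Cinf_limit_up_to_diffeo_at_bot T F E \<longleftrightarrow>
     (\<exists>\<phi> G. (\<forall>t\<in>before T. circle_diffeo (\<phi> t)) \<and> smooth_embedding G \<and> G ` S1 = E \<and>
            Cinf_limit (\<lambda>t. F t \<circ> \<phi> t) G at_bot)"

section \<open>Basic facts validating the definitions\<close>

lemma sphere_area_S2: "sphere_area S2 = 4 * pi"
proof -
  have "{r *\<^sub>R x | r x. 0 < r \<and> r < 1 \<and> x \<in> S2} = ball 0 1 - {0::real^3}"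
  proof (intro equalityI subsetI)
    fix y :: "real^3" assume y: "y \<in> ball 0 1 - {0}"
    then have "y = norm y *\<^sub>R (y /\<^sub>R norm y)" "0 < norm y" "norm y < 1" "y /\<^sub>R norm y \<in> S2"
      by auto
    then show "y \<in> {r *\<^sub>R x | r x. 0 < r \<and> r < 1 \<and> x \<in> S2}" by blast
  qed (auto simp: dist_norm)
  moreover have "measure lebesgue (ball 0 1 - {0::real^3}) = measure lebesgue (ball (0::real^3) 1)"
    by (rule measure_negligible_symdiff) (auto intro: negligible_subset[of "{0}"])
  moreover have "measure lebesgue (ball (0::real^3) 1) = 4 / 3 * pi"
    using content_ball[of 1 "0::real^3"] by (simp add: unit_ball_vol_3)
  ultimately show ?thesis by (simp add: sphere_area_def)
qed

lemma sphere_area_orthogonal: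
  assumes g: "orthogonal_transformation g" and A: "openin (top_of_set S2) A"
  shows "sphere_area (g ` A) = sphere_area A"
proof -
  have lin: "linear g" using g by (rule orthogonal_transformation_linear)
  let ?C = "\<lambda>A. {r *\<^sub>R x | r x. 0 < r \<and> r < 1 \<and> x \<in> A}"
  obtain V where V: "open V" "A = S2 \<inter> V" using A by (auto simp: openin_open)
  have "?C A = (ball 0 1 - {0}) \<inter> (\<lambda>y. y /\<^sub>R norm y) -` V"
  proof (intro equalityI subsetI)
    fix y :: "real^3" assume y: "y \<in> (ball 0 1 - {0}) \<inter> (\<lambda>y. y /\<^sub>R norm y) -` V"
    then have "y = norm y *\<^sub>R (y /\<^sub>R norm y)" "0 < norm y" "norm y < 1" "y /\<^sub>R norm y \<in> A"
      by (auto simp: V)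
    then show "y \<in> ?C A" by blast
  qed (auto simp: dist_norm V)
  moreover have "open ((ball 0 1 - {0::real^3}) \<inter> (\<lambda>y. y /\<^sub>R norm y) -` V)"
    using V(1) by (intro continuous_open_preimage continuous_intros) auto
  moreover have "?C A \<subseteq> ball 0 1" by (auto simp: V(2))
  ultimately have "open (?C A)" "bounded (?C A)"
    using bounded_subset[OF bounded_ball] by simp_all
  then have meas: "?C A \<in> lmeasurable" by (intro lmeasurable_open)
  have "?C (g ` A) = g ` ?C A"
  proof (intro equalityI subsetI)
    fix y assume "y \<in> ?C (g ` A)"
    then obtain r x where "y = g (r *\<^sub>R x)" "0 < r" "r < 1" "x \<in> A"
      by (auto simp: linear_scale[OF lin])
    then show "y \<in> g ` ?C A" by blast
  next
    fix y assume "y \<in> g ` ?C A"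
    then obtain r x where "y = r *\<^sub>R g x" "0 < r" "r < 1" "x \<in> A"
      by (auto simp: linear_scale[OF lin])
    then show "y \<in> ?C (g ` A)" by blast
  qed
  then show ?thesis
    using measure_orthogonal_image[OF g meas] by (simp add: sphere_area_def)
qed

lemma smooth_on_UNIV_real:
  fixes g :: "real \<Rightarrow> 'b::real_normed_vector"
  assumes "smooth_on UNIV g"
  shows "(g has_vector_derivative vector_derivative g (at x)) (at x)"
    and "(\<lambda>x. vector_derivative g (at x)) differentiable (at x)"
proof -
  have "Ck_on (Suc (Suc 0)) UNIV g" using assms unfolding smooth_on_def by blast
  then have 1: "g differentiable (at x)"
    and 2: "(\<lambda>x. frechet_derivative g (at x) 1) differentiable (at x)" for x
    by auto
  show d: "(g has_vector_derivative vector_derivative g (at x)) (at x)" for x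
    using 1 by (simp add: vector_derivative_works)
  have "frechet_derivative g (at x) 1 = vector_derivative g (at x)" for x
    using frechet_derivative_at[OF d[unfolded has_vector_derivative_def], of x]
    by (metis scaleR_one)
  with 2 show "(\<lambda>x. vector_derivative g (at x)) differentiable (at x)" by simp
qed

lemma circle_smooth_derivs:
  assumes "circle_smooth f" "z \<in> S1"
  shows "((\<lambda>u. f (z * cis u)) has_vector_derivative circle_deriv f z) (at 0)"
    and "(\<lambda>u. circle_deriv f (z * cis u)) differentiable (at 0)"
proof -
  let ?g = "\<lambda>u::real. f (cis u)"
  note g = smooth_on_UNIV_real[OF assms(1)[unfolded circle_smooth_def]]
  have deriv: "((\<lambda>u. f (w * cis u)) has_vector_derivative vector_derivative ?g (at a)) (at 0)"
    if "w = cis a" for w a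
  proof -
    have "((?g \<circ> (\<lambda>u. a + u)) has_vector_derivative 1 *\<^sub>R vector_derivative ?g (at (a + 0))) (at 0)"
      by (rule vector_diff_chain_at) (auto intro!: derivative_eq_intros g(1))
    then show ?thesis by (simp add: o_def that cis_mult)
  qed
  have "z \<noteq> 0" using assms(2) by auto
  then have a: "z = cis (Arg z)" using assms(2) by (simp add: cis_Arg sgn_div_norm)
  have eq: "circle_deriv f (cis b) = vector_derivative ?g (at b)" for b
    unfolding circle_deriv_def using deriv[OF refl] by (rule vector_derivative_at)
  show "((\<lambda>u. f (z * cis u)) has_vector_derivative circle_deriv f z) (at 0)"
    using deriv[OF a] eq[of "Arg z"] a by simp
  have "((\<lambda>x. vector_derivative ?g (at x)) \<circ> (\<lambda>u. Arg z + u)) differentiable (at 0)"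
    by (rule differentiable_chain_at) (auto intro: g(2))
  then show "(\<lambda>u. circle_deriv f (z * cis u)) differentiable (at 0)"
    by (subst a) (simp add: o_def cis_mult eq)
qed

lemma orthonormal_triple_expand:
  fixes p q n w :: "real^3"
  assumes "norm p = 1" "norm q = 1" "norm n = 1" "p \<bullet> q = 0" "p \<bullet> n = 0" "q \<bullet> n = 0"
    and w: "w \<bullet> p = 0" "w \<bullet> q = 0"
  shows "w = (w \<bullet> n) *\<^sub>R n"
proof -
  have nn: "p \<bullet> p = 1" "q \<bullet> q = 1" "n \<bullet> n = 1" using assms by (simp_all add: dot_square_norm)
  then have "distinct [p, q, n]" using assms by auto
  moreover have "independent {p, q, n}"
    using nn assms
    by (intro pairwise_orthogonal_independent) (auto simp: pairwise_def orthogonal_def inner_commute)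
  ultimately have "span {p, q, n} = UNIV"
    using card_eq_dim[of "{p, q, n}" "UNIV :: (real^3) set"] by auto
  then have "w - (w \<bullet> n) *\<^sub>R n \<in> span {p, q, n}" by simp
  moreover have "orthogonal (w - (w \<bullet> n) *\<^sub>R n) y" if "y \<in> {p, q, n}" for y
    using that nn assms by (auto simp: orthogonal_def inner_diff_left inner_diff_right inner_commute)
  ultimately have "orthogonal (w - (w \<bullet> n) *\<^sub>R n) (w - (w \<bullet> n) *\<^sub>R n)"
    using orthogonal_to_span by blast
  then show ?thesis by (simp add: orthogonal_def)
qed

text \<open>The description in \<^const>\<open>geodesic_curvature\<close> denotes: \<open>\<nabla>\<^sub>\<tau>\<tau>\<close> is a multiple of \<open>\<nu>\<close>.\<close>

lemma nabla_tau_unit_tangent: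
  assumes f: "smooth_embedding f" and n: "unit_normal_field f \<nu>" and z: "z \<in> S1"
  shows "nabla_tau f (unit_tangent f) z = geodesic_curvature f \<nu> z *\<^sub>R \<nu> z"
proof -
  have sm: "circle_smooth f" and nz: "\<And>z. z \<in> S1 \<Longrightarrow> circle_deriv f z \<noteq> 0"
    and sph: "\<And>z. z \<in> S1 \<Longrightarrow> f z \<bullet> f z = 1"
    using f by (auto simp: smooth_embedding_def dot_square_norm image_subset_iff)
  have rot: "z * cis u \<in> S1" for u using z by (simp add: norm_mult)
  define \<tau> where "\<tau> = unit_tangent f"
  have t1: "\<tau> w \<bullet> \<tau> w = 1" if "w \<in> S1" for w
    using nz[OF that] by (simp add: \<tau>_def unit_tangent_def dot_square_norm power2_eq_square)
  have fd: "((\<lambda>u. f (z * cis u)) has_vector_derivative circle_deriv f z) (at 0)"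
    by (rule circle_smooth_derivs[OF sm z])
  let ?D = "\<lambda>u::real. circle_deriv f (z * cis u)"
  have D: "?D differentiable (at 0)" "?D 0 \<noteq> 0"
    using circle_smooth_derivs(2)[OF sm z] nz[OF z] by simp_all
  have "(norm \<circ> ?D) differentiable (at 0)"
    using D differentiable_norm_at by (intro differentiable_chain_at) auto
  then have "(\<lambda>u. \<tau> (z * cis u)) differentiable (at 0)"
    unfolding \<tau>_def unit_tangent_def using D
    by (intro differentiable_scaleR differentiable_inverse) (auto simp: o_def)
  then have td: "((\<lambda>u. \<tau> (z * cis u)) has_vector_derivative circle_deriv \<tau> z) (at 0)"
    by (simp add: circle_deriv_def vector_derivative_works)
  have const: "v \<bullet> h z = 0"
    if "((\<lambda>u. h (z * cis u)) has_vector_derivative v) (at 0)" "\<And>w. w \<in> S1 \<Longrightarrow> h w \<bullet> h w = 1"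
    for h :: "complex \<Rightarrow> real^3" and v
  proof -
    have "((\<lambda>u. h (z * cis u) \<bullet> h (z * cis u)) has_derivative
        (\<lambda>x. h (z * cis 0) \<bullet> (x *\<^sub>R v) + (x *\<^sub>R v) \<bullet> h (z * cis 0))) (at 0)"
      using that(1) unfolding has_vector_derivative_def by (intro has_derivative_inner)
    moreover have "((\<lambda>u. h (z * cis u) \<bullet> h (z * cis u)) has_derivative (\<lambda>x. 0)) (at 0)"
      using that(2)[OF rot] by simp
    ultimately have "(\<lambda>x. h (z * cis 0) \<bullet> (x *\<^sub>R v) + (x *\<^sub>R v) \<bullet> h (z * cis 0)) = (\<lambda>x. 0)"
      by (rule has_derivative_unique)
    from fun_cong[OF this, of 1] show ?thesis by (simp add: inner_commute)
  qed
  let ?w = "nabla_tau f \<tau> z"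
  have ft: "\<tau> z \<bullet> f z = 0" using const[OF fd sph] by (simp add: \<tau>_def unit_tangent_def)
  have tt: "circle_deriv \<tau> z \<bullet> \<tau> z = 0" using const[OF td t1] .
  have nu: "norm (\<nu> z) = 1" "\<nu> z \<bullet> f z = 0" "\<nu> z \<bullet> \<tau> z = 0"
    using n z by (auto simp: unit_normal_field_def \<tau>_def unit_tangent_def)
  have "?w = (?w \<bullet> \<nu> z) *\<^sub>R \<nu> z"
  proof (rule orthonormal_triple_expand)
    show "norm (f z) = 1" "norm (\<tau> z) = 1" "norm (\<nu> z) = 1"
      using sph[OF z] t1[OF z] nu by (simp_all add: norm_eq_1)
    show "f z \<bullet> \<tau> z = 0" "f z \<bullet> \<nu> z = 0" "\<tau> z \<bullet> \<nu> z = 0"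
      using ft nu by (simp_all add: inner_commute)
    show "?w \<bullet> f z = 0"
      using sph[OF z] by (simp add: nabla_tau_def tangential_part_def inner_diff_left)
    show "?w \<bullet> \<tau> z = 0"
      using ft tt
      by (simp add: nabla_tau_def tangential_part_def inner_diff_left inner_diff_right inner_commute)
  qed
  then have "?w = geodesic_curvature f \<nu> z *\<^sub>R \<nu> z"
    unfolding geodesic_curvature_def \<tau>_def[symmetric]
  proof (rule theI)
    fix k assume "?w = k *\<^sub>R \<nu> z"
    then show "k = ?w \<bullet> \<nu> z" using nu(1) by (simp add: dot_square_norm)
  qed
  then show ?thesis by (simp add: \<tau>_def)
qed

end

theory Submission
  imports Defs
begin

text \<open>
  Write \<open>s\<close> for arclength, \<open>v\<close> for the speed, \<open>N\<close> for a unit normal and \<open>k\<close> for the curvature of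
  \<open>F\<^sub>t\<close> with respect to \<open>N\<close>. In terms of arclength the flow is the equation \<open>F\<^sub>t = F\<^sub>s\<^sub>s + F\<close>, and it
  implies \<open>v\<^sub>t = - k\<^sup>2 v\<close> and \<open>k\<^sub>t = k\<^sub>s\<^sub>s + k\<^sup>3 + k\<close>. Therefore the total curvature satisfies
  \<open>d/dt \<integral> k ds = \<integral> k ds\<close> and is a constant multiple of \<open>e\<^sup>t\<close> (\<open>total_curvature\<close>). Convexity says
  that \<open>k\<close> has one sign on each curve, so \<open>\<integral> \<bar>k\<bar> ds\<close> decays like \<open>e\<^sup>t\<close> as \<open>t \<rightarrow> -\<infinity>\<close>. Convexity
  enters through this decay of an \<open>L\<^sup>1\<close> norm, which parabolic smoothing improves.

  The speed decreases in time, so the past curves are at least as long as the one at time \<open>-1\<close>, and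
  Sobolev and Nash inequalities hold along all of them with the same constants. With the Nash
  inequality, the energy identity for \<open>E\<^sub>0 = \<integral> k\<^sup>2 ds\<close> becomes \<open>y' \<le> C - a y\<^sup>3\<close> for
  \<open>y = e\<^sup>-\<^sup>2\<^sup>t E\<^sub>0\<close>. A large value of such a function forces blow-up at a finite earlier time, so on a
  past half-line \<open>y\<close> is bounded (\<open>energy_decays_0\<close>). For \<open>E\<^sub>m = \<integral> (\<partial>\<^sub>s\<^sup>m k)\<^sup>2 ds\<close> the nonlinear terms
  are cubic, with two factors of order less than \<open>m\<close>; so they are absorbed, and
  \<open>E\<^sub>m' \<le> - E\<^sub>m\<^sub>+\<^sub>1 + 3 E\<^sub>m + e\<^sup>2\<^sup>t\<close>. Together with the dissipation in the inequality for \<open>E\<^sub>m\<^sub>-\<^sub>1\<close> this gives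
  \<open>E\<^sub>m = O(e\<^sup>2\<^sup>t)\<close> by induction (\<open>energy_decays\<close>), hence all arclength derivatives of \<open>k\<close> are \<open>O(e\<^sup>t)\<close>
  uniformly along the curve.

  The arclength derivatives of \<open>v\<close> stay bounded by a Gronwall argument, and \<open>\<partial>\<^sub>u = v \<partial>\<^sub>s\<close>. So every
  derivative in the given parameter \<open>u\<close> of the velocity \<open>F\<^sub>t = k N\<close> is \<open>O(e\<^sup>t)\<close>, which is integrable
  at \<open>-\<infinity>\<close>. Consequently \<open>F\<^sub>t\<close> itself converges smoothly, and the identity serves as the
  diffeomorphism. The limit has positive speed and curvature zero, so it is
  \<open>cos \<Theta> e\<^sub>1 + sin \<Theta> e\<^sub>2\<close> with \<open>\<Theta>\<close> its arclength, and it runs \<open>d \<ge> 1\<close> times around an equator.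

  Embeddedness forces \<open>d = 1\<close> (\<open>total_angle\<close>): a curve that is \<open>C\<^sup>1\<close>-close to a \<open>d\<close>-fold equator is a
  graph over the angle, with a height function \<open>h\<close> of period \<open>2\<pi>d\<close>. The increments of \<open>h\<close> over \<open>d\<close>
  consecutive turns add up to zero, so by the intermediate value theorem \<open>h(x + 2\<pi>) = h(x)\<close> for some
  \<open>x\<close>. If \<open>d \<ge> 2\<close>, this is a self-intersection.
\<close>

section \<open>Calculus of smooth maps on open sets\<close>

lemma Ck_on_subset: "Ck_on k U f \<Longrightarrow> V \<subseteq> U \<Longrightarrow> Ck_on k V f"
  by (induction k arbitrary: f) (auto intro: continuous_on_subset)

lemma frechet_derivative_cong_open:
  assumes "open U" "x \<in> U" "\<And>y. y \<in> U \<Longrightarrow> f y = g y"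
  shows "frechet_derivative f (at x) = frechet_derivative g (at x)"
proof -
  have "(f has_derivative D) (at x) \<longleftrightarrow> (g has_derivative D) (at x)" for D
    using assms has_derivative_transform_within_open by metis
  then show ?thesis by (simp add: frechet_derivative_def)
qed

lemma differentiable_cong_open:
  assumes "open U" "x \<in> U" "\<And>y. y \<in> U \<Longrightarrow> f y = g y"
  shows "f differentiable (at x) \<longleftrightarrow> g differentiable (at x)"
proof -
  have "(f has_derivative D) (at x) \<longleftrightarrow> (g has_derivative D) (at x)" for D
    using assms has_derivative_transform_within_open by metis
  then show ?thesis by (simp add: differentiable_def)
qed

lemma Ck_on_cong:
  assumes "open U" "\<And>x. x \<in> U \<Longrightarrow> f x = g x"
  shows "Ck_on k U f \<longleftrightarrow> Ck_on k U g"
  using assms(2)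
proof (induction k arbitrary: f g)
  case (Suc k)
  have "Ck_on k U (\<lambda>x. frechet_derivative f (at x) v) \<longleftrightarrow>
      Ck_on k U (\<lambda>x. frechet_derivative g (at x) v)" for v
    using frechet_derivative_cong_open[OF assms(1) _ Suc.prems]
    by (intro Suc.IH) auto
  then show ?case
    using differentiable_cong_open[OF assms(1) _ Suc.prems] by auto
qed (auto cong: continuous_on_cong)

lemma Ck_on_SucI:
  assumes "open U" and d: "\<And>x. x \<in> U \<Longrightarrow> (f has_derivative f' x) (at x)"
    and k: "\<And>v. Ck_on k U (\<lambda>x. f' x v)"
  shows "Ck_on (Suc k) U f"
proof -
  have "Ck_on k U (\<lambda>x. frechet_derivative f (at x) v)" for v
    using k[of v] Ck_on_cong[OF assms(1), of "\<lambda>x. frechet_derivative f (at x) v" "\<lambda>x. f' x v"]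
      frechet_derivative_at[OF d] by metis
  then show ?thesis using d by (auto simp: differentiable_def)
qed

lemma Ck_on_Suc_differentiable:
  assumes "Ck_on (Suc k) U f" "x \<in> U"
  shows "(f has_derivative frechet_derivative f (at x)) (at x)"
  using assms by (simp add: frechet_derivative_works[symmetric])

lemma Ck_on_continuous: "Ck_on k U f \<Longrightarrow> continuous_on U f"
proof (cases k)
  case (Suc n)
  assume "Ck_on k U f"
  then show ?thesis unfolding Suc
    by (intro differentiable_imp_continuous_on) (auto simp: differentiable_on_def intro: differentiable_at_withinI)
qed simp

lemma Ck_on_Suc_D: "Ck_on (Suc k) U f \<Longrightarrow> Ck_on k U f"
proof (induction k arbitrary: f)
  case 0
  show ?case using Ck_on_continuous[OF 0] by simp
next
  case (Suc k)
  have "Ck_on (Suc k) U (\<lambda>x. frechet_derivative f (at x) v)" for v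
    using Suc.prems by (subst (asm) Ck_on.simps) blast
  then have "Ck_on k U (\<lambda>x. frechet_derivative f (at x) v)" for v
    by (intro Suc.IH)
  then show ?case using Suc.prems by simp
qed

lemma Ck_on_const: "open U \<Longrightarrow> Ck_on k U (\<lambda>_. c)"
proof (induction k arbitrary: c)
  case (Suc k)
  then show ?case by (intro Ck_on_SucI[where f'="\<lambda>_ _. 0"]) auto
qed simp

lemma Ck_on_add:
  assumes "open U"
  shows "Ck_on k U f \<Longrightarrow> Ck_on k U g \<Longrightarrow> Ck_on k U (\<lambda>x. f x + g x)"
proof (induction k arbitrary: f g)
  case (Suc k)
  show ?case
  proof (rule Ck_on_SucI[OF assms])
    show "((\<lambda>x. f x + g x) has_derivative
      (\<lambda>v. frechet_derivative f (at x) v + frechet_derivative g (at x) v)) (at x)" if "x \<in> U" for x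
      using Ck_on_Suc_differentiable[OF Suc.prems(1) that] Ck_on_Suc_differentiable[OF Suc.prems(2) that]
      by (rule has_derivative_add)
    show "Ck_on k U (\<lambda>x. frechet_derivative f (at x) v + frechet_derivative g (at x) v)" for v
      using Suc.prems by (intro Suc.IH) auto
  qed
qed (auto intro: continuous_intros)

lemma Ck_on_bilinear:
  assumes b: "bounded_bilinear b" and U: "open U"
  shows "Ck_on k U f \<Longrightarrow> Ck_on k U g \<Longrightarrow> Ck_on k U (\<lambda>x. b (f x) (g x))"
proof (induction k arbitrary: f g)
  case 0
  then show ?case by (auto intro: bounded_bilinear.continuous_on[OF b])
next
  case (Suc k)
  show ?case
  proof (rule Ck_on_SucI[OF U])
    show "((\<lambda>x. b (f x) (g x)) has_derivative
      (\<lambda>v. b (f x) (frechet_derivative g (at x) v) + b (frechet_derivative f (at x) v) (g x))) (at x)"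
      if "x \<in> U" for x
      using Ck_on_Suc_differentiable[OF Suc.prems(1) that] Ck_on_Suc_differentiable[OF Suc.prems(2) that]
      by (rule bounded_bilinear.FDERIV[OF b])
    show "Ck_on k U (\<lambda>x. b (f x) (frechet_derivative g (at x) v) + b (frechet_derivative f (at x) v) (g x))" for v
      using Suc.prems Ck_on_Suc_D[OF Suc.prems(1)] Ck_on_Suc_D[OF Suc.prems(2)]
      by (intro Ck_on_add[OF U] Suc.IH) auto
  qed
qed

lemma Ck_on_inverse:
  fixes f :: "'a::real_normed_vector \<Rightarrow> real"
  assumes U: "open U" and nz: "\<And>x. x \<in> U \<Longrightarrow> f x \<noteq> 0"
  shows "Ck_on k U f \<Longrightarrow> Ck_on k U (\<lambda>x. inverse (f x))"
proof (induction k)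
  case 0
  then show ?case using nz by (auto intro: continuous_intros)
next
  case (Suc k)
  note IH = Suc.IH[OF Ck_on_Suc_D[OF Suc.prems]]
  show ?case
  proof (rule Ck_on_SucI[OF U])
    show "((\<lambda>x. inverse (f x)) has_derivative
      (\<lambda>v. (-1) * (inverse (f x) * (frechet_derivative f (at x) v * inverse (f x))))) (at x)"
      if "x \<in> U" for x
      using Deriv.has_derivative_inverse[OF nz[OF that] Ck_on_Suc_differentiable[OF Suc.prems that]]
      by (simp add: mult.assoc)
    show "Ck_on k U (\<lambda>x. (-1) * (inverse (f x) * (frechet_derivative f (at x) v * inverse (f x))))" for v
      using Suc.prems IH
      by (intro Ck_on_bilinear[OF bounded_bilinear_mult U] Ck_on_const[OF U]) auto
  qed
qed

text \<open>The derivative \<open>f' / (2 sqrt f)\<close> involves only \<open>sqrt f\<close> itself and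
  \<open>f'\<close>, so one order of regularity is gained at each step of the induction.\<close>

lemma Ck_on_sqrt:
  fixes f :: "'a::real_normed_vector \<Rightarrow> real"
  assumes U: "open U" and pos: "\<And>x. x \<in> U \<Longrightarrow> f x > 0"
  shows "Ck_on k U f \<Longrightarrow> Ck_on k U (\<lambda>x. sqrt (f x))"
proof (induction k)
  case 0
  then show ?case by (auto intro: continuous_intros)
next
  case (Suc k)
  note IH = Suc.IH[OF Ck_on_Suc_D[OF Suc.prems]]
  show ?case
  proof (rule Ck_on_SucI[OF U])
    show "((\<lambda>x. sqrt (f x)) has_derivative
      (\<lambda>v. inverse 2 * (frechet_derivative f (at x) v * inverse (sqrt (f x))))) (at x)"
      if "x \<in> U" for x
      using Ck_on_Suc_differentiable[OF Suc.prems that] pos[OF that]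
      by (auto intro!: derivative_eq_intros simp: field_simps)
    show "Ck_on k U (\<lambda>x. inverse 2 * (frechet_derivative f (at x) v * inverse (sqrt (f x))))" for v
      using Suc.prems IH pos
      by (intro Ck_on_bilinear[OF bounded_bilinear_mult U] Ck_on_const[OF U] Ck_on_inverse[OF U])
        (auto simp: less_imp_neq[symmetric])
  qed
qed

lemma bounded_bilinear_cross3: "bounded_bilinear cross3"
proof -
  have "bilinear cross3"
    unfolding bilinear_def
    by (auto intro!: linearI simp: cross_add_left cross_add_right cross_mult_left cross_mult_right)
  then show ?thesis by (simp add: bilinear_conv_bounded_bilinear)
qed

section \<open>Periodic functions of past time and of a curve parameter\<close>

text \<open>All solutions under consideration live on every negative time, so this half plane carries all functions of
  time \<open>t\<close> and curve parameter \<open>u\<close> below.\<close>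

definition past :: "(real \<times> real) set" where "past = {..<0} \<times> UNIV"

lemma open_past: "open past" by (simp add: past_def open_Times)

lemma in_past [simp]: "(t, u) \<in> past \<longleftrightarrow> t < 0" by (simp add: past_def)

definition Dt :: "(real \<times> real \<Rightarrow> 'b::real_normed_vector) \<Rightarrow> real \<times> real \<Rightarrow> 'b" where
  "Dt f p = frechet_derivative f (at p) (1, 0)"

definition Du :: "(real \<times> real \<Rightarrow> 'b::real_normed_vector) \<Rightarrow> real \<times> real \<Rightarrow> 'b" where
  "Du f p = frechet_derivative f (at p) (0, 1)"

text \<open>Functions on a moving circle, pulled back to the line along the covering map: smooth on the past and
  \<open>2\<pi>\<close>-periodic in the parameter. Values outside the past are arbitrary, hence the congruence
  lemmas.\<close>

definition psmooth :: "(real \<times> real \<Rightarrow> 'b::real_normed_vector) \<Rightarrow> bool" where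
  "psmooth f \<longleftrightarrow> smooth_on past f \<and> (\<forall>t<0. \<forall>u. f (t, u + 2 * pi) = f (t, u))"

lemma psmooth_cong:
  assumes "psmooth f" "\<And>p. p \<in> past \<Longrightarrow> f p = g p"
  shows "psmooth g"
  using assms Ck_on_cong[OF open_past, of f g] by (simp add: psmooth_def smooth_on_def)

lemma Dt_cong: "(\<And>p. p \<in> past \<Longrightarrow> f p = g p) \<Longrightarrow> p \<in> past \<Longrightarrow> Dt f p = Dt g p"
  unfolding Dt_def using frechet_derivative_cong_open[OF open_past] by metis

lemma Du_cong: "(\<And>p. p \<in> past \<Longrightarrow> f p = g p) \<Longrightarrow> p \<in> past \<Longrightarrow> Du f p = Du g p"
  unfolding Du_def using frechet_derivative_cong_open[OF open_past] by metis

lemma psmooth_periodic: "psmooth f \<Longrightarrow> t < 0 \<Longrightarrow> f (t, u + 2 * pi) = f (t, u)"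
  by (simp add: psmooth_def)

lemma psmooth_has_derivative:
  "psmooth f \<Longrightarrow> p \<in> past \<Longrightarrow> (f has_derivative frechet_derivative f (at p)) (at p)"
  unfolding psmooth_def smooth_on_def using Ck_on_Suc_differentiable by blast

lemma psmooth_differentiable: "psmooth f \<Longrightarrow> p \<in> past \<Longrightarrow> f differentiable (at p)"
  unfolding differentiable_def using psmooth_has_derivative by blast

lemma psmooth_continuous_on: "psmooth f \<Longrightarrow> continuous_on past f"
  unfolding psmooth_def smooth_on_def using Ck_on_continuous by blast

lemma psmooth_continuous_slice: "psmooth f \<Longrightarrow> t < 0 \<Longrightarrow> continuous_on A (\<lambda>u. f (t, u))"
  by (rule continuous_on_compose2[OF psmooth_continuous_on]) (auto intro!: continuous_intros)

lemma Du_has_vector_derivative: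
  assumes "psmooth f" "t < 0"
  shows "((\<lambda>u. f (t, u)) has_vector_derivative Du f (t, u)) (at u)"
proof -
  have "(f has_derivative frechet_derivative f (at (t, u))) (at (t, u))"
    using assms by (intro psmooth_has_derivative) auto
  then have *: "((f \<circ> (\<lambda>u. (t, u))) has_derivative (frechet_derivative f (at (t, u)) \<circ> (\<lambda>h. (0, h)))) (at u)"
    by (intro diff_chain_at) (auto intro!: derivative_eq_intros)
  have "frechet_derivative f (at (t, u)) (0, h) = h *\<^sub>R frechet_derivative f (at (t, u)) (0, 1)" for h
  proof -
    have "linear (frechet_derivative f (at (t, u)))"
      using assms psmooth_differentiable[OF assms(1)] by (intro linear_frechet_derivative) auto
    from linear_scale[OF this, of h "(0, 1)"] show ?thesis by simp
  qed
  note eq = this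
  show ?thesis
    unfolding has_vector_derivative_def Du_def eq[symmetric] using * unfolding o_def .
qed

lemma Dt_has_vector_derivative:
  assumes "psmooth f" "t < 0"
  shows "((\<lambda>t. f (t, u)) has_vector_derivative Dt f (t, u)) (at t)"
proof -
  have "(f has_derivative frechet_derivative f (at (t, u))) (at (t, u))"
    using assms by (intro psmooth_has_derivative) auto
  then have *: "((f \<circ> (\<lambda>t. (t, u))) has_derivative (frechet_derivative f (at (t, u)) \<circ> (\<lambda>h. (h, 0)))) (at t)"
    by (intro diff_chain_at) (auto intro!: derivative_eq_intros)
  have "frechet_derivative f (at (t, u)) (h, 0) = h *\<^sub>R frechet_derivative f (at (t, u)) (1, 0)" for h
  proof -
    have "linear (frechet_derivative f (at (t, u)))"
      using assms psmooth_differentiable[OF assms(1)] by (intro linear_frechet_derivative) auto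
    from linear_scale[OF this, of h "(1, 0)"] show ?thesis by simp
  qed
  note eq = this
  show ?thesis
    unfolding has_vector_derivative_def Dt_def eq[symmetric] using * unfolding o_def .
qed

lemma frechet_derivative_periodic:
  assumes "psmooth f" "t < 0"
  shows "frechet_derivative f (at (t, u + 2 * pi)) = frechet_derivative f (at (t, u))"
proof -
  let ?s = "\<lambda>p::real\<times>real. p + (0, 2 * pi)"
  have "(f has_derivative frechet_derivative f (at (?s (t, u)))) (at (?s (t, u)))"
    using assms by (intro psmooth_has_derivative) auto
  then have "((f \<circ> ?s) has_derivative (frechet_derivative f (at (?s (t, u))) \<circ> (\<lambda>h. h))) (at (t, u))"
    by (intro diff_chain_at) (auto intro!: derivative_eq_intros)
  moreover have "(f \<circ> ?s) q = f q" if "q \<in> past" for q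
    using psmooth_periodic[OF assms(1), of "fst q" "snd q"] that by (cases q) simp
  ultimately have "(f has_derivative (frechet_derivative f (at (?s (t, u))) \<circ> (\<lambda>h. h))) (at (t, u))"
    using has_derivative_transform_within_open[OF _ open_past, of "f \<circ> ?s" _ "(t,u)" UNIV f] assms(2)
    by simp
  then show ?thesis
    using frechet_derivative_at[of f _ "(t, u)"] by (simp add: o_def)
qed

lemma psmooth_Dt: "psmooth f \<Longrightarrow> psmooth (Dt f)"
  unfolding psmooth_def Dt_def
proof (intro conjI allI impI)
  assume *: "smooth_on past f \<and> (\<forall>t<0. \<forall>u. f (t, u + 2 * pi) = f (t, u))"
  show "smooth_on past (\<lambda>p. frechet_derivative f (at p) (1, 0))"
    unfolding smooth_on_def
  proof
    fix k
    have "Ck_on (Suc k) past f" using * unfolding smooth_on_def by blast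
    then show "Ck_on k past (\<lambda>p. frechet_derivative f (at p) (1, 0))" by simp
  qed
qed (use frechet_derivative_periodic[unfolded psmooth_def] in metis)

lemma psmooth_Du: "psmooth f \<Longrightarrow> psmooth (Du f)"
  unfolding psmooth_def Du_def
proof (intro conjI allI impI)
  assume *: "smooth_on past f \<and> (\<forall>t<0. \<forall>u. f (t, u + 2 * pi) = f (t, u))"
  show "smooth_on past (\<lambda>p. frechet_derivative f (at p) (0, 1))"
    unfolding smooth_on_def
  proof
    fix k
    have "Ck_on (Suc k) past f" using * unfolding smooth_on_def by blast
    then show "Ck_on k past (\<lambda>p. frechet_derivative f (at p) (0, 1))" by simp
  qed
qed (use frechet_derivative_periodic[unfolded psmooth_def] in metis)

lemma psmooth_const: "psmooth (\<lambda>_. c)"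
  by (simp add: psmooth_def smooth_on_def Ck_on_const open_past)

lemma psmooth_add: "psmooth f \<Longrightarrow> psmooth g \<Longrightarrow> psmooth (\<lambda>p. f p + g p)"
  by (auto simp: psmooth_def smooth_on_def Ck_on_add open_past)

lemma psmooth_bilinear: "bounded_bilinear b \<Longrightarrow> psmooth f \<Longrightarrow> psmooth g \<Longrightarrow> psmooth (\<lambda>p. b (f p) (g p))"
  by (auto simp: psmooth_def smooth_on_def Ck_on_bilinear open_past)

lemmas psmooth_scaleR = psmooth_bilinear[OF bounded_bilinear_scaleR]
lemmas psmooth_mult = psmooth_bilinear[OF bounded_bilinear_mult]
lemmas psmooth_inner = psmooth_bilinear[OF bounded_bilinear_inner]
lemmas psmooth_cross3 = psmooth_bilinear[OF bounded_bilinear_cross3]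

lemma psmooth_minus: "psmooth f \<Longrightarrow> psmooth (\<lambda>p. - f p)"
  using psmooth_scaleR[OF psmooth_const, of f "-1"] by simp

lemma psmooth_diff: "psmooth f \<Longrightarrow> psmooth g \<Longrightarrow> psmooth (\<lambda>p. f p - g p)"
  using psmooth_add[OF _ psmooth_minus, of f g] by simp

lemma psmooth_power:
  fixes f :: "real \<times> real \<Rightarrow> real"
  shows "psmooth f \<Longrightarrow> psmooth (\<lambda>p. f p ^ n)"
  by (induction n) (auto intro: psmooth_const psmooth_mult)

lemma psmooth_inverse:
  fixes f :: "real \<times> real \<Rightarrow> real"
  shows "psmooth f \<Longrightarrow> (\<And>p. p \<in> past \<Longrightarrow> f p \<noteq> 0) \<Longrightarrow> psmooth (\<lambda>p. inverse (f p))"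
  by (auto simp: psmooth_def smooth_on_def Ck_on_inverse open_past)

lemma psmooth_norm:
  fixes f :: "real \<times> real \<Rightarrow> 'a::real_inner"
  assumes "psmooth f" "\<And>p. p \<in> past \<Longrightarrow> f p \<noteq> 0"
  shows "psmooth (\<lambda>p. norm (f p))"
proof -
  have "psmooth (\<lambda>p. f p \<bullet> f p)" using assms by (intro psmooth_inner)
  then have "psmooth (\<lambda>p. sqrt (f p \<bullet> f p))"
    using assms(2) by (auto simp: psmooth_def smooth_on_def intro!: Ck_on_sqrt open_past)
  then show ?thesis by (simp add: norm_eq_sqrt_inner)
qed

lemma DtI:
  assumes "psmooth f" "t < 0" "((\<lambda>t. f (t, u)) has_vector_derivative X) (at t)"
  shows "Dt f (t, u) = X"
  using vector_derivative_unique_at[OF Dt_has_vector_derivative[OF assms(1,2)] assms(3)] .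

lemma DuI:
  assumes "psmooth f" "t < 0" "((\<lambda>u. f (t, u)) has_vector_derivative X) (at u)"
  shows "Du f (t, u) = X"
  using vector_derivative_unique_at[OF Du_has_vector_derivative[OF assms(1,2)] assms(3)] .

lemma frechet_bilinear:
  assumes "bounded_bilinear b" "f differentiable (at p)" "g differentiable (at p)"
  shows "frechet_derivative (\<lambda>p. b (f p) (g p)) (at p) e =
    b (f p) (frechet_derivative g (at p) e) + b (frechet_derivative f (at p) e) (g p)"
  using frechet_derivative_at[OF bounded_bilinear.FDERIV[OF assms(1)
      assms(2)[unfolded frechet_derivative_works] assms(3)[unfolded frechet_derivative_works]]]
  by metis

lemma Dt_bilinear:
  assumes "bounded_bilinear b" "psmooth f" "psmooth g" "p \<in> past"
  shows "Dt (\<lambda>p. b (f p) (g p)) p = b (f p) (Dt g p) + b (Dt f p) (g p)"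
  unfolding Dt_def using assms by (intro frechet_bilinear psmooth_differentiable)

lemma Du_bilinear:
  assumes "bounded_bilinear b" "psmooth f" "psmooth g" "p \<in> past"
  shows "Du (\<lambda>p. b (f p) (g p)) p = b (f p) (Du g p) + b (Du f p) (g p)"
  unfolding Du_def using assms by (intro frechet_bilinear psmooth_differentiable)

lemma Du_add:
  assumes "psmooth f" "psmooth g" "p \<in> past"
  shows "Du (\<lambda>p. f p + g p) p = Du f p + Du g p"
  unfolding Du_def using assms psmooth_has_derivative has_derivative_add frechet_derivative_at by metis

lemma Dt_const [simp]: "Dt (\<lambda>_. c) p = 0" by (simp add: Dt_def)
lemma Du_const [simp]: "Du (\<lambda>_. c) p = 0" by (simp add: Du_def)

lemma Du_integral:
  fixes f :: "real \<times> real \<Rightarrow> 'b::banach"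
  assumes "psmooth f" "t < 0" "a \<le> b"
  shows "((\<lambda>w. Du f (t, w)) has_integral f (t, b) - f (t, a)) {a..b}"
  using fundamental_theorem_of_calculus[OF assms(3), of "\<lambda>w. f (t, w)" "\<lambda>w. Du f (t, w)"]
    has_vector_derivative_at_within[OF Du_has_vector_derivative[OF assms(1,2)]] by blast

lemma Dt_integral:
  fixes f :: "real \<times> real \<Rightarrow> 'b::banach"
  assumes f: "psmooth f" and t: "t < 0"
  shows "((\<lambda>t. integral {a..b} (\<lambda>w. f (t, w))) has_vector_derivative
    integral {a..b} (\<lambda>w. Dt f (t, w))) (at t)"
proof -
  have "((\<lambda>t. integral (cbox a b) (\<lambda>w. f (t, w))) has_vector_derivative
    integral (cbox a b) (\<lambda>w. Dt f (t, w))) (at t within {..<0})"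
  proof (rule leibniz_rule_vector_derivative)
    show "continuous_on ({..<0} \<times> cbox a b) (\<lambda>(x, t). Dt f (x, t))"
      using continuous_on_subset[OF psmooth_continuous_on[OF psmooth_Dt[OF f]], of "{..<0} \<times> cbox a b"]
      by (auto simp: past_def split_beta)
  next
    fix s w :: real assume "s \<in> {..<0}"
    then show "((\<lambda>t. f (t, w)) has_vector_derivative Dt f (s, w)) (at s within {..<0})"
      using has_vector_derivative_at_within[OF Dt_has_vector_derivative[OF f, of s w]] by auto
  next
    fix s :: real assume "s \<in> {..<0}"
    then show "(\<lambda>w. f (s, w)) integrable_on cbox a b"
      using integrable_continuous[OF psmooth_continuous_slice[OF f, of s "cbox a b"]] by auto
  qed (use t in auto)
  moreover have "at t within {..<0} = at t" using t by (intro at_within_open) auto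
  ultimately show ?thesis by simp
qed

text \<open>Differentiating \<open>f(t, x) - f(t, a) = \<integral> \<partial>\<^sub>u f du\<close> in \<open>t\<close>
  under the integral sign, and then in \<open>x\<close>, gives the symmetry of mixed derivatives.\<close>

lemma Dt_Du_commute:
  fixes f :: "real \<times> real \<Rightarrow> 'b::banach"
  assumes f: "psmooth f" and p: "p \<in> past"
  shows "Dt (Du f) p = Du (Dt f) p"
proof -
  obtain t u where tu: "p = (t, u)" "t < 0" using p by (cases p) auto
  let ?a = "u - 1"
  have eq: "Dt f (t, x) = Dt f (t, ?a) + integral {?a..x} (\<lambda>w. Dt (Du f) (t, w))" if "x \<in> {?a..u+1}" for x
  proof -
    have "integral {?a..x} (\<lambda>w. Du f (s, w)) = f (s, x) - f (s, ?a)" if "s < 0" for s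
      using Du_integral[OF f that] \<open>x \<in> _\<close> by (intro integral_unique) auto
    then have "((\<lambda>s. f (s, x) - f (s, ?a)) has_vector_derivative
        integral {?a..x} (\<lambda>w. Dt (Du f) (t, w))) (at t)"
      using tu by (intro has_vector_derivative_transform_within_open[OF
            Dt_integral[OF psmooth_Du[OF f] tu(2), of ?a x] open_lessThan[of 0]]) auto
    moreover have "((\<lambda>s. f (s, x) - f (s, ?a)) has_vector_derivative Dt f (t, x) - Dt f (t, ?a)) (at t)"
      by (rule has_vector_derivative_diff[OF Dt_has_vector_derivative[OF f tu(2)] Dt_has_vector_derivative[OF f tu(2)]])
    ultimately have "integral {?a..x} (\<lambda>w. Dt (Du f) (t, w)) = Dt f (t, x) - Dt f (t, ?a)"
      by (rule vector_derivative_unique_at)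
    then show ?thesis by simp
  qed
  have "((\<lambda>x. integral {?a..x} (\<lambda>w. Dt (Du f) (t, w))) has_vector_derivative Dt (Du f) (t, u)) (at u within {?a..u+1})"
    by (rule integral_has_vector_derivative[OF psmooth_continuous_slice[OF psmooth_Dt[OF psmooth_Du[OF f]] tu(2)]]) auto
  then have "((\<lambda>x. integral {?a..x} (\<lambda>w. Dt (Du f) (t, w))) has_vector_derivative Dt (Du f) (t, u)) (at u)"
    by (simp add: at_within_Icc_at)
  then have "((\<lambda>x. Dt f (t, ?a) + integral {?a..x} (\<lambda>w. Dt (Du f) (t, w)))
      has_vector_derivative 0 + Dt (Du f) (t, u)) (at u)"
    by (rule has_vector_derivative_add[OF has_vector_derivative_const])
  then have "((\<lambda>x. Dt f (t, x)) has_vector_derivative 0 + Dt (Du f) (t, u)) (at u)"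
    by (rule has_vector_derivative_transform_within_open[where S="{?a<..<u+1}"]) (auto simp: eq[symmetric])
  then show ?thesis
    using DuI[OF psmooth_Dt[OF f] tu(2)] tu(1) by simp
qed

lemma periodic_value:
  fixes h :: "real \<Rightarrow> 'b"
  assumes "\<And>u. h (u + 2 * pi) = h u"
  obtains w where "w \<in> {0..2*pi}" "h w = h u"
proof -
  have int: "h (x + 2 * pi * real n) = h x" for x n
    by (induction n) (simp_all add: algebra_simps assms[of "x + 2 * pi * _", symmetric] del: assms,
      metis (no_types, opaque_lifting) add.assoc add.commute assms mult.commute)
  define n where "n = \<lfloor>u / (2 * pi)\<rfloor>"
  let ?w = "u - 2 * pi * real_of_int n"
  have "real_of_int n \<le> u / (2 * pi)" "u / (2*pi) \<le> real_of_int n + 1" unfolding n_def by linarith+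
  then have "?w \<in> {0..2*pi}" by (auto simp: field_simps)
  moreover have "h ?w = h u"
  proof (cases "n \<ge> 0")
    case True
    then show ?thesis using int[of ?w "nat n"] by simp
  next
    case False
    then show ?thesis using int[of u "nat (-n)"] by simp
  qed
  ultimately show ?thesis using that by blast
qed

lemma psmooth_bounded_slice:
  assumes f: "psmooth f" and t: "t < 0"
  obtains C where "\<And>u. norm (f (t, u)) \<le> C"
proof -
  have "compact ((\<lambda>u. f (t, u)) ` {0..2*pi})"
    using f t by (intro compact_continuous_image psmooth_continuous_slice) auto
  then obtain C where C: "\<forall>y\<in>(\<lambda>u. f (t, u)) ` {0..2*pi}. norm y \<le> C"
    using compact_imp_bounded bounded_iff by metis
  have "norm (f (t, u)) \<le> C" for u
    using periodic_value[of "\<lambda>u. f (t, u)" u] psmooth_periodic[OF f t] C by (metis image_eqI)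
  then show ?thesis using that by blast
qed

section \<open>Curve shortening flow in terms of arclength\<close>

definition speed :: "(real \<times> real \<Rightarrow> real^3) \<Rightarrow> real \<times> real \<Rightarrow> real" where
  "speed F p = norm (Du F p)"

text \<open>The derivative \<open>\<partial>\<^sub>s = v\<^sup>-\<^sup>1 \<partial>\<^sub>u\<close> with respect to the
  arclength of the curve at the same time.\<close>

definition arc_deriv ::
  "(real \<times> real \<Rightarrow> real^3) \<Rightarrow> (real \<times> real \<Rightarrow> 'b::real_normed_vector) \<Rightarrow> real \<times> real \<Rightarrow> 'b" where
  "arc_deriv F f p = inverse (speed F p) *\<^sub>R Du f p"

text \<open>Frenet calculus along a family of immersed curves: \<open>F, T, N\<close> is an orthonormal frame,
  \<open>k\<close> is the geodesic curvature with respect to \<open>N = F \<times> T\<close>, and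
  \<open>\<kappa> m\<close> is its \<open>m\<close>-th arclength derivative.\<close>

locale spherical_curves =
  fixes F :: "real \<times> real \<Rightarrow> real^3"
  assumes F: "psmooth F"
    and sphere: "p \<in> past \<Longrightarrow> norm (F p) = 1"
    and immersed: "p \<in> past \<Longrightarrow> Du F p \<noteq> 0"
begin

abbreviation v where "v \<equiv> speed F"
abbreviation Ds where "Ds \<equiv> arc_deriv F"

definition T where "T = Ds F"
definition N where "N p = cross3 (F p) (T p)"
definition k where "k p = Ds T p \<bullet> N p"
definition \<kappa> where "\<kappa> m = (Ds ^^ m) k"

lemma v_pos: "p \<in> past \<Longrightarrow> v p > 0"
  using immersed by (simp add: speed_def)

lemma psmooth_v: "psmooth v"
  unfolding speed_def[abs_def] using F immersed by (intro psmooth_norm psmooth_Du)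

lemma psmooth_Ds: "psmooth f \<Longrightarrow> psmooth (Ds f)"
  unfolding arc_deriv_def[abs_def]
  by (intro psmooth_scaleR psmooth_inverse psmooth_v psmooth_Du) (auto dest: v_pos)

lemma psmooth_Ds_funpow: "psmooth f \<Longrightarrow> psmooth ((Ds ^^ m) f)"
  by (induction m) (auto intro: psmooth_Ds)

lemma psmooth_T: "psmooth T" unfolding T_def by (intro psmooth_Ds F)
lemma psmooth_N: "psmooth N" unfolding N_def[abs_def] by (intro psmooth_cross3 psmooth_T F)
lemma psmooth_k: "psmooth k" unfolding k_def[abs_def] by (intro psmooth_inner psmooth_Ds psmooth_T psmooth_N)
lemma psmooth_\<kappa>: "psmooth (\<kappa> m)" unfolding \<kappa>_def by (intro psmooth_Ds_funpow psmooth_k)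

lemma \<kappa>_0: "\<kappa> 0 = k" and \<kappa>_Suc: "\<kappa> (Suc m) = Ds (\<kappa> m)"
  by (simp_all add: \<kappa>_def)

lemma Du_eq_Ds: "p \<in> past \<Longrightarrow> Du f p = v p *\<^sub>R Ds f p"
  using v_pos[of p] by (simp add: arc_deriv_def)

lemma Ds_cong: "(\<And>p. p \<in> past \<Longrightarrow> f p = g p) \<Longrightarrow> p \<in> past \<Longrightarrow> Ds f p = Ds g p"
  unfolding arc_deriv_def using Du_cong[of f g p] by simp

lemma Ds_const [simp]: "Ds (\<lambda>_. c) p = 0" by (simp add: arc_deriv_def)

lemma Ds_add:
  "psmooth f \<Longrightarrow> psmooth g \<Longrightarrow> p \<in> past \<Longrightarrow> Ds (\<lambda>p. f p + g p) p = Ds f p + Ds g p"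
  by (simp add: arc_deriv_def Du_add scaleR_add_right)

lemma Ds_bilinear:
  assumes b: "bounded_bilinear b" and "psmooth f" "psmooth g" "p \<in> past"
  shows "Ds (\<lambda>p. b (f p) (g p)) p = b (f p) (Ds g p) + b (Ds f p) (g p)"
  unfolding arc_deriv_def Du_bilinear[OF assms]
  by (simp add: scaleR_add_right bounded_bilinear.scaleR_left[OF b] bounded_bilinear.scaleR_right[OF b])

lemma Ds_inner_const:
  fixes f g :: "real \<times> real \<Rightarrow> real^3"
  assumes "psmooth f" "psmooth g" "\<And>p. p \<in> past \<Longrightarrow> f p \<bullet> g p = c" "p \<in> past"
  shows "f p \<bullet> Ds g p + Ds f p \<bullet> g p = 0"
  using Ds_bilinear[OF bounded_bilinear_inner assms(1,2,4)] Ds_cong[OF assms(3,4)] by simp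

lemma Dt_inner_const:
  fixes f g :: "real \<times> real \<Rightarrow> real^3"
  assumes "psmooth f" "psmooth g" "\<And>p. p \<in> past \<Longrightarrow> f p \<bullet> g p = c" "p \<in> past"
  shows "f p \<bullet> Dt g p + Dt f p \<bullet> g p = 0"
  using Dt_bilinear[OF bounded_bilinear_inner assms(1,2,4)] Dt_cong[OF assms(3,4)] by simp

lemma FF: "p \<in> past \<Longrightarrow> F p \<bullet> F p = 1"
  using sphere by (simp add: dot_square_norm)

lemma TT: "p \<in> past \<Longrightarrow> T p \<bullet> T p = 1"
  using v_pos[of p] by (simp add: T_def arc_deriv_def speed_def dot_square_norm field_simps power2_eq_square)

lemma FT: "p \<in> past \<Longrightarrow> F p \<bullet> T p = 0"
  using Ds_inner_const[OF F F FF] by (simp add: T_def inner_commute)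

lemma NF: "N p \<bullet> F p = 0" and NT: "N p \<bullet> T p = 0"
  by (simp_all add: N_def dot_cross_self)

lemma NN: "p \<in> past \<Longrightarrow> N p \<bullet> N p = 1"
  unfolding N_def using FF TT FT by (simp add: dot_cross)

lemma frame_expand:
  assumes p: "p \<in> past"
  shows "w = (w \<bullet> F p) *\<^sub>R F p + (w \<bullet> T p) *\<^sub>R T p + (w \<bullet> N p) *\<^sub>R N p"
proof -
  let ?w = "w - (w \<bullet> F p) *\<^sub>R F p - (w \<bullet> T p) *\<^sub>R T p"
  have "?w = (?w \<bullet> N p) *\<^sub>R N p"
    by (rule orthonormal_triple_expand[of "F p" "T p" "N p"])
      (use FF[OF p] TT[OF p] FT[OF p] NF[of p] NT[of p] NN[OF p] in
        \<open>auto simp: norm_eq_1 inner_diff_left inner_diff_right inner_commute\<close>)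
  moreover have "?w \<bullet> N p = w \<bullet> N p"
    using NF[of p] NT[of p] by (simp add: inner_diff_left inner_diff_right inner_commute)
  ultimately have "?w = (w \<bullet> N p) *\<^sub>R N p" by simp
  then show ?thesis by (simp add: algebra_simps)
qed

lemma Ds_F: "Ds F p = T p" by (simp add: T_def)

lemma Ds_T:
  assumes p: "p \<in> past"
  shows "Ds T p = k p *\<^sub>R N p - F p"
proof -
  have "F p \<bullet> Ds T p = - 1"
    using Ds_inner_const[OF F psmooth_T FT p] TT[OF p] by (simp add: Ds_F)
  moreover have "T p \<bullet> Ds T p = 0"
    using Ds_inner_const[OF psmooth_T psmooth_T TT p] by (simp add: inner_commute)
  ultimately show ?thesis
    using frame_expand[OF p, of "Ds T p"] by (simp add: k_def inner_commute)
qed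

lemma Ds_N:
  assumes p: "p \<in> past"
  shows "Ds N p = - k p *\<^sub>R T p"
proof -
  have "N p \<bullet> Ds N p = 0"
    using Ds_inner_const[OF psmooth_N psmooth_N NN p] by (simp add: inner_commute)
  moreover have "F p \<bullet> Ds N p = 0"
    using Ds_inner_const[OF psmooth_N F NF p] NT[of p] by (simp add: Ds_F inner_commute)
  moreover have "T p \<bullet> Ds N p = - k p"
    using Ds_inner_const[OF psmooth_N psmooth_T NT p] by (simp add: k_def inner_commute)
  ultimately show ?thesis
    using frame_expand[OF p, of "Ds N p"] by (simp add: inner_commute)
qed

end

text \<open>The right-hand side is \<open>k N\<close>, but in this form the equation refers to no choice of a normal.\<close>

locale spherical_flow = spherical_curves +
  assumes flow: "p \<in> past \<Longrightarrow> Dt F p = arc_deriv F (arc_deriv F F) p + F p"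
begin

lemma Dt_F: "p \<in> past \<Longrightarrow> Dt F p = k p *\<^sub>R N p"
  using flow[of p] Ds_T[of p] by (simp add: T_def)

lemma psmooth_kN: "psmooth (\<lambda>p. k p *\<^sub>R N p)"
  by (intro psmooth_scaleR psmooth_k psmooth_N)

lemma Ds_kN:
  assumes p: "p \<in> past"
  shows "Ds (\<lambda>p. k p *\<^sub>R N p) p = \<kappa> 1 p *\<^sub>R N p - (k p)\<^sup>2 *\<^sub>R T p"
  using Ds_bilinear[OF bounded_bilinear_scaleR psmooth_k psmooth_N p] Ds_N[OF p]
  by (simp add: \<kappa>_def power2_eq_square)

text \<open>Differentiate \<open>v\<^sup>2 = \<partial>\<^sub>uF \<bullet> \<partial>\<^sub>uF\<close> in time and use
  \<open>\<partial>\<^sub>t\<partial>\<^sub>uF = \<partial>\<^sub>u(k N)\<close>, whose tangential part is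
  \<open>- k\<^sup>2 v T\<close>.\<close>

lemma Dt_v:
  assumes p: "p \<in> past"
  shows "Dt v p = - (k p)\<^sup>2 * v p"
proof -
  have "Dt (Du F) p = Du (\<lambda>p. k p *\<^sub>R N p) p"
    using Dt_Du_commute[OF F p] Du_cong[OF Dt_F p] by simp
  also have "\<dots> = v p *\<^sub>R (\<kappa> 1 p *\<^sub>R N p - (k p)\<^sup>2 *\<^sub>R T p)"
    using Du_eq_Ds[OF p] Ds_kN[OF p] by metis
  finally have 1: "Dt (Du F) p \<bullet> Du F p = - (k p)\<^sup>2 * (v p)\<^sup>2"
    using Du_eq_Ds[OF p, of F] NT[of p] TT[OF p]
    by (simp add: Ds_F inner_diff_left power2_eq_square)
  have "Dt (\<lambda>p. v p * v p) p = 2 * v p * Dt v p"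
    using Dt_bilinear[OF bounded_bilinear_mult psmooth_v psmooth_v p] by simp
  moreover have "Dt (\<lambda>p. v p * v p) p = 2 * (Dt (Du F) p \<bullet> Du F p)"
    using Dt_bilinear[OF bounded_bilinear_inner psmooth_Du[OF F] psmooth_Du[OF F] p]
    by (simp add: speed_def power2_eq_square[symmetric] power2_norm_eq_inner inner_commute)
  ultimately have "v p * Dt v p = v p * (- (k p)\<^sup>2 * v p)"
    using 1 by (simp add: power2_eq_square algebra_simps)
  then show ?thesis using v_pos[OF p] by (metis less_irrefl mult_left_cancel)
qed

text \<open>Arclength depends on time, so its derivative does not commute with that of time; the commutator
  \<open>k\<^sup>2 \<partial>\<^sub>s\<close> comes from the evolution of the speed.\<close>

lemma Dt_Ds:
  fixes f :: "real \<times> real \<Rightarrow> 'b::banach"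
  assumes f: "psmooth f" and p: "p \<in> past"
  shows "Dt (Ds f) p = Ds (Dt f) p + (k p)\<^sup>2 *\<^sub>R Ds f p"
proof -
  have "v p *\<^sub>R Ds (Dt f) p = Dt (Du f) p"
    using Dt_Du_commute[OF f p] Du_eq_Ds[OF p] by metis
  also have "\<dots> = Dt (\<lambda>p. v p *\<^sub>R Ds f p) p"
    using Dt_cong[OF Du_eq_Ds p] .
  also have "\<dots> = v p *\<^sub>R (Dt (Ds f) p - (k p)\<^sup>2 *\<^sub>R Ds f p)"
    using Dt_bilinear[OF bounded_bilinear_scaleR psmooth_v psmooth_Ds[OF f] p] Dt_v[OF p]
    by (simp add: algebra_simps)
  finally show ?thesis using v_pos[OF p] by simp
qed

text \<open>The reaction term has two sources: the commutator contributes \<open>k\<^sup>3\<close> and the curvature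
  \<open>1\<close> of the sphere contributes \<open>k\<close>.\<close>

lemma Dt_k:
  assumes p: "p \<in> past"
  shows "Dt k p = \<kappa> 2 p + (k p) ^ 3 + k p"
proof -
  have DtT: "Dt T q = \<kappa> 1 q *\<^sub>R N q" if q: "q \<in> past" for q
    using Dt_Ds[OF F q] Ds_cong[OF Dt_F q] Ds_kN[OF q] by (simp add: T_def)
  have "Ds (Dt T) p = Ds (\<lambda>q. \<kappa> 1 q *\<^sub>R N q) p" by (rule Ds_cong[OF DtT p])
  also have "\<dots> = \<kappa> 1 p *\<^sub>R (- k p *\<^sub>R T p) + \<kappa> 2 p *\<^sub>R N p"
    using Ds_bilinear[OF bounded_bilinear_scaleR psmooth_\<kappa> psmooth_N p, of 1] Ds_N[OF p] \<kappa>_Suc[of 1]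
    by (simp add: numeral_2_eq_2)
  finally have 1: "Dt (Ds T) p \<bullet> N p = \<kappa> 2 p + (k p)\<^sup>2 * k p"
    using Dt_Ds[OF psmooth_T p] NN[OF p] NT[of p]
    by (simp add: inner_add_right inner_diff_right inner_commute k_def)
  have "N p \<bullet> Dt N p = 0"
    using Dt_inner_const[OF psmooth_N psmooth_N NN p] by (simp add: inner_commute)
  moreover have "F p \<bullet> Dt N p = - k p"
    using Dt_inner_const[OF psmooth_N F NF p] Dt_F[OF p] NN[OF p] by (simp add: inner_commute)
  ultimately have "Ds T p \<bullet> Dt N p = k p"
    using Ds_T[OF p] by (simp add: inner_diff_left)
  then show ?thesis
    using Dt_bilinear[OF bounded_bilinear_inner psmooth_Ds[OF psmooth_T] psmooth_N p] 1
    by (simp add: k_def[abs_def] power3_eq_cube power2_eq_square)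
qed

end

section \<open>Integrals along the curve\<close>

context spherical_flow
begin

text \<open>The integral with respect to arclength \<open>ds = v du\<close> over the curve at time \<open>t\<close>.\<close>

definition I where "I f t = integral {0..2*pi} (\<lambda>u. f (t, u) * v (t, u))"

lemma v_slice: "t < 0 \<Longrightarrow> continuous_on A (\<lambda>u. v (t, u))"
  by (rule psmooth_continuous_slice[OF psmooth_v])

lemma I_integrable:
  assumes "t < 0" "continuous_on UNIV (\<lambda>u. f (t, u))"
  shows "(\<lambda>u. f (t, u) * v (t, u)) integrable_on {a..b}"
  using assms v_slice[OF assms(1)]
  by (intro integrable_continuous_interval continuous_on_mult) (auto intro: continuous_on_subset)

lemma I_mono:
  assumes "t < 0" "continuous_on UNIV (\<lambda>u. f (t, u))" "continuous_on UNIV (\<lambda>u. g (t, u))"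
    and "\<And>u. f (t, u) \<le> g (t, u)"
  shows "I f t \<le> I g t"
  unfolding I_def using assms v_pos[of "(t, _)"]
  by (intro integral_le I_integrable mult_right_mono) (auto simp: less_imp_le)

lemma I_add:
  assumes "t < 0" "continuous_on UNIV (\<lambda>u. f (t, u))" "continuous_on UNIV (\<lambda>u. g (t, u))"
  shows "I (\<lambda>p. f p + g p) t = I f t + I g t"
  unfolding I_def distrib_right using assms by (intro integral_add I_integrable)

lemma I_cmul: "I (\<lambda>p. c * f p) t = c * I f t"
  unfolding I_def by (simp add: mult.assoc)

lemma I_nonneg:
  assumes "t < 0" "\<And>u. 0 \<le> f (t, u)"
  shows "0 \<le> I f t"
proof (cases "(\<lambda>u. f (t, u) * v (t, u)) integrable_on {0..2*pi}")
  case True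
  then show ?thesis unfolding I_def using assms v_pos[of "(t, _)"]
    by (intro integral_nonneg) (auto simp: less_imp_le)
qed (simp add: I_def not_integrable_integral)

lemma I_cong: "t < 0 \<Longrightarrow> (\<And>p. p \<in> past \<Longrightarrow> f p = g p) \<Longrightarrow> I f t = I g t"
  unfolding I_def by (intro integral_cong) auto

text \<open>The term \<open>- k\<^sup>2 f\<close> accounts for the shrinking of the arclength element.\<close>

lemma I_deriv:
  assumes f: "psmooth f" and t: "t < 0"
  shows "(I f has_real_derivative I (\<lambda>p. Dt f p - (k p)\<^sup>2 * f p) t) (at t)"
proof -
  have "((\<lambda>t. integral {0..2*pi} (\<lambda>w. f (t, w) * v (t, w))) has_vector_derivative
    integral {0..2*pi} (\<lambda>w. Dt (\<lambda>p. f p * v p) (t, w))) (at t)"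
    by (rule Dt_integral[OF psmooth_mult[OF f psmooth_v] t])
  moreover have "Dt (\<lambda>p. f p * v p) (t, w) = (Dt f (t, w) - (k (t, w))\<^sup>2 * f (t, w)) * v (t, w)" for w
    using Dt_bilinear[OF bounded_bilinear_mult f psmooth_v, of "(t, w)"] Dt_v[of "(t, w)"] t
    by (simp add: algebra_simps)
  ultimately show ?thesis
    by (simp add: I_def[abs_def] has_real_derivative_iff_has_vector_derivative)
qed

lemma I_Ds:
  assumes f: "psmooth f" and t: "t < 0"
  shows "I (Ds f) t = 0"
proof -
  have "Ds f (t, w) * v (t, w) = Du f (t, w)" for w
    using Du_eq_Ds[of "(t, w)" f] t by (simp add: mult.commute)
  moreover have "f (t, 2 * pi) = f (t, 0)" using psmooth_periodic[OF f t, of 0] by simp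
  ultimately show ?thesis
    using integral_unique[OF Du_integral[OF f t, of 0 "2*pi"]] by (simp add: I_def)
qed

lemma I_by_parts:
  assumes f: "psmooth f" and g: "psmooth g" and t: "t < 0"
  shows "I (\<lambda>p. f p * Ds g p) t = - I (\<lambda>p. Ds f p * g p) t"
proof -
  have "0 = I (\<lambda>p. f p * Ds g p + Ds f p * g p) t"
    using I_Ds[OF psmooth_mult[OF f g] t] I_cong[OF t Ds_bilinear[OF bounded_bilinear_mult f g]] by simp
  also have "\<dots> = I (\<lambda>p. f p * Ds g p) t + I (\<lambda>p. Ds f p * g p) t"
    using t by (intro I_add psmooth_continuous_slice[OF psmooth_mult] psmooth_Ds f g)
  finally show ?thesis by simp
qed

text \<open>Going back in time the curve only gets longer. This is the source of the uniform constants in the Sobolev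
  inequalities below.\<close>

lemma v_antimono:
  assumes "s \<le> t" "t < 0"
  shows "v (t, u) \<le> v (s, u)"
proof (rule DERIV_nonpos_imp_nonincreasing[OF assms(1)])
  fix x assume "s \<le> x" "x \<le> t"
  then have x: "x < 0" using assms by simp
  have "((\<lambda>s. v (s, u)) has_real_derivative - (k (x, u))\<^sup>2 * v (x, u)) (at x)"
    using Dt_has_vector_derivative[OF psmooth_v x, of u] Dt_v[of "(x, u)"] x
    by (simp add: has_real_derivative_iff_has_vector_derivative)
  moreover have "- (k (x, u))\<^sup>2 * v (x, u) \<le> 0" using v_pos[of "(x, u)"] x by (simp add: mult_nonpos_nonneg)
  ultimately show "\<exists>y. ((\<lambda>a. v (a, u)) has_real_derivative y) (at x) \<and> y \<le> 0" by blast
qed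

text \<open>The length at time \<open>-1\<close>, a lower bound for the length at all earlier times.\<close>

definition len where "len = I (\<lambda>_. 1) (-1)"

lemma len_pos: "0 < len"
proof -
  obtain x where x: "x \<in> {0..2*pi}" "\<And>y. y \<in> {0..2*pi} \<Longrightarrow> v (-1, x) \<le> v (-1, y)"
    using continuous_attains_inf[OF _ _ v_slice[of "-1" "{0..2*pi}"]] by fastforce
  have "0 < 2 * pi * v (-1, x)" using v_pos[of "(-1, x)"] by simp
  also have "\<dots> = integral {0..2*pi} (\<lambda>u. v (-1, x))" by simp
  also have "\<dots> \<le> len"
    unfolding len_def I_def using x(2)
    by (intro integral_le integrable_continuous_interval continuous_intros v_slice) auto
  finally show ?thesis .
qed

lemma len_le: "t \<le> -1 \<Longrightarrow> len \<le> I (\<lambda>_. 1) t"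
  unfolding len_def I_def using v_antimono[of t "-1"]
  by (intro integral_le integrable_continuous_interval continuous_intros v_slice) auto

text \<open>A Sobolev inequality on the curve whose constants do not depend on time. The oscillation of
  \<open>f\<^sup>2\<close> is at most \<open>\<integral> 2 \<bar>f\<bar> \<bar>f\<^sub>s\<bar> ds\<close>,
  which is split with weight \<open>\<eta>\<close>; then \<open>f\<^sup>2\<close> is compared with its
  average. The free parameter is what makes the inequality interpolate.\<close>

lemma square_le_integrals:
  fixes f :: "real \<times> real \<Rightarrow> real"
  assumes f: "psmooth f" and t: "t \<le> -1" and \<eta>: "\<eta> > 0"
  shows "(f (t, x))\<^sup>2 \<le> I (\<lambda>p. (f p)\<^sup>2) t / len + (\<eta> * I (\<lambda>p. (f p)\<^sup>2) t + I (\<lambda>p. (Ds f p)\<^sup>2) t / \<eta>)"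
proof -
  have t0: "t < 0" using t by simp
  define g where "g p = \<eta> * (f p)\<^sup>2 + (Ds f p)\<^sup>2 / \<eta>" for p
  define J where "J = I g t"
  have g: "psmooth g"
    unfolding g_def[abs_def] divide_inverse
    by (intro psmooth_add psmooth_mult psmooth_power psmooth_const psmooth_Ds f)
  have cont: "psmooth h \<Longrightarrow> continuous_on A (\<lambda>u. h (t, u))" for A and h :: "real \<times> real \<Rightarrow> real"
    by (rule psmooth_continuous_slice[OF _ t0])
  have J: "J = \<eta> * I (\<lambda>p. (f p)\<^sup>2) t + I (\<lambda>p. (Ds f p)\<^sup>2) t / \<eta>"
  proof -
    have "J = I (\<lambda>p. \<eta> * (f p)\<^sup>2 + inverse \<eta> * (Ds f p)\<^sup>2) t"
      unfolding J_def g_def[abs_def] by (simp add: field_simps)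
    also have "\<dots> = I (\<lambda>p. \<eta> * (f p)\<^sup>2) t + I (\<lambda>p. inverse \<eta> * (Ds f p)\<^sup>2) t"
      by (intro I_add t0 cont psmooth_mult psmooth_power psmooth_const psmooth_Ds f)
    finally show ?thesis unfolding I_cmul by (simp add: divide_inverse mult.commute)
  qed
  have nn: "0 \<le> g (t, w) * v (t, w)" for w
    using \<eta> v_pos[of "(t, w)"] t0 by (simp add: g_def)
  have exp_bounded: "\<bar>2 * f (t, w) * Du f (t, w)\<bar> \<le> g (t, w) * v (t, w)" for w
  proof -
    have "0 \<le> (sqrt \<eta> * \<bar>f (t, w)\<bar> - \<bar>Ds f (t, w)\<bar> / sqrt \<eta>)\<^sup>2" by simp
    also have "\<dots> = g (t, w) - 2 * \<bar>f (t, w)\<bar> * \<bar>Ds f (t, w)\<bar>"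
      using \<eta> by (simp add: power2_diff g_def power_mult_distrib power_divide)
    finally have "2 * \<bar>f (t, w)\<bar> * \<bar>Ds f (t, w)\<bar> * v (t, w) \<le> g (t, w) * v (t, w)"
      using v_pos[of "(t, w)"] t0 by (intro mult_right_mono) auto
    then show ?thesis
      using Du_eq_Ds[of "(t, w)" f] v_pos[of "(t, w)"] t0 by (simp add: abs_mult mult_ac)
  qed
  have gi: "(\<lambda>w. g (t, w) * v (t, w)) integrable_on {a..b}" for a b
    by (intro I_integrable t0 cont g)
  have osc: "\<bar>(f (t, b))\<^sup>2 - (f (t, a))\<^sup>2\<bar> \<le> J" if "0 \<le> a" "a \<le> b" "b \<le> 2 * pi" for a b
  proof -
    have ff: "psmooth (\<lambda>p. f p * f p)" by (intro psmooth_mult f)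
    have d: "Du (\<lambda>p. f p * f p) (t, w) = 2 * f (t, w) * Du f (t, w)" for w
      using Du_bilinear[OF bounded_bilinear_mult f f, of "(t, w)"] t0 by simp
    have hi: "((\<lambda>w. 2 * f (t, w) * Du f (t, w)) has_integral (f (t, b))\<^sup>2 - (f (t, a))\<^sup>2) {a..b}"
      using Du_integral[OF ff t0 that(2)] unfolding d by (simp add: power2_eq_square)
    have "\<bar>(f (t, b))\<^sup>2 - (f (t, a))\<^sup>2\<bar> \<le> integral {a..b} (\<lambda>w. g (t, w) * v (t, w))"
      using integral_norm_bound_integral[OF has_integral_integrable[OF hi] gi] exp_bounded integral_unique[OF hi] by simp
    also have "\<dots> \<le> J"
      unfolding J_def I_def using that nn gi by (intro integral_subset_le) auto
    finally show ?thesis .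
  qed
  have main: "(f (t, x))\<^sup>2 \<le> I (\<lambda>p. (f p)\<^sup>2) t / len + J" if x: "x \<in> {0..2*pi}" for x
  proof -
    have *: "(f (t, x))\<^sup>2 \<le> (f (t, y))\<^sup>2 + J" if y: "y \<in> {0..2*pi}" for y
      using osc[of x y] osc[of y x] x y by (cases "x \<le> y") auto
    have L: "I (\<lambda>_. 1) t > 0" using len_le[OF t] len_pos by simp
    have "((f (t, x))\<^sup>2 - J) * I (\<lambda>_. 1) t = integral {0..2*pi} (\<lambda>y. ((f (t, x))\<^sup>2 - J) * v (t, y))"
      unfolding I_def by simp
    also have "\<dots> \<le> I (\<lambda>p. (f p)\<^sup>2) t"
      unfolding I_def
    proof (intro integral_le)
      show "(\<lambda>y. ((f (t, x))\<^sup>2 - J) * v (t, y)) integrable_on {0..2*pi}"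
        by (intro integrable_continuous_interval continuous_intros v_slice t0)
      show "(\<lambda>u. (f (t, u))\<^sup>2 * v (t, u)) integrable_on {0..2 * pi}"
        by (intro I_integrable[where f="\<lambda>p. (f p)\<^sup>2"] t0 cont psmooth_power f)
      fix y assume "y \<in> {0..2*pi}"
      then show "((f (t, x))\<^sup>2 - J) * v (t, y) \<le> (f (t, y))\<^sup>2 * v (t, y)"
        using *[of y] v_pos[of "(t, y)"] t0 by (intro mult_right_mono) auto
    qed
    finally have "(f (t, x))\<^sup>2 - J \<le> I (\<lambda>p. (f p)\<^sup>2) t / I (\<lambda>_. 1) t"
      using L by (simp add: pos_le_divide_eq)
    also have "\<dots> \<le> I (\<lambda>p. (f p)\<^sup>2) t / len"
      using len_le[OF t] len_pos L I_nonneg[OF t0, of "\<lambda>p. (f p)\<^sup>2"] by (intro divide_left_mono) auto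
    finally show ?thesis by simp
  qed
  obtain w where "w \<in> {0..2*pi}" "f (t, w) = f (t, x)"
    using periodic_value[of "\<lambda>u. f (t, u)" x] psmooth_periodic[OF f t0] by metis
  then show ?thesis using main[of w] J by simp
qed

definition E where "E m = I (\<lambda>p. (\<kappa> m p)\<^sup>2)"

text \<open>The nonlinear part of the evolution equation of \<open>\<kappa> m\<close>, whose linear part is
  \<open>\<partial>\<^sub>s\<^sup>2 + 1\<close>.\<close>

definition P where "P m p = Dt (\<kappa> m) p - \<kappa> (m + 2) p - \<kappa> m p"

lemma psmooth_P: "psmooth (P m)"
  unfolding P_def[abs_def] by (intro psmooth_diff psmooth_Dt psmooth_\<kappa>)

lemma E_nonneg: "t < 0 \<Longrightarrow> 0 \<le> E m t"
  unfolding E_def by (rule I_nonneg) auto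

lemma \<kappa>_square_le:
  assumes "t \<le> -1"
  shows "(\<kappa> m (t, u))\<^sup>2 \<le> (1 / len + 1) * (E m t + E (m + 1) t)"
proof -
  have "0 \<le> E (m + 1) t" using assms by (intro E_nonneg) auto
  then have "0 \<le> E (m + 1) t / len" using len_pos by simp
  then show ?thesis
    using square_le_integrals[OF psmooth_\<kappa> assms, of 1 m u]
    by (simp add: E_def \<kappa>_Suc algebra_simps)
qed

text \<open>Integration by parts turns the diffusion term into the dissipation
  \<open>- 2 E\<^sub>m\<^sub>+\<^sub>1\<close>.\<close>

lemma E_deriv:
  assumes t: "t < 0"
  shows "(E m has_real_derivative
    - 2 * E (m + 1) t + 2 * E m t + I (\<lambda>p. 2 * \<kappa> m p * P m p - (k p)\<^sup>2 * (\<kappa> m p)\<^sup>2) t) (at t)"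
proof -
  note c = psmooth_continuous_slice[OF _ t]
  note s = psmooth_add psmooth_diff psmooth_mult psmooth_power psmooth_\<kappa> psmooth_k psmooth_P psmooth_const
  have sq: "Dt (\<lambda>p. (\<kappa> m p)\<^sup>2) p = 2 * \<kappa> m p * Dt (\<kappa> m) p" if "p \<in> past" for p
    using Dt_bilinear[OF bounded_bilinear_mult psmooth_\<kappa> psmooth_\<kappa> that, of m m]
    by (simp add: power2_eq_square)
  have "I (\<lambda>p. Dt (\<lambda>p. (\<kappa> m p)\<^sup>2) p - (k p)\<^sup>2 * (\<kappa> m p)\<^sup>2) t =
     I (\<lambda>p. 2 * (\<kappa> m p * \<kappa> (m + 2) p) + (2 * (\<kappa> m p)\<^sup>2 +
       (2 * \<kappa> m p * P m p - (k p)\<^sup>2 * (\<kappa> m p)\<^sup>2))) t"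
    using t sq by (intro I_cong) (auto simp: P_def power2_eq_square algebra_simps)
  also have "\<dots> = I (\<lambda>p. 2 * (\<kappa> m p * \<kappa> (m + 2) p)) t + (I (\<lambda>p. 2 * (\<kappa> m p)\<^sup>2) t +
       I (\<lambda>p. 2 * \<kappa> m p * P m p - (k p)\<^sup>2 * (\<kappa> m p)\<^sup>2) t)"
    by (subst I_add[OF t] I_add[OF t], (intro c s)+, rule arg_cong2[where f="(+)", OF refl],
        subst I_add[OF t], (intro c s)+, rule refl)
  also have "I (\<lambda>p. 2 * (\<kappa> m p)\<^sup>2) t = 2 * E m t"
    unfolding I_cmul E_def ..
  also have "I (\<lambda>p. 2 * (\<kappa> m p * \<kappa> (m + 2) p)) t = - 2 * E (m + 1) t"
    unfolding I_cmul E_def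
    using I_by_parts[OF psmooth_\<kappa> psmooth_\<kappa> t, of m "m + 1"] \<kappa>_Suc[of m] \<kappa>_Suc[of "m + 1"]
    by (simp add: power2_eq_square)
  finally have eq: "I (\<lambda>p. Dt (\<lambda>p. (\<kappa> m p)\<^sup>2) p - (k p)\<^sup>2 * (\<kappa> m p)\<^sup>2) t =
      - 2 * E (m + 1) t + (2 * E m t + I (\<lambda>p. 2 * \<kappa> m p * P m p - (k p)\<^sup>2 * (\<kappa> m p)\<^sup>2) t)" .
  show ?thesis
    by (rule DERIV_cong[OF I_deriv[OF psmooth_power[OF psmooth_\<kappa>, of m 2] t, folded E_def]])
      (simp add: eq)
qed

text \<open>The evolution of the arclength element cancels the cubic term, and \<open>k\<^sub>s\<^sub>s\<close>
  integrates to zero. What remains is a linear equation, due to the curvature of the sphere.\<close>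

lemma total_curvature:
  assumes t: "t < 0"
  shows "I k t = I k (-1) * exp (t + 1)"
proof -
  have d: "(I k has_real_derivative I k t) (at t)" if "t < 0" for t
  proof -
    have "I (\<lambda>p. Dt k p - (k p)\<^sup>2 * k p) t = I (\<lambda>p. Ds (\<kappa> 1) p + k p) t"
      using that Dt_k \<kappa>_Suc[of 1] by (intro I_cong) (auto simp: power3_eq_cube power2_eq_square numeral_2_eq_2)
    also have "\<dots> = I k t"
      using I_add[OF that psmooth_continuous_slice[OF psmooth_Ds[OF psmooth_\<kappa>] that, of UNIV 1]
          psmooth_continuous_slice[OF psmooth_k that]] I_Ds[OF psmooth_\<kappa> that] by simp
    finally show ?thesis using I_deriv[OF psmooth_k that] by simp
  qed
  have d0: "((\<lambda>t. I k t * exp (- t)) has_real_derivative 0) (at x)" if "x < 0" for x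
    using d[OF that] by (auto intro!: derivative_eq_intros)
  obtain c where c: "\<And>x. x \<in> {..<0} \<Longrightarrow> I k x * exp (- x) = c"
  proof (rule DERIV_zero_connected_constant[where S="{..<0}" and K="{}" and f="\<lambda>t. I k t * exp (- t)"])
    show "\<forall>x\<in>{..<0} - {}. ((\<lambda>t. I k t * exp (- t)) has_real_derivative 0) (at x)" using d0 by auto
    show "continuous_on {..<0} (\<lambda>t. I k t * exp (- t))"
      using d0 by (intro continuous_at_imp_continuous_on) (auto intro: DERIV_isCont)
  qed auto
  have "I k t * exp (- t) = I k (-1) * exp 1" using c[of t] c[of "-1"] t by simp
  then show ?thesis by (simp add: exp_add exp_minus field_simps)
qed

end

section \<open>Differential inequalities on a past half-line\<close>

text \<open>Above the bound the right-hand side is at most \<open>- (a/2) y\<^sup>3\<close>. So once \<open>y\<close> is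
  above it at some time, it is above it at all earlier times, and \<open>y\<^sup>-\<^sup>2\<close> decreases
  at a definite rate towards the past until it becomes negative, which is absurd.\<close>

lemma ancient_cubic_inequality_bounded:
  fixes y :: "real \<Rightarrow> real"
  assumes d: "\<And>t. t \<le> t1 \<Longrightarrow> (y has_real_derivative y' t) (at t)"
    and le: "\<And>t. t \<le> t1 \<Longrightarrow> y' t \<le> C - a * y t ^ 3"
    and a: "a > 0" and C: "C \<ge> 0" and t: "t \<le> t1"
  shows "y t \<le> 1 + 2 * C / a"
proof (rule ccontr)
  define B where "B = 1 + 2 * C / a"
  assume "\<not> ?thesis"
  then have yt: "y t > B" by (simp add: B_def)
  have B1: "B \<ge> 1" using a C by (simp add: B_def)
  have above: "y' s \<le> - (a / 2) * y s ^ 3" "y' s < 0" if "s \<le> t1" "y s > B" for s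
  proof -
    have "2 * C \<le> a * B" using a by (simp add: B_def field_simps)
    also have "a * B \<le> a * y s ^ 3"
    proof (intro mult_left_mono)
      have "B * 1 \<le> y s * (y s)\<^sup>2" using that B1 by (intro mult_mono) auto
      then show "B \<le> y s ^ 3" by (simp add: power3_eq_cube power2_eq_square)
    qed (use a in auto)
    finally show *: "y' s \<le> - (a / 2) * y s ^ 3" using le[OF that(1)] by simp
    have "0 < (a / 2) * y s ^ 3" using a that B1 by auto
    then show "y' s < 0" using * by simp
  qed
  have cont: "continuous_on A y" if "A \<subseteq> {..t1}" for A
    using d that by (intro continuous_at_imp_continuous_on) (auto intro: DERIV_isCont)
  have gtB: "y s > B" if s: "s \<le> t" for s
  proof (rule ccontr)
    assume "\<not> y s > B"
    define S where "S = {x \<in> {s..t}. y x \<le> B}"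
    have "closed S"
      unfolding S_def using cont[of "{s..t}"] t
      by (intro continuous_closed_preimage[of "{s..t}" y "{..B}", unfolded vimage_def Int_def, simplified]
           continuous_on_closed_Collect_le) auto
    moreover have "S \<noteq> {}" "bdd_above S" using \<open>\<not> y s > B\<close> s by (auto simp: S_def bdd_above_def)
    ultimately have "Sup S \<in> S" by (intro closed_contains_Sup)
    then have S: "s \<le> Sup S" "Sup S \<le> t" "y (Sup S) \<le> B" by (auto simp: S_def)
    have "y x > B" if "Sup S < x" "x \<le> t" for x
      using cSup_upper[OF _ \<open>bdd_above S\<close>, of x] that S unfolding S_def by force
    then have "y t \<le> y (Sup S)"
      using S t above(2) d cont[of "{Sup S..t}"]
      by (cases "Sup S = t")
        (auto intro!: less_imp_le DERIV_neg_imp_decreasing_open[of "Sup S" t y],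
         metis less_imp_le order_trans)
    then show False using S(3) yt by simp
  qed
  \<comment> \<open>Nondecreasing because \<open>(y\<^sup>-\<^sup>2)' = - 2 y' / y\<^sup>3 \<ge> a\<close>, yet larger than \<open>- a s\<close>.\<close>
  define q where "q s = inverse ((y s)\<^sup>2) - a * s" for s
  have qm: "q s \<le> q t" if s: "s \<le> t" for s
  proof (rule DERIV_nonneg_imp_nondecreasing[OF s])
    fix x assume "s \<le> x" "x \<le> t"
    then have x: "x \<le> t1" "x \<le> t" using t by auto
    have y0: "y x > 0" using gtB[OF x(2)] B1 by simp
    have "(q has_real_derivative - 2 * y' x / (y x) ^ 3 - a) (at x)"
      unfolding q_def[abs_def] using y0 d[OF x(1)]
      by (auto intro!: derivative_eq_intros simp: field_simps power2_eq_square power3_eq_cube)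
    moreover have "a \<le> - 2 * y' x / (y x) ^ 3"
      using above(1)[OF x(1) gtB[OF x(2)]] y0 by (intro pos_le_divide_eq[THEN iffD2]) auto
    ultimately show "\<exists>D. (q has_real_derivative D) (at x) \<and> 0 \<le> D" by force
  qed
  define s where "s = min t (- \<bar>q t\<bar> / a - 1)"
  have "q s \<le> q t" by (rule qm) (simp add: s_def)
  moreover have "q s \<ge> - a * s" by (simp add: q_def)
  moreover have "- a * s > q t"
  proof -
    have "a * s \<le> a * (- \<bar>q t\<bar> / a - 1)" using a by (intro mult_left_mono) (auto simp: s_def)
    also have "\<dots> = - \<bar>q t\<bar> - a" using a by (simp add: field_simps)
    finally show ?thesis using a by linarith
  qed
  ultimately show False by linarith
qed

text \<open>Over a unit time interval the dissipation \<open>- e1\<close> of \<open>e0\<close> controls the integral of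
  \<open>e1\<close>, hence, as \<open>e1\<close> grows at most exponentially, its final value.\<close>

lemma parabolic_smoothing:
  fixes e0 e1 :: "real \<Rightarrow> real"
  assumes d0: "\<And>t. t \<le> t1 \<Longrightarrow> \<exists>d. (e0 has_real_derivative d) (at t) \<and> d \<le> - e1 t + C * exp (2 * t)"
    and d1: "\<And>t. t \<le> t1 \<Longrightarrow> \<exists>d. (e1 has_real_derivative d) (at t) \<and> d \<le> 3 * e1 t + C * exp (2 * t)"
    and e0: "\<And>t. t \<le> t1 \<Longrightarrow> 0 \<le> e0 t \<and> e0 t \<le> C * exp (2 * t)"
    and e1: "\<And>t. t \<le> t1 \<Longrightarrow> 0 \<le> e1 t" and C: "0 \<le> C" and t: "t \<le> t1"
  shows "e1 t \<le> 7 * C * exp (2 * t)"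
proof -
  \<comment> \<open>The weight of \<open>e1\<close> vanishes at time \<open>t - 1\<close>; the factor \<open>4\<close> lets the dissipation of \<open>e0\<close>
    absorb the derivative of this weight and the growth \<open>3 e1\<close>.\<close>
  define Q where "Q s = (s - t + 1) * e1 s + 4 * e0 s - 3 * C * exp (2 * s)" for s
  have "Q t \<le> Q (t - 1)"
  proof (rule DERIV_nonpos_imp_nonincreasing[where f=Q and a="t - 1" and b=t])
    fix x assume x: "t - 1 \<le> x" "x \<le> t"
    then have xt: "x \<le> t1" using t by simp
    obtain a where a: "(e0 has_real_derivative a) (at x)" "a \<le> - e1 x + C * exp (2 * x)"
      using d0[OF xt] by blast
    obtain b where b: "(e1 has_real_derivative b) (at x)" "b \<le> 3 * e1 x + C * exp (2 * x)"
      using d1[OF xt] by blast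
    have "(Q has_real_derivative e1 x + (x - t + 1) * b + 4 * a - 6 * C * exp (2 * x)) (at x)"
      unfolding Q_def[abs_def] by (rule derivative_eq_intros a b refl | simp)+
    moreover have "(x - t + 1) * b \<le> 1 * (3 * e1 x + C * exp (2 * x))"
    proof -
      have "(x - t + 1) * b \<le> (x - t + 1) * (3 * e1 x + C * exp (2 * x))"
        using b(2) x by (intro mult_left_mono) auto
      also have "\<dots> \<le> 1 * (3 * e1 x + C * exp (2 * x))"
        using x e1[OF xt] C by (intro mult_right_mono) auto
      finally show ?thesis .
    qed
    moreover have "0 \<le> C * exp (2 * x)" using C by simp
    ultimately show "\<exists>y. (Q has_real_derivative y) (at x) \<and> y \<le> 0"
      using a(2) by (intro exI conjI) auto
  qed simp
  moreover have "0 \<le> e0 t" "e0 (t - 1) \<le> C * exp (2 * (t - 1))" using e0[of t] e0[of "t - 1"] t by auto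
  moreover have "C * exp (2 * (t - 1)) \<le> C * exp (2 * t)" using C by (intro mult_left_mono) auto
  moreover have "0 \<le> C * exp (2 * (t - 1))" using C by simp
  ultimately show ?thesis by (simp add: Q_def)
qed

section \<open>Decay of the curvature in the mean\<close>

text \<open>Convexity without reference to a normal field: at each time the curvature has one sign, which may depend on
  the time and on the orientation of the curve.\<close>

locale convex_flow = spherical_flow +
  assumes one_signed: "t < 0 \<Longrightarrow> (\<forall>u. 0 \<le> k (t, u)) \<or> (\<forall>u. k (t, u) \<le> 0)"
begin

text \<open>A bound for the total absolute curvature. The summand \<open>1\<close> keeps it positive also for a
  stationary equator, so that one may divide by it.\<close>

definition \<delta> where "\<delta> t = (\<bar>I k (-1)\<bar> * exp 1 + 1) * exp t"

lemma \<delta>_pos: "\<delta> t > 0"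
  unfolding \<delta>_def by (intro mult_pos_pos add_nonneg_pos) auto

lemma k_slice: "t < 0 \<Longrightarrow> continuous_on A (\<lambda>u. k (t, u))"
  by (rule psmooth_continuous_slice[OF psmooth_k])

lemma total_abs_curvature:
  assumes t: "t < 0"
  shows "I (\<lambda>p. \<bar>k p\<bar>) t \<le> \<delta> t"
proof -
  have "I (\<lambda>p. \<bar>k p\<bar>) t = I k t \<or> I (\<lambda>p. \<bar>k p\<bar>) t = I (\<lambda>p. (-1) * k p) t"
    using one_signed[OF t] unfolding I_def by auto
  then have "I (\<lambda>p. \<bar>k p\<bar>) t \<le> \<bar>I k t\<bar>" unfolding I_cmul by auto
  also have "\<dots> = (\<bar>I k (-1)\<bar> * exp 1) * exp t"
    by (subst total_curvature[OF t]) (simp add: abs_mult exp_add)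
  also have "\<dots> \<le> \<delta> t" by (simp add: \<delta>_def algebra_simps)
  finally show ?thesis .
qed

text \<open>Interpolation between the \<open>L\<^sup>1\<close> norm of \<open>k\<close> and the \<open>L\<^sup>2\<close>
  norm of \<open>k\<^sub>s\<close>, with \<open>M\<close> the maximum of \<open>\<bar>k\<bar>\<close>. Both
  the energy \<open>E 0\<close> and the quartic term of its evolution are controlled by \<open>M\<close> and
  \<open>\<delta>\<close>.\<close>

lemma nash_inequality:
  assumes t: "t \<le> -1"
  obtains M where "0 \<le> M" "M ^ 3 \<le> 8 * \<delta> t * E 1 t + 64 * (\<delta> t) ^ 3 / len ^ 3"
    "E 0 t \<le> M * \<delta> t" "I (\<lambda>p. k p ^ 4) t \<le> M ^ 3 * \<delta> t"
proof -
  have t0: "t < 0" using t by simp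
  define D where "D = \<delta> t"
  have D: "D > 0" using \<delta>_pos by (simp add: D_def)
  obtain x where x: "x \<in> {0..2*pi}" "\<And>y. y \<in> {0..2*pi} \<Longrightarrow> \<bar>k (t, y)\<bar> \<le> \<bar>k (t, x)\<bar>"
    using continuous_attains_sup[of "{0..2*pi}" "\<lambda>y. \<bar>k (t, y)\<bar>"] k_slice[OF t0]
    by (fastforce intro!: continuous_intros)
  define M where "M = \<bar>k (t, x)\<bar>"
  have M0: "0 \<le> M" by (simp add: M_def)
  have kM: "\<bar>k (t, y)\<bar> \<le> M" for y
    using periodic_value[of "\<lambda>u. k (t, u)" y] psmooth_periodic[OF psmooth_k t0] x(2) M_def by metis
  have c: "continuous_on UNIV (\<lambda>u. c * \<bar>k (t, u)\<bar>)" for c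
    using k_slice[OF t0] by (intro continuous_intros)
  have Iabs: "I (\<lambda>p. c * \<bar>k p\<bar>) t \<le> c * D" if "0 \<le> c" for c
    unfolding I_cmul D_def using total_abs_curvature[OF t0] that by (rule mult_left_mono)
  have "E 0 t \<le> I (\<lambda>p. M * \<bar>k p\<bar>) t"
    unfolding E_def \<kappa>_0
  proof (rule I_mono[OF t0 _ c])
    show "continuous_on UNIV (\<lambda>u. (k (t, u))\<^sup>2)" using k_slice[OF t0] by (intro continuous_intros)
    show "(k (t, u))\<^sup>2 \<le> M * \<bar>k (t, u)\<bar>" for u
      using mult_right_mono[OF kM[of u], of "\<bar>k (t, u)\<bar>"] by (simp add: power2_eq_square flip: abs_mult)
  qed
  then have E0: "E 0 t \<le> M * D" using Iabs[OF M0] by simp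
  have "I (\<lambda>p. k p ^ 4) t \<le> I (\<lambda>p. M ^ 3 * \<bar>k p\<bar>) t"
  proof (rule I_mono[OF t0 _ c])
    show "continuous_on UNIV (\<lambda>u. k (t, u) ^ 4)" using k_slice[OF t0] by (intro continuous_intros)
    show "k (t, u) ^ 4 \<le> M ^ 3 * \<bar>k (t, u)\<bar>" for u
    proof -
      have "k (t, u) ^ 4 = \<bar>k (t, u)\<bar> ^ 3 * \<bar>k (t, u)\<bar>"
        by (simp add: power4_eq_xxxx power3_eq_cube abs_mult[symmetric] mult.assoc)
      also have "\<dots> \<le> M ^ 3 * \<bar>k (t, u)\<bar>"
        using kM[of u] by (intro mult_right_mono power_mono) auto
      finally show ?thesis .
    qed
  qed
  also have "\<dots> \<le> M ^ 3 * D" using M0 by (intro Iabs) auto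
  finally have I4: "I (\<lambda>p. k p ^ 4) t \<le> M ^ 3 * D" .
  have E1: "0 \<le> E 1 t" using E_nonneg[OF t0] .
  have "M ^ 3 \<le> 8 * D * E 1 t + 64 * D ^ 3 / len ^ 3"
  proof (cases "M = 0")
    case True
    then show ?thesis using E1 D len_pos by simp
  next
    case False
    then have Mp: "M > 0" using M0 by simp
    \<comment> \<open>With this weight the term \<open>\<eta> M D\<close> is half of the left-hand side \<open>M\<^sup>2\<close> and can be absorbed.\<close>
    define \<eta> where "\<eta> = M / (2 * D)"
    have \<eta>: "\<eta> > 0" using Mp D by (simp add: \<eta>_def)
    have "M\<^sup>2 \<le> E 0 t / len + (\<eta> * E 0 t + E 1 t / \<eta>)"
      using square_le_integrals[OF psmooth_k t \<eta>, of x] \<kappa>_Suc[of 0] by (simp add: E_def \<kappa>_0 M_def)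
    also have "\<dots> \<le> M * D / len + (\<eta> * (M * D) + E 1 t / \<eta>)"
      using E0 len_pos \<eta> by (intro add_mono divide_right_mono mult_left_mono) auto
    also have "\<dots> = M * D / len + M\<^sup>2 / 2 + 2 * D * E 1 t / M"
      using D Mp by (simp add: \<eta>_def power2_eq_square field_simps)
    finally have "M\<^sup>2 / 2 \<le> M * (D / len) + 2 * D * E 1 t / M"
      unfolding times_divide_eq_right by linarith
    then have "M * (M\<^sup>2 / 2) \<le> M * (M * (D / len) + 2 * D * E 1 t / M)"
      using Mp by (intro mult_left_mono) auto
    moreover have "M * (M * (D / len) + 2 * D * E 1 t / M) = M\<^sup>2 * (D / len) + 2 * D * E 1 t"
      using Mp by (simp add: power2_eq_square distrib_left)
    moreover have "M * (M\<^sup>2 / 2) = M ^ 3 / 2" by (simp add: power2_eq_square power3_eq_cube)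
    ultimately have *: "M ^ 3 \<le> 2 * M\<^sup>2 * (D / len) + 4 * D * E 1 t" by linarith
    show ?thesis
    proof (cases "4 * (D / len) \<le> M")
      case True
      then have le: "M\<^sup>2 * (4 * (D / len)) \<le> M\<^sup>2 * M" by (intro mult_left_mono) auto
      define Z W where "Z = M\<^sup>2 * (D / len)" and "W = D * E 1 t"
      have "M\<^sup>2 * (4 * (D / len)) = 4 * Z" "M\<^sup>2 * M = M ^ 3"
        by (simp_all add: power3_eq_cube power2_eq_square Z_def)
      then have "4 * Z \<le> M ^ 3" using le by metis
      moreover have "M ^ 3 \<le> 2 * Z + 4 * W" using * by (simp add: Z_def W_def mult.assoc)
      ultimately have "M ^ 3 \<le> 8 * W" by linarith
      then have "M ^ 3 \<le> 8 * D * E 1 t" by (simp add: W_def mult.assoc)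
      moreover have "0 \<le> 64 * D ^ 3 / len ^ 3" using D len_pos by simp
      ultimately show ?thesis by linarith
    next
      case False
      then have "M ^ 3 \<le> (4 * (D / len)) ^ 3" using M0 by (intro power_mono) auto
      moreover have "0 \<le> 8 * D * E 1 t" using E1 D by simp
      ultimately show ?thesis by (simp add: power_divide power_mult_distrib)
    qed
  qed
  then show ?thesis using that[of M] M0 E0 I4 by (simp add: D_def)
qed

text \<open>The dissipation inequality is part of the induction statement: it is what yields the decay of the next
  energy.\<close>

definition energy_decays where
  "energy_decays m \<longleftrightarrow> (\<exists>C t1. t1 \<le> -1 \<and> 0 \<le> C \<and> (\<forall>t\<le>t1. E m t \<le> C * exp (2 * t) \<and>
     (\<exists>d. (E m has_real_derivative d) (at t) \<and> d \<le> - E (m + 1) t + C * exp (2 * t))))"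

text \<open>After rescaling by the square of \<open>\<delta>\<close>, the energy identity and the Nash inequality
  combine to the cubic differential inequality treated above.\<close>

lemma energy_decays_0: "energy_decays 0"
proof -
  define K where "K = \<bar>I k (-1)\<bar> * exp 1 + 1"
  \<comment> \<open>Before this time \<open>\<delta> \<le> 1/4\<close>, so that the quartic term uses up only a quarter of the dissipation.\<close>
  define t1 where "t1 = min (-1) (ln (1 / (4 * K)))"
  have K: "K \<ge> 1" by (simp add: K_def)
  have \<delta>K: "\<delta> t = K * exp t" for t by (simp add: \<delta>_def K_def)
  have small: "\<delta> t \<le> 1 / 4" if "t \<le> t1" for t
  proof -
    have "exp t \<le> exp (ln (1 / (4 * K)))" using that by (simp add: t1_def del: exp_ln)
    also have "\<dots> = 1 / (4 * K)" using K by simp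
    finally show ?thesis using K by (simp add: \<delta>K field_simps)
  qed
  define e' where "e' t = - 2 * E 1 t + 2 * E 0 t + I (\<lambda>p. k p ^ 4) t" for t
  have P0: "P 0 p = (k p) ^ 3" if "p \<in> past" for p
    using Dt_k[OF that] by (simp add: P_def \<kappa>_0 numeral_2_eq_2)
  have dE: "(E 0 has_real_derivative e' t) (at t)" if "t \<le> t1" for t
  proof -
    have t: "t < 0" using that by (simp add: t1_def)
    have "I (\<lambda>p. 2 * \<kappa> 0 p * P 0 p - (k p)\<^sup>2 * (\<kappa> 0 p)\<^sup>2) t = I (\<lambda>p. k p ^ 4) t"
      using t P0 by (intro I_cong) (auto simp: \<kappa>_0 power4_eq_xxxx power3_eq_cube power2_eq_square)
    then show ?thesis using E_deriv[OF t, of 0] by (simp add: e'_def)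
  qed
  define y where "y t = E 0 t / (\<delta> t)\<^sup>2" for t
  have dy: "(y has_real_derivative e' t / (\<delta> t)\<^sup>2 - 2 * y t) (at t)" if "t \<le> t1" for t
    unfolding y_def[abs_def] \<delta>K using K
    by (auto intro!: derivative_eq_intros dE[OF that] simp: field_simps power2_eq_square)
  have key: "e' t \<le> - (3 / 2) * E 1 t + 2 * E 0 t + 64 * \<delta> t ^ 4 / len ^ 3"
    "y t ^ 3 \<le> 8 * E 1 t / (\<delta> t)\<^sup>2 + 64 / len ^ 3" if "t \<le> t1" for t
  proof -
    let ?D = "\<delta> t"
    have t: "t \<le> -1" using that by (simp add: t1_def)
    obtain M where M: "0 \<le> M" "M ^ 3 \<le> 8 * ?D * E 1 t + 64 * ?D ^ 3 / len ^ 3"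
      "E 0 t \<le> M * ?D" "I (\<lambda>p. k p ^ 4) t \<le> M ^ 3 * ?D" using nash_inequality[OF t] by blast
    have E: "0 \<le> E 0 t" "0 \<le> E 1 t" using E_nonneg t by auto
    have D: "?D > 0" by (rule \<delta>_pos)
    have "M ^ 3 * ?D \<le> (8 * ?D * E 1 t + 64 * ?D ^ 3 / len ^ 3) * ?D"
      using M(2) D by (intro mult_right_mono) auto
    also have "\<dots> = 8 * ?D\<^sup>2 * E 1 t + 64 * ?D ^ 4 / len ^ 3"
      by (simp add: field_simps power2_eq_square power3_eq_cube power4_eq_xxxx)
    also have "8 * ?D\<^sup>2 * E 1 t \<le> 1 / 2 * E 1 t"
    proof (intro mult_right_mono E)
      have "?D\<^sup>2 \<le> (1 / 4)\<^sup>2" using small[OF that] D by (intro power_mono) auto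
      then show "8 * ?D\<^sup>2 \<le> 1 / 2" by (simp add: power2_eq_square)
    qed
    finally show "e' t \<le> - (3 / 2) * E 1 t + 2 * E 0 t + 64 * ?D ^ 4 / len ^ 3"
      using M(4) by (simp add: e'_def)
    have "E 0 t ^ 3 \<le> (M * ?D) ^ 3" using M(3) E by (intro power_mono) auto
    also have "\<dots> \<le> (8 * ?D * E 1 t + 64 * ?D ^ 3 / len ^ 3) * ?D ^ 3"
      unfolding power_mult_distrib using M(2) D by (intro mult_right_mono) auto
    also have "\<dots> = (8 * E 1 t / ?D\<^sup>2 + 64 / len ^ 3) * (?D\<^sup>2) ^ 3"
      using D len_pos by (simp add: field_simps power2_eq_square power3_eq_cube)
    finally show "y t ^ 3 \<le> 8 * E 1 t / ?D\<^sup>2 + 64 / len ^ 3"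
      using D unfolding y_def power_divide by (simp add: pos_divide_le_eq)
  qed
  define B where "B = 1 + 2 * (16 / len ^ 3) / (3 / 16)"
  have len3: "0 < len ^ 3" using len_pos by simp
  have yB: "y t \<le> B" if "t \<le> t1" for t
    unfolding B_def
  proof (rule ancient_cubic_inequality_bounded[OF dy _ _ _ that])
    fix s assume s: "s \<le> t1"
    let ?D = "\<delta> s"
    have D: "?D > 0" by (rule \<delta>_pos)
    have "e' s / ?D\<^sup>2 \<le> (- (3 / 2) * E 1 s + 2 * E 0 s + 64 * ?D ^ 4 / len ^ 3) / ?D\<^sup>2"
      using key(1)[OF s] D by (intro divide_right_mono) auto
    also have "\<dots> = - (3 / 2) * (E 1 s / ?D\<^sup>2) + 2 * y s + 64 * ?D\<^sup>2 / len ^ 3"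
      using D len_pos by (simp add: y_def field_simps power2_eq_square power4_eq_xxxx)
    also have "64 * ?D\<^sup>2 / len ^ 3 \<le> 4 / len ^ 3"
    proof (intro divide_right_mono)
      have "?D\<^sup>2 \<le> (1 / 4)\<^sup>2" using small[OF s] D by (intro power_mono) auto
      then show "64 * ?D\<^sup>2 \<le> 4" by (simp add: power2_eq_square)
    qed (use len_pos in auto)
    finally show "e' s / ?D\<^sup>2 - 2 * y s \<le> 16 / len ^ 3 - 3 / 16 * y s ^ 3"
      using key(2)[OF s] by simp
  qed (use len_pos in auto)
  define C where "C = 2 * B * K\<^sup>2 + 4 * K\<^sup>2 / len ^ 3"
  have B0: "B \<ge> 0" using len_pos by (simp add: B_def)
  have e2: "(\<delta> t)\<^sup>2 = K\<^sup>2 * exp (2 * t)" for t by (simp add: \<delta>K power_mult_distrib exp_double)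
  have "E 0 t \<le> C * exp (2 * t) \<and>
     (\<exists>d. (E 0 has_real_derivative d) (at t) \<and> d \<le> - E (0 + 1) t + C * exp (2 * t))" if t: "t \<le> t1" for t
  proof -
    have t0: "t < 0" using t by (simp add: t1_def)
    have D: "\<delta> t > 0" by (rule \<delta>_pos)
    have E0: "E 0 t \<le> B * (K\<^sup>2 * exp (2 * t))"
      using yB[OF t] D unfolding y_def e2[symmetric] by (simp add: pos_divide_le_eq)
    have "0 \<le> B * K\<^sup>2 * exp (2 * t)" "0 \<le> 4 * K\<^sup>2 / len ^ 3 * exp (2 * t)" using B0 len_pos by auto
    then have 1: "E 0 t \<le> C * exp (2 * t)" "2 * E 0 t + 4 * K\<^sup>2 / len ^ 3 * exp (2 * t) \<le> C * exp (2 * t)"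
      using E0 by (auto simp: C_def algebra_simps)
    have "64 * \<delta> t ^ 4 \<le> 4 * (\<delta> t)\<^sup>2"
    proof -
      have "(\<delta> t)\<^sup>2 \<le> (1 / 4)\<^sup>2" using small[OF t] D by (intro power_mono) auto
      then have "(\<delta> t)\<^sup>2 * (\<delta> t)\<^sup>2 \<le> (1 / 4)\<^sup>2 * (\<delta> t)\<^sup>2" by (intro mult_right_mono) auto
      then show ?thesis by (simp add: power2_eq_square power4_eq_xxxx)
    qed
    then have "64 * \<delta> t ^ 4 / len ^ 3 \<le> 4 * K\<^sup>2 / len ^ 3 * exp (2 * t)"
      unfolding e2 using len_pos by (simp add: divide_right_mono)
    then have "e' t \<le> - E 1 t + C * exp (2 * t)"
      using key(1)[OF t] 1(2) E_nonneg[OF t0, of 1] by simp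
    then show ?thesis using dE[OF t] 1 by auto
  qed
  moreover have "t1 \<le> -1" by (simp add: t1_def)
  moreover have "0 \<le> C" using B0 len_pos by (simp add: C_def)
  ultimately show ?thesis unfolding energy_decays_def by blast
qed

end

section \<open>Decay of the derivatives of the curvature\<close>

context spherical_flow
begin

text \<open>Linear combinations of the products \<open>\<kappa> i \<cdot> \<kappa> j \<cdot> a l\<close> with
  \<open>i, j < n\<close> and \<open>l \<le> m\<close>. Both the nonlinear part of the evolution of
  \<open>\<kappa> m\<close> (for \<open>m \<ge> 1\<close>, with \<open>a = \<kappa>\<close>) and the time
  derivatives of the arclength derivatives of \<open>v\<close> have this form, and the estimates use only
  these bounds on the orders.\<close>

inductive trilinear :: "(nat \<Rightarrow> real \<times> real \<Rightarrow> real) \<Rightarrow> nat \<Rightarrow> nat \<Rightarrow> (real \<times> real \<Rightarrow> real) \<Rightarrow> bool" for a where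
  triple: "i < n \<Longrightarrow> j < n \<Longrightarrow> l \<le> m \<Longrightarrow> trilinear a n m (\<lambda>p. c * (\<kappa> i p * \<kappa> j p * a l p))"
| plus: "trilinear a n m f \<Longrightarrow> trilinear a n m g \<Longrightarrow> trilinear a n m (\<lambda>p. f p + g p)"
| equal: "trilinear a n m f \<Longrightarrow> (\<And>p. p \<in> past \<Longrightarrow> f p = g p) \<Longrightarrow> trilinear a n m g"

text \<open>By the product rule, an arclength derivative raises both bounds on the orders by one.\<close>

lemma trilinear_Ds:
  assumes "trilinear a n m f" and a: "\<And>l. psmooth (a l)" "\<And>l. a (Suc l) = Ds (a l)"
  shows "psmooth f \<and> trilinear a (Suc n) (Suc m) (Ds f)"
  using assms(1)
proof induction
  case (triple i n j l m c)
  note s = psmooth_mult[OF psmooth_\<kappa> psmooth_\<kappa>, of i j]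
  note b = Ds_bilinear[OF bounded_bilinear_mult]
  have e: "Ds (\<lambda>p. c * (\<kappa> i p * \<kappa> j p * a l p)) p =
      c * (\<kappa> (Suc i) p * \<kappa> j p * a l p) + (c * (\<kappa> i p * \<kappa> (Suc j) p * a l p) +
      c * (\<kappa> i p * \<kappa> j p * a (Suc l) p))" if p: "p \<in> past" for p
    using b[OF psmooth_const psmooth_mult[OF s a(1)] p, of c] b[OF s a(1) p, of l]
      b[OF psmooth_\<kappa> psmooth_\<kappa> p, of i j]
    by (simp add: \<kappa>_Suc a(2) algebra_simps)
  have "trilinear a (Suc n) (Suc m) (\<lambda>p. c * (\<kappa> (Suc i) p * \<kappa> j p * a l p) + (c * (\<kappa> i p * \<kappa> (Suc j) p * a l p) +
      c * (\<kappa> i p * \<kappa> j p * a (Suc l) p)))"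
    using triple by (intro trilinear.plus trilinear.triple) auto
  then have "trilinear a (Suc n) (Suc m) (Ds (\<lambda>p. c * (\<kappa> i p * \<kappa> j p * a l p)))"
    by (rule trilinear.equal) (simp add: e)
  then show ?case using psmooth_mult[OF psmooth_const psmooth_mult[OF s a(1)]] by blast
next
  case (plus n m f g)
  have "trilinear a (Suc n) (Suc m) (\<lambda>p. Ds f p + Ds g p)"
    using plus by (intro trilinear.plus) auto
  then have "trilinear a (Suc n) (Suc m) (Ds (\<lambda>p. f p + g p))"
    by (rule trilinear.equal) (simp add: Ds_add plus.IH)
  then show ?case using plus psmooth_add by blast
next
  case (equal n m f g)
  have "trilinear a (Suc n) (Suc m) (Ds g)"
  proof (rule trilinear.equal[where f="Ds f"])
    show "trilinear a (Suc n) (Suc m) (Ds f)" using equal.IH by blast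
    show "Ds f p = Ds g p" if "p \<in> past" for p
      by (rule Ds_cong[OF _ that]) (rule equal.hyps(2))
  qed
  then show ?case using equal psmooth_cong by blast
qed

text \<open>The commutator of \<open>\<partial>\<^sub>t\<close> and \<open>\<partial>\<^sub>s\<close> produces the
  additional cubic term.\<close>

lemma P_Suc:
  assumes p: "p \<in> past"
  shows "P (Suc m) p = Ds (P m) p + (k p)\<^sup>2 * \<kappa> (Suc m) p"
proof -
  have "Ds (Dt (\<kappa> m)) p = Ds (\<lambda>p. P m p + (\<kappa> (m + 2) p + \<kappa> m p)) p"
    by (rule Ds_cong[OF _ p]) (simp add: P_def)
  also have "\<dots> = Ds (P m) p + (\<kappa> (m + 3) p + \<kappa> (m + 1) p)"
    using Ds_add[OF psmooth_P psmooth_add[OF psmooth_\<kappa> psmooth_\<kappa>] p, of m "m+2" m]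
      Ds_add[OF psmooth_\<kappa> psmooth_\<kappa> p, of "m+2" m]
    by (simp add: \<kappa>_Suc eval_nat_numeral)
  finally show ?thesis
    using Dt_Ds[OF psmooth_\<kappa> p, of m] by (simp add: P_def \<kappa>_Suc eval_nat_numeral)
qed

lemma P_0: "p \<in> past \<Longrightarrow> P 0 p = (k p) ^ 3"
  using Dt_k[of p] by (simp add: P_def \<kappa>_0 numeral_2_eq_2)

lemma trilinear_P: "trilinear \<kappa> (Suc m) (Suc m) (P (Suc m))"
proof (induction m)
  case 0
  have "P 1 p = 4 * (\<kappa> 0 p * \<kappa> 0 p * \<kappa> 1 p)" if p: "p \<in> past" for p
  proof -
    have "Ds (P 0) p = Ds (\<lambda>p. k p * (k p * k p)) p"
      by (rule Ds_cong[OF _ p]) (simp add: P_0 power3_eq_cube)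
    then show ?thesis
      using P_Suc[OF p, of 0] Ds_bilinear[OF bounded_bilinear_mult psmooth_k psmooth_mult[OF psmooth_k psmooth_k] p]
        Ds_bilinear[OF bounded_bilinear_mult psmooth_k psmooth_k p]
      by (simp add: \<kappa>_Suc \<kappa>_0 power2_eq_square algebra_simps)
  qed
  then show ?case using trilinear.triple[of 0 1 0 1 1 \<kappa> 4]
    by (intro trilinear.equal[where g="P (Suc 0)" and f="\<lambda>p. 4 * (\<kappa> 0 p * \<kappa> 0 p * \<kappa> 1 p)"]) auto
next
  case (Suc m)
  have "trilinear \<kappa> (Suc (Suc m)) (Suc (Suc m)) (\<lambda>p. Ds (P (Suc m)) p + 1 * (\<kappa> 0 p * \<kappa> 0 p * \<kappa> (Suc (Suc m)) p))"
    using trilinear_Ds[OF Suc psmooth_\<kappa> \<kappa>_Suc] by (intro trilinear.plus trilinear.triple) auto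
  then show ?case by (rule trilinear.equal) (simp add: P_Suc \<kappa>_0 power2_eq_square)
qed

text \<open>The factors \<open>\<kappa> m\<close> and \<open>\<kappa> l\<close> are estimated by their maxima, which the
  Sobolev inequality bounds by energies of order at most \<open>m + 1\<close>; the other two have order less
  than \<open>m\<close>, so the integral of their product is \<open>O(e\<^sup>2\<^sup>t)\<close>. This factor
  makes the term small in the distant past, even relative to the dissipation.\<close>

lemma trilinear_energy_bound:
  assumes "trilinear \<kappa> n m f" "n = m" and C: "0 \<le> C" and t1: "t1 \<le> -1"
    and low: "\<And>i t. i < m \<Longrightarrow> t \<le> t1 \<Longrightarrow> E i t \<le> C * exp (2 * t)"
  shows "\<exists>B\<ge>0. \<forall>t\<le>t1. I (\<lambda>p. \<bar>\<kappa> m p * f p\<bar>) t \<le> B * exp (2 * t) * (E m t + E (m + 1) t + exp (2 * t))"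
  using assms(1,2) low
proof induction
  case (triple i n j l m c)
  define A where "A = 1 / len + 1"
  have A: "A \<ge> 0" using len_pos by (simp add: A_def)
  define B where "B = \<bar>c\<bar> * (A * (1 + C)) * C"
  have "I (\<lambda>p. \<bar>\<kappa> m p * (c * (\<kappa> i p * \<kappa> j p * \<kappa> l p))\<bar>) t
      \<le> B * exp (2 * t) * (E m t + E (m + 1) t + exp (2 * t))" if t: "t \<le> t1" for t
  proof -
    have tm: "t \<le> -1" and t0: "t < 0" using t t1 by auto
    note cs = psmooth_continuous_slice[OF _ t0]
    let ?G = "E m t + E (m + 1) t + exp (2 * t)"
    have E: "0 \<le> E m t" "0 \<le> E (m + 1) t" using E_nonneg[OF t0] by auto
    have El: "E l t + E (l + 1) t \<le> E m t + E (m + 1) t + 2 * (C * exp (2 * t))"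
    proof (cases "l = m")
      case False
      then have "l < m" using triple by simp
      then have "E l t \<le> C * exp (2 * t)" "E (l + 1) t \<le> C * exp (2 * t) + E m t"
        using triple(5)[OF _ t, of l] triple(5)[OF _ t, of "l + 1"] E C
        by (auto, cases "l + 1 = m", auto)
      then show ?thesis using E by simp
    qed (use C in simp)
    have S: "\<bar>\<kappa> m (t, u)\<bar> * \<bar>\<kappa> l (t, u)\<bar> \<le> A * (1 + C) * ?G" for u
    proof -
      have "\<bar>\<kappa> m (t, u)\<bar> * \<bar>\<kappa> l (t, u)\<bar> \<le> ((\<kappa> m (t, u))\<^sup>2 + (\<kappa> l (t, u))\<^sup>2) / 2"
        using sum_squares_bound[of "\<bar>\<kappa> m (t, u)\<bar>" "\<bar>\<kappa> l (t, u)\<bar>"] by simp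
      also have "\<dots> \<le> (A * (E m t + E (m + 1) t) + A * (E l t + E (l + 1) t)) / 2"
        using \<kappa>_square_le[OF tm, of m u, folded A_def] \<kappa>_square_le[OF tm, of l u, folded A_def] by simp
      also have "\<dots> \<le> A * (E m t + E (m + 1) t + C * exp (2 * t))"
        using mult_left_mono[OF El A] by (simp add: algebra_simps)
      also have "\<dots> \<le> A * ((1 + C) * ?G)"
      proof (intro mult_left_mono A)
        have "0 \<le> C * (E m t + E (m + 1) t)" using C E by simp
        moreover have "0 \<le> exp (2 * t)" by simp
        ultimately show "E m t + E (m + 1) t + C * exp (2 * t) \<le> (1 + C) * ?G"
          unfolding distrib_right distrib_left mult_1 by linarith
      qed
      finally show ?thesis by (simp add: mult.assoc)
    qed
    have G: "0 \<le> \<bar>c\<bar> * (A * (1 + C) * ?G)" using A C E by auto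
    have "I (\<lambda>p. \<bar>\<kappa> m p * (c * (\<kappa> i p * \<kappa> j p * \<kappa> l p))\<bar>) t
      \<le> I (\<lambda>p. (\<bar>c\<bar> * (A * (1 + C) * ?G) / 2) * ((\<kappa> i p)\<^sup>2 + (\<kappa> j p)\<^sup>2)) t"
    proof (rule I_mono[OF t0])
      show "continuous_on UNIV (\<lambda>u. \<bar>\<kappa> m (t, u) * (c * (\<kappa> i (t, u) * \<kappa> j (t, u) * \<kappa> l (t, u)))\<bar>)"
        by (intro continuous_intros cs psmooth_\<kappa>)
      show "continuous_on UNIV (\<lambda>u. (\<bar>c\<bar> * (A * (1 + C) * ?G) / 2) * ((\<kappa> i (t, u))\<^sup>2 + (\<kappa> j (t, u))\<^sup>2))"
        by (intro continuous_intros cs psmooth_\<kappa>)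
      fix u
      have "\<bar>\<kappa> m (t, u) * (c * (\<kappa> i (t, u) * \<kappa> j (t, u) * \<kappa> l (t, u)))\<bar> =
        \<bar>c\<bar> * (\<bar>\<kappa> m (t, u)\<bar> * \<bar>\<kappa> l (t, u)\<bar>) * (\<bar>\<kappa> i (t, u)\<bar> * \<bar>\<kappa> j (t, u)\<bar>)"
        by (simp add: abs_mult mult_ac)
      also have "\<dots> \<le> \<bar>c\<bar> * (A * (1 + C) * ?G) * (((\<kappa> i (t, u))\<^sup>2 + (\<kappa> j (t, u))\<^sup>2) / 2)"
        using S[of u] G sum_squares_bound[of "\<bar>\<kappa> i (t, u)\<bar>" "\<bar>\<kappa> j (t, u)\<bar>"]
        by (intro mult_mono[OF mult_left_mono] G) (auto simp: mult.assoc)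
      finally show "\<bar>\<kappa> m (t, u) * (c * (\<kappa> i (t, u) * \<kappa> j (t, u) * \<kappa> l (t, u)))\<bar>
        \<le> (\<bar>c\<bar> * (A * (1 + C) * ?G) / 2) * ((\<kappa> i (t, u))\<^sup>2 + (\<kappa> j (t, u))\<^sup>2)" by simp
    qed
    also have "\<dots> = (\<bar>c\<bar> * (A * (1 + C) * ?G) / 2) * (E i t + E j t)"
    proof -
      have "I (\<lambda>p. (\<kappa> i p)\<^sup>2 + (\<kappa> j p)\<^sup>2) t = E i t + E j t"
        unfolding E_def by (intro I_add t0 cs psmooth_power psmooth_\<kappa>)
      then show ?thesis unfolding I_cmul by simp
    qed
    also have "\<dots> \<le> (\<bar>c\<bar> * (A * (1 + C) * ?G) / 2) * (2 * (C * exp (2 * t)))"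
      using triple(5)[OF _ t, of i] triple(5)[OF _ t, of j] triple(1,2,4) G by (intro mult_left_mono) auto
    also have "\<dots> = B * exp (2 * t) * ?G" by (simp add: B_def)
    finally show ?thesis .
  qed
  moreover have "B \<ge> 0" using A C by (simp add: B_def)
  ultimately show ?case by blast
next
  case (plus n m f g)
  obtain B1 where B1: "B1 \<ge> 0" "\<And>t. t \<le> t1 \<Longrightarrow> I (\<lambda>p. \<bar>\<kappa> m p * f p\<bar>) t \<le> B1 * exp (2 * t) * (E m t + E (m + 1) t + exp (2 * t))"
    using plus by blast
  obtain B2 where B2: "B2 \<ge> 0" "\<And>t. t \<le> t1 \<Longrightarrow> I (\<lambda>p. \<bar>\<kappa> m p * g p\<bar>) t \<le> B2 * exp (2 * t) * (E m t + E (m + 1) t + exp (2 * t))"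
    using plus by blast
  have "I (\<lambda>p. \<bar>\<kappa> m p * (f p + g p)\<bar>) t \<le> (B1 + B2) * exp (2 * t) * (E m t + E (m + 1) t + exp (2 * t))"
    if t: "t \<le> t1" for t
  proof -
    have t0: "t < 0" using t t1 by auto
    have "psmooth f" "psmooth g" using trilinear_Ds[where a=\<kappa>, OF _ psmooth_\<kappa> \<kappa>_Suc] plus(1,2) by blast+
    note cs = psmooth_continuous_slice[OF psmooth_\<kappa> t0] psmooth_continuous_slice[OF \<open>psmooth f\<close> t0] psmooth_continuous_slice[OF \<open>psmooth g\<close> t0]
    have "I (\<lambda>p. \<bar>\<kappa> m p * (f p + g p)\<bar>) t \<le> I (\<lambda>p. \<bar>\<kappa> m p * f p\<bar> + \<bar>\<kappa> m p * g p\<bar>) t"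
      by (intro I_mono t0 continuous_intros cs) (simp add: distrib_left abs_triangle_ineq)
    also have "\<dots> = I (\<lambda>p. \<bar>\<kappa> m p * f p\<bar>) t + I (\<lambda>p. \<bar>\<kappa> m p * g p\<bar>) t"
      by (intro I_add t0 continuous_intros cs)
    finally show ?thesis using B1(2)[OF t] B2(2)[OF t] by (simp add: algebra_simps)
  qed
  then show ?case using B1(1) B2(1) by (intro exI[of _ "B1 + B2"]) auto
next
  case (equal n m f g)
  have "I (\<lambda>p. \<bar>\<kappa> m p * g p\<bar>) t = I (\<lambda>p. \<bar>\<kappa> m p * f p\<bar>) t" if "t \<le> t1" for t
    using that t1 equal(2) by (intro I_cong) auto
  then show ?case using equal by auto
qed

end

context convex_flow
begin

text \<open>In the distant past the cubic terms in the evolution of \<open>E n\<close>, where \<open>n = Suc m\<close>,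
  are at most \<open>E n + E (n + 1) + e\<^sup>2\<^sup>t\<close>; so half of the dissipation survives, and
  parabolic smoothing applies to the pair \<open>E m\<close>, \<open>E n\<close>.\<close>

lemma energy_decays_Suc:
  assumes "\<And>i. i \<le> m \<Longrightarrow> energy_decays i"
  shows "energy_decays (Suc m)"
proof -
  obtain Ci ti where i: "\<And>i. i \<le> m \<Longrightarrow> ti i \<le> -1 \<and> 0 \<le> Ci i \<and> (\<forall>t\<le>ti i. E i t \<le> Ci i * exp (2 * t) \<and>
     (\<exists>d. (E i has_real_derivative d) (at t) \<and> d \<le> - E (i + 1) t + Ci i * exp (2 * t)))"
    using assms unfolding energy_decays_def by metis
  define C where "C = (\<Sum>i\<le>m. Ci i)"
  define t1 where "t1 = Min (ti ` {..m})"
  have CiC: "Ci i \<le> C" if "i \<le> m" for i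
    unfolding C_def using i that by (intro member_le_sum) auto
  have tit: "t1 \<le> ti i" if "i \<le> m" for i
    unfolding t1_def using that by (intro Min_le) auto
  have C: "0 \<le> C" unfolding C_def using i by (intro sum_nonneg) auto
  have t1: "t1 \<le> -1" using tit[of 0] i[of 0] by simp
  have low: "E i t \<le> C * exp (2 * t)" if "i < Suc m" "t \<le> t1" for i t
  proof -
    have "E i t \<le> Ci i * exp (2 * t)" using i[of i] tit[of i] that by simp
    also have "\<dots> \<le> C * exp (2 * t)" using CiC[of i] that by simp
    finally show ?thesis .
  qed
  have low': "\<exists>d. (E m has_real_derivative d) (at t) \<and> d \<le> - E (Suc m) t + C * exp (2 * t)" if t: "t \<le> t1" for t
  proof -
    obtain d where "(E m has_real_derivative d) (at t)" "d \<le> - E (m + 1) t + Ci m * exp (2 * t)"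
      using i[of m] order_trans[OF t tit[of m]] by blast
    moreover have "Ci m * exp (2 * t) \<le> C * exp (2 * t)" using CiC[of m] by (intro mult_right_mono) auto
    ultimately have "d \<le> - E (Suc m) t + C * exp (2 * t)" unfolding Suc_eq_plus1 by linarith
    then show ?thesis using \<open>(E m has_real_derivative d) (at t)\<close> by blast
  qed
  obtain B where B: "0 \<le> B" "\<And>t. t \<le> t1 \<Longrightarrow> I (\<lambda>p. \<bar>\<kappa> (Suc m) p * P (Suc m) p\<bar>) t
      \<le> B * exp (2 * t) * (E (Suc m) t + E (Suc m + 1) t + exp (2 * t))"
    using trilinear_energy_bound[OF trilinear_P refl C t1 low] by blast
  \<comment> \<open>Before this time the factor \<open>2 B e\<^sup>2\<^sup>t\<close> in front of the cubic terms is at most \<open>1\<close>.\<close>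
  define t2 where "t2 = min t1 (ln (1 / (2 * B + 2)) / 2)"
  have t21: "t2 \<le> t1" by (simp add: t2_def)
  have step: "\<exists>d. (E (Suc m) has_real_derivative d) (at t) \<and>
      d \<le> - E (Suc m + 1) t + 3 * E (Suc m) t + exp (2 * t)" if t: "t \<le> t2" for t
  proof -
    have t1': "t \<le> t1" and t0: "t < 0" using t t21 t1 by auto
    let ?n = "Suc m" and ?G = "E (Suc m) t + E (Suc m + 1) t + exp (2 * t)"
    have G: "0 \<le> ?G" using E_nonneg[OF t0] by simp
    have "2 * B * exp (2 * t) \<le> 1"
    proof -
      have "exp (2 * t) \<le> exp (ln (1 / (2 * B + 2)))" using t by (simp add: t2_def del: exp_ln)
      also have "\<dots> = 1 / (2 * B + 2)" using B(1) by simp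
      finally have "(2 * B + 2) * exp (2 * t) \<le> 1" using B(1) by (simp add: field_simps)
      then show ?thesis by (simp add: distrib_right) (smt (verit) exp_ge_zero)
    qed
    then have *: "(2 * B * exp (2 * t)) * ?G \<le> 1 * ?G" using G by (intro mult_right_mono)
    note cs = psmooth_continuous_slice[OF _ t0]
    have "I (\<lambda>p. 2 * \<kappa> ?n p * P ?n p - (k p)\<^sup>2 * (\<kappa> ?n p)\<^sup>2) t \<le> I (\<lambda>p. 2 * \<bar>\<kappa> ?n p * P ?n p\<bar>) t"
    proof (rule I_mono[OF t0])
      show "continuous_on UNIV (\<lambda>u. 2 * \<kappa> ?n (t, u) * P ?n (t, u) - (k (t, u))\<^sup>2 * (\<kappa> ?n (t, u))\<^sup>2)"
        by (intro continuous_intros cs psmooth_\<kappa> psmooth_P psmooth_k)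
      show "continuous_on UNIV (\<lambda>u. 2 * \<bar>\<kappa> ?n (t, u) * P ?n (t, u)\<bar>)"
        by (intro continuous_intros cs psmooth_\<kappa> psmooth_P)
      show "2 * \<kappa> ?n (t, u) * P ?n (t, u) - (k (t, u))\<^sup>2 * (\<kappa> ?n (t, u))\<^sup>2 \<le> 2 * \<bar>\<kappa> ?n (t, u) * P ?n (t, u)\<bar>" for u
      proof -
        have "0 \<le> (k (t, u))\<^sup>2 * (\<kappa> ?n (t, u))\<^sup>2" by simp
        then show ?thesis by linarith
      qed
    qed
    also have "\<dots> \<le> 2 * (B * exp (2 * t) * ?G)"
      unfolding I_cmul using B(2)[OF t1'] by simp
    finally have "I (\<lambda>p. 2 * \<kappa> ?n p * P ?n p - (k p)\<^sup>2 * (\<kappa> ?n p)\<^sup>2) t \<le> ?G" using * by simp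
    then have "- 2 * E (?n + 1) t + 2 * E ?n t + I (\<lambda>p. 2 * \<kappa> ?n p * P ?n p - (k p)\<^sup>2 * (\<kappa> ?n p)\<^sup>2) t
      \<le> - E (?n + 1) t + 3 * E ?n t + exp (2 * t)" by linarith
    then show ?thesis using E_deriv[OF t0, of ?n] by blast
  qed
  define C' where "C' = C + 1"
  have CC: "C * exp (2 * t) \<le> C' * exp (2 * t)" "exp (2 * t) \<le> C' * exp (2 * t)" for t
    using C by (auto simp: C'_def)
  have bound: "E (Suc m) t \<le> 7 * C' * exp (2 * t)" if t: "t \<le> t2" for t
  proof (rule parabolic_smoothing[of t2 "E m" "E (Suc m)" C' t])
    fix t assume t: "t \<le> t2"
    then have t0: "t < 0" using t21 t1 by simp
    show "\<exists>d. (E m has_real_derivative d) (at t) \<and> d \<le> - E (Suc m) t + C' * exp (2 * t)"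
      using low'[OF order_trans[OF t t21]] CC(1)[of t] by (meson add_left_mono order_trans)
    show "\<exists>d. (E (Suc m) has_real_derivative d) (at t) \<and> d \<le> 3 * E (Suc m) t + C' * exp (2 * t)"
    proof -
      obtain d where "(E (Suc m) has_real_derivative d) (at t)"
        "d \<le> - E (Suc m + 1) t + 3 * E (Suc m) t + exp (2 * t)" using step[OF t] by blast
      then show ?thesis using CC(2)[of t] E_nonneg[OF t0, of "Suc m + 1"] by (intro exI[of _ d] conjI) linarith+
    qed
    show "0 \<le> E m t \<and> E m t \<le> C' * exp (2 * t)"
      using E_nonneg[OF t0] low[of m t] order_trans[OF t t21] CC(1)[of t] by (auto intro: order_trans)
    show "0 \<le> E (Suc m) t" using E_nonneg[OF t0] .
  qed (use C t in \<open>auto simp: C'_def\<close>)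
  define C'' where "C'' = 22 * C'"
  show ?thesis
    unfolding energy_decays_def
  proof (rule exI[of _ C''], rule exI[of _ t2], intro conjI allI impI)
    show "t2 \<le> -1" "0 \<le> C''" using t21 t1 C by (auto simp: C''_def C'_def)
    fix t assume t: "t \<le> t2"
    have p: "0 \<le> C' * exp (2 * t)" using C by (simp add: C'_def)
    show "E (Suc m) t \<le> C'' * exp (2 * t)" using bound[OF t] p by (simp add: C''_def)
    obtain d where "(E (Suc m) has_real_derivative d) (at t)"
      "d \<le> - E (Suc m + 1) t + 3 * E (Suc m) t + exp (2 * t)" using step[OF t] by blast
    then show "\<exists>d. (E (Suc m) has_real_derivative d) (at t) \<and> d \<le> - E (Suc m + 1) t + C'' * exp (2 * t)"
      using bound[OF t] CC(2)[of t] unfolding C''_def by (intro exI[of _ d] conjI) linarith+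
  qed
qed

lemma energy_decays: "energy_decays m"
proof (induction m rule: less_induct)
  case (less m)
  then show ?case using energy_decays_0 energy_decays_Suc by (cases m) (auto simp: less_Suc_eq_le)
qed

lemma \<kappa>_decays: "\<exists>C t1. t1 \<le> -1 \<and> 0 \<le> C \<and> (\<forall>t\<le>t1. \<forall>u. \<bar>\<kappa> m (t, u)\<bar> \<le> C * exp t)"
proof -
  obtain C t1 where 1: "t1 \<le> -1" "0 \<le> C" "\<And>t. t \<le> t1 \<Longrightarrow> E m t \<le> C * exp (2 * t)"
    using energy_decays[of m] unfolding energy_decays_def by blast
  obtain C' t2 where 2: "t2 \<le> -1" "0 \<le> C'" "\<And>t. t \<le> t2 \<Longrightarrow> E (m + 1) t \<le> C' * exp (2 * t)"
    using energy_decays[of "m + 1"] unfolding energy_decays_def by blast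
  define K where "K = (1 / len + 1) * (C + C')"
  have K: "0 \<le> K" using 1 2 len_pos by (simp add: K_def)
  have "\<bar>\<kappa> m (t, u)\<bar> \<le> sqrt K * exp t" if t: "t \<le> min t1 t2" for t u
  proof (rule power2_le_imp_le)
    have "(\<kappa> m (t, u))\<^sup>2 \<le> (1 / len + 1) * (E m t + E (m + 1) t)"
      using \<kappa>_square_le[of t m u] t 1 by simp
    also have "\<dots> \<le> (1 / len + 1) * (C * exp (2 * t) + C' * exp (2 * t))"
      using 1(3)[of t] 2(3)[of t] t len_pos by (intro mult_left_mono add_mono) auto
    also have "\<dots> = K * (exp t)\<^sup>2" by (simp add: K_def exp_double[symmetric] algebra_simps add_divide_distrib)
    finally show "\<bar>\<kappa> m (t, u)\<bar>\<^sup>2 \<le> (sqrt K * exp t)\<^sup>2" using K by (simp add: power_mult_distrib)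
  qed (use K in simp)
  moreover have "min t1 t2 \<le> -1" "0 \<le> sqrt K" using 1(1) K by auto
  ultimately show ?thesis by blast
qed

end

section \<open>Parameter derivatives of the flow\<close>

text \<open>The rate \<open>C e\<^sup>t\<close> is integrable at \<open>-\<infinity>\<close>, so the bound is uniform in
  the past. The weight \<open>exp (4 C e\<^sup>t)\<close> makes \<open>1 + f\<^sup>2\<close> increasing.\<close>

lemma gronwall_past:
  fixes f :: "real \<Rightarrow> real"
  assumes d: "\<And>t. t \<le> t1 \<Longrightarrow> (f has_real_derivative f' t) (at t)"
    and le: "\<And>t. t \<le> t1 \<Longrightarrow> \<bar>f' t\<bar> \<le> C * exp t * (1 + \<bar>f t\<bar>)"
    and C: "0 \<le> C" and t: "t \<le> t1"
  shows "(f t)\<^sup>2 \<le> (1 + (f t1)\<^sup>2) * exp (4 * C * exp t1)"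
proof -
  define h where "h s = (1 + (f s)\<^sup>2) * exp (4 * C * exp s)" for s
  have "h t \<le> h t1"
  proof (rule DERIV_nonneg_imp_nondecreasing[where f=h and a=t and b=t1, OF t])
    fix x assume "t \<le> x" and x: "x \<le> t1"
    have "(h has_real_derivative (2 * f x * f' x + 4 * C * exp x * (1 + (f x)\<^sup>2)) * exp (4 * C * exp x)) (at x)"
      unfolding h_def[abs_def] using d[OF x]
      by (auto intro!: derivative_eq_intros simp: algebra_simps)
    moreover have "0 \<le> 2 * f x * f' x + 4 * C * exp x * (1 + (f x)\<^sup>2)"
    proof -
      have "\<bar>2 * f x * f' x\<bar> = 2 * \<bar>f x\<bar> * \<bar>f' x\<bar>" by (simp add: abs_mult)
      also have "\<dots> \<le> 2 * \<bar>f x\<bar> * (C * exp x * (1 + \<bar>f x\<bar>))" using le[OF x] by (intro mult_left_mono) auto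
      also have "\<dots> = 2 * (C * exp x) * (\<bar>f x\<bar> * (1 + \<bar>f x\<bar>))" by (simp add: mult_ac)
      also have "\<dots> \<le> 2 * (C * exp x) * (2 * (1 + (f x)\<^sup>2))"
      proof (intro mult_left_mono)
        have "2 * \<bar>f x\<bar> * 1 \<le> \<bar>f x\<bar>\<^sup>2 + 1\<^sup>2" by (rule sum_squares_bound)
        then show "\<bar>f x\<bar> * (1 + \<bar>f x\<bar>) \<le> 2 * (1 + (f x)\<^sup>2)"
          by (simp add: distrib_left flip: power2_eq_square)
      qed (use C in auto)
      finally show ?thesis by linarith
    qed
    ultimately show "\<exists>y. (h has_real_derivative y) (at x) \<and> 0 \<le> y"
      by (meson exp_ge_zero mult_nonneg_nonneg)
  qed
  moreover have "(f t)\<^sup>2 \<le> h t"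
  proof -
    have "(f t)\<^sup>2 * 1 \<le> (1 + (f t)\<^sup>2) * exp (4 * C * exp t)"
      using C by (intro mult_mono) auto
    then show ?thesis by (simp add: h_def)
  qed
  ultimately show ?thesis by (simp add: h_def)
qed

text \<open>\<open>f = O(e\<^sup>r\<^sup>t)\<close> as \<open>t \<rightarrow> -\<infinity>\<close>, uniformly in the
  parameter.\<close>

definition exp_bounded :: "real \<Rightarrow> (real \<times> real \<Rightarrow> 'b::real_normed_vector) \<Rightarrow> bool" where
  "exp_bounded r f \<longleftrightarrow> (\<exists>C t1. t1 \<le> -1 \<and> 0 \<le> C \<and> (\<forall>t\<le>t1. \<forall>u. norm (f (t, u)) \<le> C * exp (r * t)))"

lemma exp_boundedI: "t1 \<le> -1 \<Longrightarrow> 0 \<le> C \<Longrightarrow> (\<And>t u. t \<le> t1 \<Longrightarrow> norm (f (t, u)) \<le> C * exp (r * t)) \<Longrightarrow> exp_bounded r f"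
  unfolding exp_bounded_def by blast

lemma exp_boundedE:
  assumes "exp_bounded r f"
  obtains C t1 where "t1 \<le> -1" "0 \<le> C" "\<And>t u. t \<le> t1 \<Longrightarrow> norm (f (t, u)) \<le> C * exp (r * t)"
  using assms unfolding exp_bounded_def by blast

lemma exp_bounded_cong: "(\<And>p. p \<in> past \<Longrightarrow> f p = g p) \<Longrightarrow> exp_bounded r f \<Longrightarrow> exp_bounded r g"
  by (erule exp_boundedE, rule exp_boundedI) auto

lemma exp_bounded_weaken:
  assumes "exp_bounded r f" "s \<le> r" shows "exp_bounded s f"
proof -
  obtain C t1 where 1: "t1 \<le> -1" "0 \<le> C" "\<And>t u. t \<le> t1 \<Longrightarrow> norm (f (t, u)) \<le> C * exp (r * t)"
    using assms(1) by (rule exp_boundedE) blast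
  show ?thesis
  proof (rule exp_boundedI[OF 1(1,2)])
    fix t u assume t: "t \<le> t1"
    then have "r * t \<le> s * t" using assms(2) 1(1) by (intro mult_right_mono_neg) auto
    then have "C * exp (r * t) \<le> C * exp (s * t)" using 1(2) by (intro mult_left_mono) auto
    then show "norm (f (t, u)) \<le> C * exp (s * t)" using 1(3)[OF t, of u] by linarith
  qed
qed

lemma exp_bounded_add:
  assumes "exp_bounded r f" "exp_bounded r g" shows "exp_bounded r (\<lambda>p. f p + g p)"
proof -
  obtain C t1 where 1: "t1 \<le> -1" "0 \<le> C" "\<And>t u. t \<le> t1 \<Longrightarrow> norm (f (t, u)) \<le> C * exp (r * t)"
    using assms(1) by (rule exp_boundedE) blast
  obtain D t2 where 2: "t2 \<le> -1" "0 \<le> D" "\<And>t u. t \<le> t2 \<Longrightarrow> norm (g (t, u)) \<le> D * exp (r * t)"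
    using assms(2) by (rule exp_boundedE) blast
  show ?thesis
  proof (rule exp_boundedI[of "min t1 t2" "C + D"])
    fix t u assume "t \<le> min t1 t2"
    then show "norm (f (t, u) + g (t, u)) \<le> (C + D) * exp (r * t)"
      using 1(3)[of t u] 2(3)[of t u] norm_triangle_ineq[of "f (t, u)" "g (t, u)"]
      by (simp add: distrib_right)
  qed (use 1 2 in auto)
qed

lemma exp_bounded_bilinear:
  assumes b: "bounded_bilinear b" and "exp_bounded r f" "exp_bounded s g" shows "exp_bounded (r + s) (\<lambda>p. b (f p) (g p))"
proof -
  obtain C t1 where 1: "t1 \<le> -1" "0 \<le> C" "\<And>t u. t \<le> t1 \<Longrightarrow> norm (f (t, u)) \<le> C * exp (r * t)"
    using assms(2) by (rule exp_boundedE) blast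
  obtain D t2 where 2: "t2 \<le> -1" "0 \<le> D" "\<And>t u. t \<le> t2 \<Longrightarrow> norm (g (t, u)) \<le> D * exp (s * t)"
    using assms(3) by (rule exp_boundedE) blast
  obtain K where K: "0 \<le> K" "\<And>x y. norm (b x y) \<le> norm x * norm y * K"
    using bounded_bilinear.nonneg_bounded[OF b] by blast
  show ?thesis
  proof (rule exp_boundedI[of "min t1 t2" "C * D * K"])
    fix t u assume t: "t \<le> min t1 t2"
    have "norm (b (f (t, u)) (g (t, u))) \<le> norm (f (t, u)) * norm (g (t, u)) * K" by (rule K)
    also have "\<dots> \<le> (C * exp (r * t)) * (D * exp (s * t)) * K"
      using 1(2) 1(3)[of t u] 2(2) 2(3)[of t u] t K(1) by (intro mult_mono) auto
    moreover have "exp ((r + s) * t) = exp (r * t) * exp (s * t)"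
      by (simp add: distrib_right exp_add)
    ultimately show "norm (b (f (t, u)) (g (t, u))) \<le> C * D * K * exp ((r + s) * t)"
      by (simp add: mult_ac)
  qed (use 1 2 K in auto)
qed

lemma exp_bounded_minus: "exp_bounded r f \<Longrightarrow> exp_bounded r (\<lambda>p. - f p)"
  unfolding exp_bounded_def by simp

context spherical_flow
begin

lemma Ds_funpow_cong:
  "(\<And>p. p \<in> past \<Longrightarrow> f p = g p) \<Longrightarrow> p \<in> past \<Longrightarrow> (Ds ^^ n) f p = (Ds ^^ n) g p"
proof (induction n arbitrary: p)
  case (Suc n)
  show ?case unfolding funpow.simps o_def
    by (rule Ds_cong[OF _ Suc.prems(2)]) (rule Suc.IH[OF Suc.prems(1)])
qed simp

lemma Ds_funpow_add:
  "psmooth f \<Longrightarrow> psmooth g \<Longrightarrow> p \<in> past \<Longrightarrow> (Ds ^^ n) (\<lambda>p. f p + g p) p = (Ds ^^ n) f p + (Ds ^^ n) g p"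
proof (induction n arbitrary: p)
  case (Suc n)
  have "(Ds ^^ Suc n) (\<lambda>p. f p + g p) p = Ds (\<lambda>p. (Ds ^^ n) f p + (Ds ^^ n) g p) p"
    unfolding funpow.simps o_def
    by (rule Ds_cong[OF _ Suc.prems(3)]) (rule Suc.IH[OF Suc.prems(1,2)])
  then show ?case
    using Ds_add[OF psmooth_Ds_funpow psmooth_Ds_funpow, OF Suc.prems(1,2,3)] by simp
qed simp

text \<open>The same rate for all arclength derivatives of order at most \<open>n\<close>. Keeping track of
  \<open>n\<close> allows inductions in which \<open>n\<close> derivatives of the frame bound
  \<open>n + 1\<close> of them.\<close>

definition exp_bounded_upto :: "nat \<Rightarrow> real \<Rightarrow> (real \<times> real \<Rightarrow> 'b::real_normed_vector) \<Rightarrow> bool" where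
  "exp_bounded_upto n r f \<longleftrightarrow> (\<forall>j\<le>n. exp_bounded r ((Ds ^^ j) f))"

lemma exp_bounded_upto_0: "exp_bounded_upto 0 r f \<longleftrightarrow> exp_bounded r f" by (simp add: exp_bounded_upto_def)

lemma exp_bounded_upto_Suc: "exp_bounded_upto (Suc n) r f \<longleftrightarrow> exp_bounded r f \<and> exp_bounded_upto n r (Ds f)"
proof
  assume *: "exp_bounded_upto (Suc n) r f"
  have "exp_bounded r ((Ds ^^ j) (Ds f))" if "j \<le> n" for j
    using *[unfolded exp_bounded_upto_def, rule_format, of "Suc j"] that unfolding funpow_Suc_right o_def by simp
  moreover have "exp_bounded r f" using *[unfolded exp_bounded_upto_def, rule_format, of 0] by simp
  ultimately show "exp_bounded r f \<and> exp_bounded_upto n r (Ds f)" by (simp add: exp_bounded_upto_def)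
next
  assume *: "exp_bounded r f \<and> exp_bounded_upto n r (Ds f)"
  have "exp_bounded r ((Ds ^^ j) f)" if "j \<le> Suc n" for j
  proof (cases j)
    case (Suc i)
    then show ?thesis using * that unfolding exp_bounded_upto_def Suc funpow_Suc_right o_def by simp
  qed (use * in simp)
  then show "exp_bounded_upto (Suc n) r f" by (simp add: exp_bounded_upto_def)
qed

lemma exp_bounded_upto_mono: "exp_bounded_upto n r f \<Longrightarrow> m \<le> n \<Longrightarrow> exp_bounded_upto m r f"
  by (simp add: exp_bounded_upto_def)

lemma exp_bounded_upto_weaken: "exp_bounded_upto n r f \<Longrightarrow> s \<le> r \<Longrightarrow> exp_bounded_upto n s f"
  unfolding exp_bounded_upto_def using exp_bounded_weaken by blast

lemma exp_bounded_upto_cong: "(\<And>p. p \<in> past \<Longrightarrow> f p = g p) \<Longrightarrow> exp_bounded_upto n r f \<Longrightarrow> exp_bounded_upto n r g"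
  unfolding exp_bounded_upto_def
proof (intro allI impI)
  fix j assume *: "\<And>p. p \<in> past \<Longrightarrow> f p = g p" "\<forall>j\<le>n. exp_bounded r ((Ds ^^ j) f)" "j \<le> n"
  show "exp_bounded r ((Ds ^^ j) g)"
    by (rule exp_bounded_cong[OF Ds_funpow_cong[OF *(1)]]) (use *(2,3) in auto)
qed

lemma exp_bounded_upto_add: "psmooth f \<Longrightarrow> psmooth g \<Longrightarrow> exp_bounded_upto n r f \<Longrightarrow> exp_bounded_upto n r g \<Longrightarrow>
    exp_bounded_upto n r (\<lambda>p. f p + g p)"
  unfolding exp_bounded_upto_def
proof (intro allI impI)
  fix j assume *: "psmooth f" "psmooth g" "\<forall>j\<le>n. exp_bounded r ((Ds ^^ j) f)" "\<forall>j\<le>n. exp_bounded r ((Ds ^^ j) g)" "j \<le> n"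
  show "exp_bounded r ((Ds ^^ j) (\<lambda>p. f p + g p))"
    by (rule exp_bounded_cong[where f="\<lambda>p. (Ds ^^ j) f p + (Ds ^^ j) g p"])
      (use * in \<open>auto simp: Ds_funpow_add intro: exp_bounded_add\<close>)
qed

lemma exp_bounded_upto_bilinear:
  assumes b: "bounded_bilinear b"
  shows "psmooth f \<Longrightarrow> psmooth g \<Longrightarrow> exp_bounded_upto n r f \<Longrightarrow> exp_bounded_upto n s g \<Longrightarrow>
    exp_bounded_upto n (r + s) (\<lambda>p. b (f p) (g p))"
proof (induction n arbitrary: f g)
  case 0
  then show ?case using exp_bounded_bilinear[OF b] by (simp add: exp_bounded_upto_0)
next
  case (Suc n)
  have lower: "exp_bounded_upto n r f" "exp_bounded_upto n s g" using Suc.prems by (auto intro: exp_bounded_upto_mono)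
  have "exp_bounded_upto n (r + s) (\<lambda>p. b (f p) (Ds g p) + b (Ds f p) (g p))"
    using Suc lower by (intro exp_bounded_upto_add psmooth_bilinear[OF b] Suc.IH psmooth_Ds) (auto simp: exp_bounded_upto_Suc)
  then have "exp_bounded_upto n (r + s) (Ds (\<lambda>p. b (f p) (g p)))"
    by (rule exp_bounded_upto_cong[rotated]) (simp add: Ds_bilinear[OF b] Suc.prems)
  then show ?case using Suc.prems exp_bounded_bilinear[OF b] by (simp add: exp_bounded_upto_Suc)
qed

end

context convex_flow
begin

lemma exp_bounded_\<kappa>: "exp_bounded 1 (\<kappa> m)"
  using \<kappa>_decays[of m] unfolding exp_bounded_def by simp

lemma exp_bounded_upto_k: "exp_bounded_upto n 1 k"
  using exp_bounded_\<kappa> unfolding exp_bounded_upto_def \<kappa>_def by blast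

definition v_derivs where "v_derivs m = (Ds ^^ m) v"

lemma v_derivs_Suc: "v_derivs (Suc m) = Ds (v_derivs m)" by (simp add: v_derivs_def)

lemma psmooth_v_derivs: "psmooth (v_derivs m)" unfolding v_derivs_def by (intro psmooth_Ds_funpow psmooth_v)

lemma trilinear_Dt_v_derivs: "trilinear v_derivs (Suc m) m (Dt (v_derivs m))"
proof (induction m)
  case 0
  have "trilinear v_derivs (Suc 0) 0 (\<lambda>p. (-1) * (\<kappa> 0 p * \<kappa> 0 p * v_derivs 0 p))" by (intro trilinear.triple) auto
  then show ?case by (rule trilinear.equal) (simp add: \<kappa>_0 v_derivs_def Dt_v power2_eq_square)
next
  case (Suc m)
  have "trilinear v_derivs (Suc (Suc m)) (Suc m) (\<lambda>p. Ds (Dt (v_derivs m)) p + 1 * (\<kappa> 0 p * \<kappa> 0 p * v_derivs (Suc m) p))"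
    using trilinear_Ds[OF Suc psmooth_v_derivs v_derivs_Suc] by (intro trilinear.plus trilinear.triple) auto
  then show ?case
    by (rule trilinear.equal) (simp add: Dt_Ds[OF psmooth_v_derivs] v_derivs_Suc \<kappa>_0 power2_eq_square)
qed

text \<open>The top order factor \<open>v_derivs m\<close> is kept on the right-hand side, in the form needed for the
  Gronwall argument.\<close>

lemma trilinear_pointwise_bound:
  assumes "trilinear v_derivs n m f" and low: "\<And>l. l < m \<Longrightarrow> exp_bounded 0 (v_derivs l)"
  shows "\<exists>C t1. t1 \<le> -1 \<and> 0 \<le> C \<and> (\<forall>t\<le>t1. \<forall>u. \<bar>f (t, u)\<bar> \<le> C * exp t * (1 + \<bar>v_derivs m (t, u)\<bar>))"
  using assms
proof induction
  case (triple i n j l m c)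
  obtain A ta where A: "ta \<le> -1" "0 \<le> A" "\<And>t u. t \<le> ta \<Longrightarrow> norm (\<kappa> i (t, u)) \<le> A * exp (1 * t)"
    using exp_bounded_\<kappa>[of i] by (rule exp_boundedE) blast
  obtain B tb where B: "tb \<le> -1" "0 \<le> B" "\<And>t u. t \<le> tb \<Longrightarrow> norm (\<kappa> j (t, u)) \<le> B * exp (0 * t)"
    by (rule exp_boundedE[OF exp_bounded_weaken[OF exp_bounded_\<kappa>[of j], of 0]]) auto
  have "\<exists>D td. td \<le> -1 \<and> 0 \<le> D \<and> (\<forall>t\<le>td. \<forall>u. \<bar>v_derivs l (t, u)\<bar> \<le> D * (1 + \<bar>v_derivs m (t, u)\<bar>))"
  proof (cases "l = m")
    case True
    then have "\<forall>t\<le>-1. \<forall>u. \<bar>v_derivs l (t, u)\<bar> \<le> 1 * (1 + \<bar>v_derivs m (t, u)\<bar>)" by simp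
    then show ?thesis by (meson order_refl zero_le_one)
  next
    case False
    then have "exp_bounded 0 (v_derivs l)" using triple by simp
    then obtain D td where D: "td \<le> -1" "0 \<le> D" "\<And>t u. t \<le> td \<Longrightarrow> norm (v_derivs l (t, u)) \<le> D * exp (0 * t)"
      by (rule exp_boundedE) blast
    have "\<bar>v_derivs l (t, u)\<bar> \<le> D * (1 + \<bar>v_derivs m (t, u)\<bar>)" if "t \<le> td" for t u
      using D(3)[OF that, of u] mult_left_mono[of 1 "1 + \<bar>v_derivs m (t, u)\<bar>" D] D(2) by simp
    then show ?thesis using D by blast
  qed
  then obtain D td where D: "td \<le> -1" "0 \<le> D" "\<And>t u. t \<le> td \<Longrightarrow> \<bar>v_derivs l (t, u)\<bar> \<le> D * (1 + \<bar>v_derivs m (t, u)\<bar>)"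
    by blast
  have "\<bar>c * (\<kappa> i (t, u) * \<kappa> j (t, u) * v_derivs l (t, u))\<bar> \<le> \<bar>c\<bar> * A * B * D * exp t * (1 + \<bar>v_derivs m (t, u)\<bar>)"
    if t: "t \<le> min ta (min tb td)" for t u
  proof -
    have "\<bar>c * (\<kappa> i (t, u) * \<kappa> j (t, u) * v_derivs l (t, u))\<bar> = \<bar>c\<bar> * (\<bar>\<kappa> i (t, u)\<bar> * \<bar>\<kappa> j (t, u)\<bar> * \<bar>v_derivs l (t, u)\<bar>)"
      by (simp add: abs_mult)
    also have "\<dots> \<le> \<bar>c\<bar> * ((A * exp t) * B * (D * (1 + \<bar>v_derivs m (t, u)\<bar>)))"
      using t A(2) A(3)[of t u] B(2) B(3)[of t u] D(2) D(3)[of t u]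
      by (intro mult_left_mono mult_mono) (auto simp: mult_nonneg_nonneg)
    finally show ?thesis by (simp add: mult_ac)
  qed
  moreover have "min ta (min tb td) \<le> -1" using A by simp
  moreover have "0 \<le> \<bar>c\<bar> * A * B * D" using A B D by simp
  ultimately show ?case by blast
next
  case (plus n m f g)
  obtain A ta where A: "ta \<le> -1" "0 \<le> A" "\<And>t u. t \<le> ta \<Longrightarrow> \<bar>f (t, u)\<bar> \<le> A * exp t * (1 + \<bar>v_derivs m (t, u)\<bar>)"
    using plus.IH(1)[OF plus.prems] by blast
  obtain B tb where B: "tb \<le> -1" "0 \<le> B" "\<And>t u. t \<le> tb \<Longrightarrow> \<bar>g (t, u)\<bar> \<le> B * exp t * (1 + \<bar>v_derivs m (t, u)\<bar>)"
    using plus.IH(2)[OF plus.prems] by blast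
  have "\<bar>f (t, u) + g (t, u)\<bar> \<le> (A + B) * exp t * (1 + \<bar>v_derivs m (t, u)\<bar>)" if "t \<le> min ta tb" for t u
    using A(3)[of t u] B(3)[of t u] that abs_triangle_ineq[of "f (t, u)" "g (t, u)"]
    unfolding distrib_right by (auto simp: distrib_left)
  moreover have "min ta tb \<le> -1" "0 \<le> A + B" using A B by auto
  ultimately show ?case by blast
next
  case (equal n m f g)
  obtain A ta where A: "ta \<le> -1" "0 \<le> A" "\<And>t u. t \<le> ta \<Longrightarrow> \<bar>f (t, u)\<bar> \<le> A * exp t * (1 + \<bar>v_derivs m (t, u)\<bar>)"
    using equal.IH[OF equal.prems] by blast
  have "\<bar>g (t, u)\<bar> \<le> A * exp t * (1 + \<bar>v_derivs m (t, u)\<bar>)" if "t \<le> ta" for t u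
  proof -
    have "f (t, u) = g (t, u)" by (rule equal.hyps(2)) (use that A(1) in simp)
    then show ?thesis using A(3)[OF that, of u] by simp
  qed
  then show ?case using A by blast
qed

text \<open>Strong induction on the order: the time derivative of \<open>v_derivs m\<close> is at most
  \<open>C e\<^sup>t (1 + \<bar>v_derivs m\<bar>)\<close> once the lower orders are bounded.\<close>

lemma exp_bounded_v_derivs: "exp_bounded 0 (v_derivs m)"
proof (induction m rule: less_induct)
  case (less m)
  have "\<exists>C t1. t1 \<le> -1 \<and> 0 \<le> C \<and>
      (\<forall>t\<le>t1. \<forall>u. \<bar>Dt (v_derivs m) (t, u)\<bar> \<le> C * exp t * (1 + \<bar>v_derivs m (t, u)\<bar>))"
    by (rule trilinear_pointwise_bound[OF trilinear_Dt_v_derivs]) (rule less.IH)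
  then obtain C t1 where C: "t1 \<le> -1" "0 \<le> C"
    "\<And>t u. t \<le> t1 \<Longrightarrow> \<bar>Dt (v_derivs m) (t, u)\<bar> \<le> C * exp t * (1 + \<bar>v_derivs m (t, u)\<bar>)"
    by auto
  obtain S where S: "\<And>u. norm (v_derivs m (t1, u)) \<le> S"
    using psmooth_bounded_slice[OF psmooth_v_derivs, of t1 m] C(1) by force
  define K where "K = sqrt ((1 + S\<^sup>2) * exp (4 * C * exp t1))"
  show ?case
  proof (rule exp_boundedI[of t1 K])
    fix t u assume t: "t \<le> t1"
    have "(v_derivs m (t, u))\<^sup>2 \<le> (1 + (v_derivs m (t1, u))\<^sup>2) * exp (4 * C * exp t1)"
    proof (rule gronwall_past[of t1 "\<lambda>t. v_derivs m (t, u)" "\<lambda>t. Dt (v_derivs m) (t, u)" C t, OF _ C(3) C(2) t])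
      show "((\<lambda>t. v_derivs m (t, u)) has_real_derivative Dt (v_derivs m) (s, u)) (at s)" if "s \<le> t1" for s
        using Dt_has_vector_derivative[OF psmooth_v_derivs, of s] that C(1)
        by (simp add: has_real_derivative_iff_has_vector_derivative)
    qed
    also have "\<dots> \<le> (1 + S\<^sup>2) * exp (4 * C * exp t1)"
      using S[of u] abs_ge_zero[of "v_derivs m (t1, u)"] by (intro mult_right_mono add_left_mono) (auto intro: power2_le_iff_abs_le[THEN iffD2, OF order_trans[OF abs_ge_zero]])
    finally have "sqrt ((v_derivs m (t, u))\<^sup>2) \<le> K" unfolding K_def by (rule real_sqrt_le_mono)
    then show "norm (v_derivs m (t, u)) \<le> K * exp (0 * t)" by simp
  qed (use C in \<open>auto simp: K_def\<close>)
qed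

lemma exp_bounded_upto_v: "exp_bounded_upto n 0 v"
  using exp_bounded_v_derivs unfolding exp_bounded_upto_def v_derivs_def by blast

text \<open>By the Frenet equations, an arclength derivative of the frame is a combination of its vectors with
  coefficients \<open>\<plusminus>1\<close> and \<open>\<plusminus>k\<close>.\<close>

lemma exp_bounded_upto_frame: "exp_bounded_upto n 0 F \<and> exp_bounded_upto n 0 T \<and> exp_bounded_upto n 0 N"
proof (induction n)
  have "exp_bounded 0 F" "exp_bounded 0 T" "exp_bounded 0 N"
    using sphere TT[folded norm_eq_1] NN[folded norm_eq_1] by (auto intro!: exp_boundedI[of "-1" 1])
  note bd0 = this
  {
    case 0
    show ?case using bd0 by (simp add: exp_bounded_upto_0)
  next
    case (Suc n)
    have kn: "exp_bounded_upto n 0 k" by (rule exp_bounded_upto_weaken[OF exp_bounded_upto_k]) simp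
    have m: "exp_bounded_upto n 0 (\<lambda>p. (-1) *\<^sub>R f p)" if "psmooth f" "exp_bounded_upto n 0 f" for f :: "real \<times> real \<Rightarrow> real^3"
    proof -
      have "exp_bounded_upto n 0 (\<lambda>_. -1::real)"
      proof -
        have "exp_bounded 0 ((Ds ^^ j) (\<lambda>_. -1::real))" for j
        proof (cases j)
          case 0
          then show ?thesis by (auto intro!: exp_boundedI[of "-1" 1])
        next
          case (Suc i)
          have z: "Ds (\<lambda>_. c) = (\<lambda>_. 0)" for c :: real by (rule ext) simp
          have "(Ds ^^ i) (\<lambda>_. 0) = (\<lambda>_. 0::real)" by (induction i) (auto simp: z)
          then have "(Ds ^^ j) (\<lambda>_. -1::real) = (\<lambda>_. 0)"
            unfolding Suc funpow_Suc_right o_def z .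
          then show ?thesis by (auto intro!: exp_boundedI[of "-1" 1])
        qed
        then show ?thesis by (simp add: exp_bounded_upto_def)
      qed
      from exp_bounded_upto_bilinear[OF bounded_bilinear_scaleR psmooth_const that(1) this that(2)]
      show ?thesis by simp
    qed
    have kT: "exp_bounded_upto n 0 (\<lambda>p. k p *\<^sub>R T p)" and kN: "exp_bounded_upto n 0 (\<lambda>p. k p *\<^sub>R N p)"
      using exp_bounded_upto_bilinear[OF bounded_bilinear_scaleR psmooth_k psmooth_T kn]
        exp_bounded_upto_bilinear[OF bounded_bilinear_scaleR psmooth_k psmooth_N kn] Suc by auto
    have "exp_bounded_upto n 0 (\<lambda>p. k p *\<^sub>R N p + (-1) *\<^sub>R F p)"
      using Suc by (intro exp_bounded_upto_add psmooth_kN psmooth_scaleR psmooth_const F kN m) auto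
    then have "exp_bounded_upto n 0 (Ds T)" by (rule exp_bounded_upto_cong[rotated]) (simp add: Ds_T)
    moreover have "exp_bounded_upto n 0 (Ds N)"
      by (rule exp_bounded_upto_cong[OF _ m[OF psmooth_scaleR[OF psmooth_k psmooth_T] kT]]) (simp add: Ds_N)
    moreover have "exp_bounded_upto n 0 (Ds F)" using Suc by (simp add: T_def)
    ultimately show ?case using bd0 by (simp add: exp_bounded_upto_Suc)
  }
qed

lemma exp_bounded_upto_Du:
  fixes f :: "real \<times> real \<Rightarrow> 'b::real_normed_vector"
  assumes "psmooth f" "\<And>n. exp_bounded_upto n r f"
  shows "exp_bounded_upto n r (Du f)"
proof -
  have "exp_bounded_upto n r (Ds f)" using assms(2)[of "Suc n"] by (simp add: exp_bounded_upto_Suc)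
  from exp_bounded_upto_bilinear[OF bounded_bilinear_scaleR psmooth_v psmooth_Ds[OF assms(1)] exp_bounded_upto_v this]
  have "exp_bounded_upto n r (\<lambda>p. v p *\<^sub>R Ds f p)" by simp
  then show ?thesis by (rule exp_bounded_upto_cong[rotated]) (simp only: Du_eq_Ds)
qed

lemma psmooth_Du_funpow: "psmooth f \<Longrightarrow> psmooth ((Du ^^ j) f)"
  by (induction j) (auto intro: psmooth_Du)

lemma exp_bounded_upto_Du_funpow:
  assumes "psmooth f" "\<And>n. exp_bounded_upto n r f"
  shows "exp_bounded_upto n r ((Du ^^ j) f)"
  by (induction j arbitrary: n) (use assms in \<open>auto intro: exp_bounded_upto_Du psmooth_Du_funpow\<close>)

lemma Dt_Du_funpow: "p \<in> past \<Longrightarrow> Dt ((Du ^^ j) F) p = (Du ^^ j) (Dt F) p"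
proof (induction j arbitrary: p)
  case (Suc j)
  show ?case
    using Dt_Du_commute[OF psmooth_Du_funpow[OF F] Suc.prems, of j] Du_cong[OF Suc.IH Suc.prems] by simp
qed simp

text \<open>All parameter derivatives of the velocity \<open>k N\<close> decay like \<open>k\<close>; this is the bound
  that makes the flow converge backwards in time.\<close>

lemma exp_bounded_Dt_Du_F: "exp_bounded 1 (Dt ((Du ^^ j) F))"
proof -
  have "exp_bounded_upto n 1 (\<lambda>p. k p *\<^sub>R N p)" for n
    using exp_bounded_upto_bilinear[OF bounded_bilinear_scaleR psmooth_k psmooth_N exp_bounded_upto_k, of n 0] exp_bounded_upto_frame by simp
  then have "exp_bounded_upto n 1 (Dt F)" for n by (rule exp_bounded_upto_cong[rotated]) (simp add: Dt_F)
  then have "exp_bounded 1 ((Du ^^ j) (Dt F))"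
    using exp_bounded_upto_Du_funpow[OF psmooth_Dt[OF F], of 1 0 j] by (simp add: exp_bounded_upto_0)
  then show ?thesis by (rule exp_bounded_cong[rotated]) (simp add: Dt_Du_funpow)
qed

end

section \<open>The backward limit\<close>

lemma antiderivative_exists:
  fixes f :: "real \<Rightarrow> real"
  assumes "continuous_on UNIV f"
  obtains g where "\<And>x. (g has_real_derivative f x) (at x)" "g 0 = 0"
proof -
  define g where "g x = (if 0 \<le> x then integral {0..x} f else - integral {x..0} f)" for x
  have i: "f integrable_on {a..b}" for a b
    by (rule integrable_continuous_interval[OF continuous_on_subset[OF assms]]) simp
  have eq: "g y = integral {-M..y} f - integral {-M..0} f" if "-M < y" "M > 0" for y M
  proof (cases "0 \<le> y")
    case True
    then show ?thesis using Henstock_Kurzweil_Integration.integral_combine[OF _ _ i, of "-M" 0 y] that by (simp add: g_def)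
  next
    case False
    then show ?thesis using Henstock_Kurzweil_Integration.integral_combine[OF _ _ i, of "-M" y 0] that by (simp add: g_def)
  qed
  have "(g has_real_derivative f x) (at x)" for x
  proof -
    define M where "M = \<bar>x\<bar> + 1"
    have x: "x \<in> {-M<..<M}" by (auto simp: M_def)
    have "((\<lambda>y. integral {-M..y} f) has_vector_derivative f x) (at x within {-M..M})"
      using x by (intro integral_has_vector_derivative continuous_on_subset[OF assms]) auto
    then have "((\<lambda>y. integral {-M..y} f) has_vector_derivative f x) (at x)"
      using x by (simp add: at_within_Icc_at)
    then have "((\<lambda>y. integral {-M..y} f - integral {-M..0} f) has_vector_derivative f x - 0) (at x)"
      by (rule has_vector_derivative_diff[OF _ has_vector_derivative_const])
    then have "(g has_vector_derivative f x - 0) (at x)"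
      by (rule has_vector_derivative_transform_within_open[where S="{-M<..<M}"]) (use x eq in auto)
    then show ?thesis by (simp add: has_real_derivative_iff_has_vector_derivative)
  qed
  moreover have "g 0 = 0" by (simp add: g_def)
  ultimately show ?thesis using that by blast
qed

text \<open>The velocity is bounded by the derivative of \<open>C e\<^sup>t\<close>, so \<open>f(t, u)\<close> is Cauchy
  as \<open>t \<rightarrow> -\<infinity>\<close>, uniformly in \<open>u\<close>.\<close>

lemma backward_limit_exists:
  fixes f :: "real \<times> real \<Rightarrow> 'b::banach"
  assumes f: "psmooth f" and b: "exp_bounded 1 (Dt f)"
  shows "\<exists>g. uniform_limit UNIV (\<lambda>t u. f (t, u)) g at_bot"
proof -
  obtain C t1 where C: "t1 \<le> -1" "0 \<le> C" "\<And>t u. t \<le> t1 \<Longrightarrow> norm (Dt f (t, u)) \<le> C * exp (1 * t)"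
    using b by (rule exp_boundedE) blast
  have close: "norm (f (t, u) - f (s, u)) \<le> C * exp t" if st: "s \<le> t" "t \<le> t1" for s t u
  proof -
    have "norm (f (t, u) - f (s, u)) \<le> C * exp t - C * exp s"
    proof (cases "s = t")
      case False
      have d: "((\<lambda>t. f (t, u)) has_vector_derivative Dt f (x, u)) (at x)" if "x \<le> t" for x
        using that st C(1) by (intro Dt_has_vector_derivative[OF f]) auto
      show ?thesis
      proof (rule differentiable_bound_general[where f="\<lambda>t. f (t, u)" and \<phi>="\<lambda>t. C * exp t" and f'="\<lambda>x. Dt f (x, u)" and \<phi>'="\<lambda>t. C * exp t"])
        show "continuous_on {s..t} (\<lambda>t. f (t, u))"
          by (intro continuous_at_imp_continuous_on ballI has_vector_derivative_continuous[OF d]) auto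
      next
        fix x assume x: "s < x" "x < t"
        show "((\<lambda>t. f (t, u)) has_vector_derivative Dt f (x, u)) (at x)" using d x by simp
        show "((\<lambda>t. C * exp t) has_vector_derivative C * exp x) (at x)"
          unfolding has_real_derivative_iff_has_vector_derivative[symmetric] by (auto intro!: derivative_eq_intros)
        show "norm (Dt f (x, u)) \<le> C * exp x" using C(3)[of x u] x st by simp
      qed (use st False in \<open>auto intro!: continuous_intros\<close>)
    qed simp
    then show ?thesis using C(2) by (smt (verit) exp_ge_zero mult_nonneg_nonneg)
  qed
  have small: "\<exists>t0\<le>t1. \<forall>t\<le>t0. C * exp t < e" if e: "e > 0" for e
  proof -
    have "((\<lambda>t. C * exp t) \<longlongrightarrow> C * 0) (at_bot :: real filter)" by (intro tendsto_intros exp_at_bot)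
    then have "\<forall>\<^sub>F t in at_bot. C * exp t < e" using e by (intro order_tendstoD(2)) auto
    then obtain t0 where t0: "\<forall>t\<le>t0. C * exp t < e" by (auto simp: eventually_at_bot_linorder)
    then show ?thesis by (intro exI[of _ "min t0 t1"]) auto
  qed
  have "\<exists>l. (\<lambda>n. f (- real n, u)) \<longlonglongrightarrow> l" for u
  proof -
    have "Cauchy (\<lambda>n. f (- real n, u))"
    proof (rule metric_CauchyI)
      fix e :: real assume e: "0 < e"
      obtain t0 where t0: "t0 \<le> t1" "\<forall>t\<le>t0. C * exp t < e" using small[OF e] by blast
      have "dist (f (- real m, u)) (f (- real n, u)) < e" if "m \<ge> nat \<lceil>- t0\<rceil>" "n \<ge> nat \<lceil>- t0\<rceil>" for m n
      proof -
        have "- real m \<le> t0" "- real n \<le> t0" using that by linarith+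
        then show ?thesis
          using close[of "- real m" "- real n" u] close[of "- real n" "- real m" u] t0
          unfolding dist_norm
          by (cases "m \<le> n") (smt (verit, best) norm_minus_commute of_nat_mono linorder_linear)+
      qed
      then show "\<exists>M. \<forall>m\<ge>M. \<forall>n\<ge>M. dist (f (- real m, u)) (f (- real n, u)) < e" by blast
    qed
    then show ?thesis by (simp add: Cauchy_convergent_iff convergent_def)
  qed
  then obtain g where g: "\<And>u. (\<lambda>n. f (- real n, u)) \<longlonglongrightarrow> g u" by metis
  have gclose: "norm (f (t, u) - g u) \<le> C * exp t" if t: "t \<le> t1" for t u
  proof (rule Lim_norm_ubound[OF sequentially_bot])
    show "(\<lambda>n. f (t, u) - f (- real n, u)) \<longlonglongrightarrow> f (t, u) - g u" by (intro tendsto_intros g)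
    have "norm (f (t, u) - f (- real n, u)) \<le> C * exp t" if "n \<ge> nat \<lceil>- t\<rceil>" for n
      using that by (intro close t) linarith
    then show "\<forall>\<^sub>F n in sequentially. norm (f (t, u) - f (- real n, u)) \<le> C * exp t"
      unfolding eventually_sequentially by blast
  qed
  have "uniform_limit UNIV (\<lambda>t u. f (t, u)) g at_bot"
    unfolding uniform_limit_iff
  proof (intro allI impI)
    fix e :: real assume e: "0 < e"
    obtain t0 where t0: "t0 \<le> t1" "\<forall>t\<le>t0. C * exp t < e" using small[OF e] by blast
    have "dist (f (t, x)) (g x) < e" if "t \<le> t0" for t x
      using gclose[of t x] t0 that unfolding dist_norm by (meson le_less_trans order_trans)
    then have "\<forall>t\<le>t0. \<forall>x\<in>UNIV. dist (f (t, x)) (g x) < e" by blast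
    then show "\<forall>\<^sub>F t in at_bot. \<forall>x\<in>UNIV. dist (f (t, x)) (g x) < e"
      unfolding eventually_at_bot_linorder by blast
  qed
  then show ?thesis by blast
qed

context convex_flow
begin

text \<open>The limit curve (\<open>j = 0\<close>) and its parameter derivatives, a priori only the limits of the
  parameter derivatives of the flow.\<close>

definition G where "G j = (SOME g. uniform_limit UNIV (\<lambda>t u. (Du ^^ j) F (t, u)) g at_bot)"

lemma G_limit: "uniform_limit UNIV (\<lambda>t u. (Du ^^ j) F (t, u)) (G j) at_bot"
  using someI_ex[OF backward_limit_exists[OF psmooth_Du_funpow[OF F] exp_bounded_Dt_Du_F, of j]]
  unfolding G_def .

lemma G_tendsto: "((\<lambda>t. (Du ^^ j) F (t, u)) \<longlongrightarrow> G j u) at_bot"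
  using tendsto_uniform_limitI[OF G_limit] by simp

lemma minus_real_at_bot: "filterlim (\<lambda>n. - real n) at_bot sequentially"
  by (simp add: filterlim_uminus_at_bot filterlim_real_sequentially)

lemma G_deriv: "(G j has_vector_derivative G (Suc j) u) (at u)"
proof -
  have sl: "filterlim (\<lambda>n. - real (Suc n)) at_bot sequentially"
      using minus_real_at_bot filterlim_Suc filterlim_compose[of "\<lambda>n. - real n" at_bot sequentially Suc sequentially] by simp
  have "\<exists>g. \<forall>x\<in>UNIV. (\<lambda>n. (Du ^^ j) F (- real (Suc n), x)) \<longlonglongrightarrow> g x \<and>
      (g has_derivative (\<lambda>h. h *\<^sub>R G (Suc j) x)) (at x)"
  proof (rule has_derivative_sequence[where S=UNIV and f'="\<lambda>n x h. h *\<^sub>R (Du ^^ Suc j) F (- real (Suc n), x)"])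
    show "((\<lambda>x. (Du ^^ j) F (- real (Suc n), x)) has_derivative (\<lambda>h. h *\<^sub>R (Du ^^ Suc j) F (- real (Suc n), x))) (at x)" for n x
      using Du_has_vector_derivative[OF psmooth_Du_funpow[OF F], of "- real (Suc n)" j x]
      by (simp add: has_vector_derivative_def)
    fix e :: real assume e: "e > 0"
    have "\<forall>\<^sub>F t in at_bot. \<forall>x\<in>UNIV. dist ((Du ^^ Suc j) F (t, x)) (G (Suc j) x) < e"
      using G_limit[of "Suc j"] e unfolding uniform_limit_iff by blast
    from eventually_compose_filterlim[OF this sl]
    show "\<forall>\<^sub>F n in sequentially. \<forall>x\<in>UNIV. \<forall>h. norm (h *\<^sub>R (Du ^^ Suc j) F (- real (Suc n), x) - h *\<^sub>R G (Suc j) x) \<le> e * norm h"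
    proof (rule eventually_mono, intro ballI allI)
      fix n x and h :: real
      assume "\<forall>x\<in>UNIV. dist ((Du ^^ Suc j) F (- real (Suc n), x)) (G (Suc j) x) < e"
      then have "norm ((Du ^^ Suc j) F (- real (Suc n), x) - G (Suc j) x) \<le> e"
        unfolding dist_norm using less_imp_le by blast
      then have "\<bar>h\<bar> * norm ((Du ^^ Suc j) F (- real (Suc n), x) - G (Suc j) x) \<le> \<bar>h\<bar> * e"
        by (rule mult_left_mono) simp
      then show "norm (h *\<^sub>R (Du ^^ Suc j) F (- real (Suc n), x) - h *\<^sub>R G (Suc j) x) \<le> e * norm h"
        by (simp only: scaleR_diff_right[symmetric] norm_scaleR real_norm_def mult.commute)
    qed
  next
    show "(\<lambda>n. (Du ^^ j) F (- real (Suc n), u)) \<longlonglongrightarrow> G j u"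
      by (rule filterlim_compose[OF G_tendsto sl])
  qed auto
  then obtain g where g: "\<And>x. (\<lambda>n. (Du ^^ j) F (- real (Suc n), x)) \<longlonglongrightarrow> g x"
    "\<And>x. (g has_derivative (\<lambda>h. h *\<^sub>R G (Suc j) x)) (at x)" by blast
  have "g x = G j x" for x
  proof (rule LIMSEQ_unique[OF g(1)])
    show "(\<lambda>n. (Du ^^ j) F (- real (Suc n), x)) \<longlonglongrightarrow> G j x"
      by (rule filterlim_compose[OF G_tendsto sl])
  qed
  then have "g = G j" by blast
  then show ?thesis using g(2) by (simp add: has_vector_derivative_def)
qed

lemma G_smooth: "smooth_on UNIV (G j)"
proof -
  have "Ck_on n UNIV (G j)" for n
  proof (induction n arbitrary: j)
    case 0
    then show ?case
      using G_deriv by (auto intro!: continuous_at_imp_continuous_on has_vector_derivative_continuous)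
  next
    case (Suc n)
    show ?case
    proof (rule Ck_on_SucI[where f'="\<lambda>x h. h *\<^sub>R G (Suc j) x"])
      show "(G j has_derivative (\<lambda>h. h *\<^sub>R G (Suc j) x)) (at x)" for x
        using G_deriv by (simp add: has_vector_derivative_def)
      show "Ck_on n UNIV (\<lambda>x. v *\<^sub>R G (Suc j) x)" for v
        by (intro Ck_on_bilinear[OF bounded_bilinear_scaleR] Ck_on_const Suc.IH open_UNIV)
    qed simp
  qed
  then show ?thesis by (simp add: smooth_on_def)
qed

lemma eventually_past: "\<forall>\<^sub>F t in at_bot. t < (0::real)"
  using eventually_at_bot_dense[of "\<lambda>t. t < (0::real)"] by blast

lemma G_periodic: "G j (u + 2 * pi) = G j u"
proof (rule tendsto_unique[OF trivial_limit_at_bot_linorder G_tendsto])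
  show "((\<lambda>t. (Du ^^ j) F (t, u + 2 * pi)) \<longlongrightarrow> G j u) at_bot"
    by (rule Lim_transform_eventually[OF G_tendsto])
      (use eventually_past in eventually_elim, simp add: psmooth_periodic[OF psmooth_Du_funpow[OF F]])
qed

lemma G0_norm: "norm (G 0 u) = 1"
proof (rule tendsto_unique[OF trivial_limit_at_bot_linorder tendsto_norm[OF G_tendsto]])
  show "((\<lambda>t. norm ((Du ^^ 0) F (t, u))) \<longlongrightarrow> 1) at_bot"
    by (rule Lim_transform_eventually[OF tendsto_const])
      (use eventually_past in eventually_elim, simp add: sphere)
qed

text \<open>The speed increases towards the past, so the limit is an immersion.\<close>

lemma G_pos_speed: "v (-1, u) \<le> norm (G 1 u)"
proof (rule tendsto_lowerbound[OF tendsto_norm[OF G_tendsto]])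
  show "\<forall>\<^sub>F t in at_bot. v (- 1, u) \<le> norm ((Du ^^ 1) F (t, u))"
    using eventually_le_at_bot[of "-1"]
    by eventually_elim (use v_antimono[of _ "-1" u] in \<open>simp add: speed_def\<close>)
qed simp

lemma G1_nonzero: "norm (G 1 u) > 0"
  by (rule less_le_trans[OF v_pos G_pos_speed]) simp

definition \<sigma> where "\<sigma> u = G 1 u /\<^sub>R norm (G 1 u)"
text \<open>The cross product at one point already is the normal of the plane of the whole limit curve.\<close>

definition limit_normal where "limit_normal = cross3 (G 0 0) (\<sigma> 0)"

lemma T_tendsto: "((\<lambda>t. T (t, u)) \<longlongrightarrow> \<sigma> u) at_bot"
proof -
  have "((\<lambda>t. (Du ^^ 1) F (t, u) /\<^sub>R norm ((Du ^^ 1) F (t, u))) \<longlongrightarrow> \<sigma> u) at_bot"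
    unfolding \<sigma>_def using G1_nonzero[of u] by (intro tendsto_intros G_tendsto) auto
  then show ?thesis by (simp add: T_def arc_deriv_def speed_def)
qed

lemma N_tendsto: "((\<lambda>t. N (t, u)) \<longlongrightarrow> cross3 (G 0 u) (\<sigma> u)) at_bot"
  unfolding N_def
  using bounded_bilinear.tendsto[OF bounded_bilinear_cross3 G_tendsto[of 0 u] T_tendsto[of u]] by simp

text \<open>The normal turns at the rate \<open>\<partial>\<^sub>uN = - v k T\<close>, which tends to zero uniformly.\<close>

lemma normal_constant: "cross3 (G 0 u) (\<sigma> u) = limit_normal"
proof -
  have "exp_bounded_upto n 1 (\<lambda>p. k p *\<^sub>R T p)" for n
    using exp_bounded_upto_bilinear[OF bounded_bilinear_scaleR psmooth_k psmooth_T exp_bounded_upto_k, of n 0] exp_bounded_upto_frame by simp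
  from exp_bounded_upto_bilinear[OF bounded_bilinear_scaleR psmooth_v psmooth_scaleR[OF psmooth_k psmooth_T] exp_bounded_upto_v this]
  have "exp_bounded 1 (\<lambda>p. v p *\<^sub>R k p *\<^sub>R T p)" by (simp add: exp_bounded_upto_0[symmetric])
  then have "exp_bounded 1 (\<lambda>p. - (v p *\<^sub>R k p *\<^sub>R T p))" by (rule exp_bounded_minus)
  then have "exp_bounded 1 (Du N)" by (rule exp_bounded_cong[rotated]) (simp only: Du_eq_Ds Ds_N scaleR_minus_left scaleR_minus_right)
  then obtain C t1 where C: "t1 \<le> -1" "0 \<le> C" "\<And>t u. t \<le> t1 \<Longrightarrow> norm (Du N (t, u)) \<le> C * exp (1 * t)"
    by (rule exp_boundedE) blast
  have "norm (N (t, u) - N (t, 0)) \<le> C * exp t * norm (u - 0)" if t: "t \<le> t1" for t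
  proof (rule differentiable_bound[where f="\<lambda>u. N (t, u)" and f'="\<lambda>u h. h *\<^sub>R Du N (t, u)" and S=UNIV])
    fix x
    show "((\<lambda>u. N (t, u)) has_derivative (\<lambda>h. h *\<^sub>R Du N (t, x))) (at x)"
      using Du_has_vector_derivative[OF psmooth_N, of t x] t C(1) by (simp add: has_vector_derivative_def)
    show "onorm (\<lambda>h. h *\<^sub>R Du N (t, x)) \<le> C * exp t"
      using C(3)[OF t, of x] C(2) by (intro onorm_le) (auto intro: mult_left_mono simp: mult.commute[of _ "\<bar>_\<bar>"])
  qed auto
  then have ev: "\<forall>\<^sub>F t in at_bot. norm (N (t, u) - N (t, 0)) \<le> C * exp t * norm (u - 0)"
    unfolding eventually_at_bot_linorder by blast
  have "((\<lambda>t. C * exp t * norm (u - 0)) \<longlongrightarrow> C * 0 * norm (u - 0)) at_bot"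
    by (intro tendsto_intros exp_at_bot)
  then have "((\<lambda>t. N (t, u) - N (t, 0)) \<longlongrightarrow> 0) at_bot"
    using Lim_null_comparison[OF ev] by simp
  moreover have "((\<lambda>t. N (t, u) - N (t, 0)) \<longlongrightarrow> cross3 (G 0 u) (\<sigma> u) - limit_normal) at_bot"
    unfolding limit_normal_def by (intro tendsto_diff N_tendsto)
  ultimately show ?thesis using tendsto_unique[OF trivial_limit_at_bot_linorder] by fastforce
qed

lemma frame_limit:
  "G 0 u \<bullet> G 0 u = 1" "\<sigma> u \<bullet> \<sigma> u = 1" "limit_normal \<bullet> limit_normal = 1"
  "G 0 u \<bullet> \<sigma> u = 0" "G 0 u \<bullet> limit_normal = 0" "\<sigma> u \<bullet> limit_normal = 0"
proof -
  show 1: "G 0 u \<bullet> G 0 u = 1" using G0_norm by (simp add: dot_square_norm)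
  show 2: "\<sigma> u \<bullet> \<sigma> u = 1" using G1_nonzero[of u] by (simp add: \<sigma>_def dot_square_norm power2_eq_square)
  have "((\<lambda>t. F (t, u) \<bullet> T (t, u)) \<longlongrightarrow> G 0 u \<bullet> \<sigma> u) at_bot"
    using tendsto_inner[OF G_tendsto[of 0 u] T_tendsto[of u]] by simp
  moreover have "((\<lambda>t. F (t, u) \<bullet> T (t, u)) \<longlongrightarrow> 0) at_bot"
    by (rule Lim_transform_eventually[OF tendsto_const])
      (use eventually_past in eventually_elim, simp add: FT)
  ultimately show 3: "G 0 u \<bullet> \<sigma> u = 0" using tendsto_unique[OF trivial_limit_at_bot_linorder] by blast
  show "limit_normal \<bullet> limit_normal = 1"
    unfolding normal_constant[of u, symmetric] using 1 2 3 by (simp add: dot_cross)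
  show "G 0 u \<bullet> limit_normal = 0" "\<sigma> u \<bullet> limit_normal = 0"
    unfolding normal_constant[of u, symmetric] by (simp_all add: dot_cross_self)
qed

lemma limit_frame_expand: "w = (w \<bullet> G 0 u) *\<^sub>R G 0 u + (w \<bullet> \<sigma> u) *\<^sub>R \<sigma> u + (w \<bullet> limit_normal) *\<^sub>R limit_normal"
proof -
  note fr = frame_limit(1,2,4,5,6)[of u] frame_limit(3)
  let ?w = "w - (w \<bullet> G 0 u) *\<^sub>R G 0 u - (w \<bullet> \<sigma> u) *\<^sub>R \<sigma> u"
  have "?w = (?w \<bullet> limit_normal) *\<^sub>R limit_normal"
    by (rule orthonormal_triple_expand[of "G 0 u" "\<sigma> u" limit_normal])
      (use fr in \<open>auto simp: norm_eq_1 inner_diff_left inner_diff_right inner_commute\<close>)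
  moreover have "?w \<bullet> limit_normal = w \<bullet> limit_normal"
    using fr by (simp add: inner_diff_left inner_diff_right inner_commute)
  ultimately have "?w = (w \<bullet> limit_normal) *\<^sub>R limit_normal" by simp
  then show ?thesis by (simp add: algebra_simps)
qed

lemma G0_deriv: "(G 0 has_vector_derivative norm (G 1 u) *\<^sub>R \<sigma> u) (at u)"
  using G_deriv[of 0 u] G1_nonzero[of u] by (simp add: \<sigma>_def)

text \<open>In the orthonormal frame \<open>G 0, \<sigma>, limit_normal\<close> the components of
  \<open>\<sigma>'\<close> follow by differentiating the constant inner products.\<close>

lemma \<sigma>_deriv: "(\<sigma> has_vector_derivative - norm (G 1 u) *\<^sub>R G 0 u) (at u)"
proof -
  have "G 1 differentiable (at u)" using G_deriv[of 1 u] by (auto simp: has_vector_derivative_def differentiable_def)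
  moreover have "(norm \<circ> G 1) differentiable (at u)"
    using G1_nonzero[of u] calculation by (intro differentiable_chain_at differentiable_norm_at) auto
  ultimately have "\<sigma> differentiable (at u)"
    unfolding \<sigma>_def[abs_def] using G1_nonzero[of u]
    by (intro differentiable_scaleR differentiable_inverse) (auto simp: o_def)
  then obtain w where w: "(\<sigma> has_vector_derivative w) (at u)"
    using vector_derivative_works by blast
  have prod: "f u \<bullet> w + f' \<bullet> \<sigma> u = 0"
    if "(f has_vector_derivative f') (at u)" "\<And>u. f u \<bullet> \<sigma> u = c" for f f' c
  proof -
    have "((\<lambda>u. f u \<bullet> \<sigma> u) has_vector_derivative (f u \<bullet> w + f' \<bullet> \<sigma> u)) (at u)"
      by (rule bounded_bilinear.has_vector_derivative[OF bounded_bilinear_inner that(1) w])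
    moreover have "((\<lambda>u. f u \<bullet> \<sigma> u) has_vector_derivative 0) (at u)" unfolding that(2) by simp
    ultimately show ?thesis by (rule vector_derivative_unique_at)
  qed
  have "w \<bullet> \<sigma> u = 0" using prod[OF w frame_limit(2)] by (simp add: inner_commute)
  moreover have "w \<bullet> G 0 u = - norm (G 1 u)"
    using prod[OF G0_deriv frame_limit(4)] frame_limit(2)[of u] by (simp add: inner_commute)
  moreover have "w \<bullet> limit_normal = 0"
    using prod[OF has_vector_derivative_const, of limit_normal 0] frame_limit(6) by (simp add: inner_commute)
  ultimately show ?thesis using limit_frame_expand[of w u] w by simp
qed

text \<open>The arclength of the limit curve, which is also the angle along the equator.\<close>

definition \<Theta> where "\<Theta> = (SOME g. (\<forall>x. (g has_real_derivative norm (G 1 x)) (at x)) \<and> g 0 = 0)"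

lemma \<Theta>_deriv: "(\<Theta> has_real_derivative norm (G 1 x)) (at x)" and \<Theta>_0: "\<Theta> 0 = 0"
proof -
  have "continuous_on UNIV (\<lambda>x. norm (G 1 x))"
    using G_smooth[of 1] by (intro continuous_on_norm) (auto simp: smooth_on_def dest: spec[of _ 0])
  then have "\<exists>g. (\<forall>x. (g has_real_derivative norm (G 1 x)) (at x)) \<and> g 0 = 0"
    using antiderivative_exists by metis
  from someI_ex[OF this] show "(\<Theta> has_real_derivative norm (G 1 x)) (at x)" "\<Theta> 0 = 0"
    unfolding \<Theta>_def by auto
qed

lemma \<Theta>_strict_mono: "x < y \<Longrightarrow> \<Theta> x < \<Theta> y"
  using DERIV_pos_imp_increasing[of x y \<Theta>] \<Theta>_deriv G1_nonzero by blast

lemma \<Theta>_continuous: "continuous_on A \<Theta>"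
  using \<Theta>_deriv by (intro continuous_at_imp_continuous_on) (auto intro: DERIV_isCont)

lemma \<Theta>_shift: "\<Theta> (u + 2 * pi) = \<Theta> u + \<Theta> (2 * pi)"
proof -
  have "((\<lambda>u. \<Theta> (u + 2 * pi) - \<Theta> u) has_real_derivative 0) (at x)" for x
  proof -
    have "((\<lambda>u. \<Theta> (u + 2 * pi)) has_real_derivative norm (G 1 (x + 2 * pi)) * 1) (at x)"
      by (rule DERIV_chain2[OF \<Theta>_deriv]) (auto intro!: derivative_eq_intros)
    from DERIV_diff[OF this \<Theta>_deriv] show ?thesis by (simp add: G_periodic)
  qed
  then have "\<Theta> (u + 2 * pi) - \<Theta> u = \<Theta> (0 + 2 * pi) - \<Theta> 0"
    using DERIV_isconst_all[of "\<lambda>u. \<Theta> (u + 2 * pi) - \<Theta> u" u 0] by blast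
  then show ?thesis by (simp add: \<Theta>_0)
qed

text \<open>Rotating the moving frame back by the angle \<open>\<Theta>\<close> gives vectors with zero derivative.\<close>

lemma rotated_frame:
  "cos (\<Theta> u) *\<^sub>R G 0 u - sin (\<Theta> u) *\<^sub>R \<sigma> u = G 0 0"
  "sin (\<Theta> u) *\<^sub>R G 0 u + cos (\<Theta> u) *\<^sub>R \<sigma> u = \<sigma> 0"
proof -
  have c: "((\<lambda>u. cos (\<Theta> u)) has_real_derivative - sin (\<Theta> u) * norm (G 1 u)) (at u)"
    and s: "((\<lambda>u. sin (\<Theta> u)) has_real_derivative cos (\<Theta> u) * norm (G 1 u)) (at u)" for u
    by (auto intro!: derivative_eq_intros \<Theta>_deriv)
  note d = has_vector_derivative_scaleR[OF c G0_deriv] has_vector_derivative_scaleR[OF s \<sigma>_deriv]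
    has_vector_derivative_scaleR[OF s G0_deriv] has_vector_derivative_scaleR[OF c \<sigma>_deriv]
  have "((\<lambda>u. cos (\<Theta> u) *\<^sub>R G 0 u - sin (\<Theta> u) *\<^sub>R \<sigma> u) has_vector_derivative 0) (at u)" for u
    using has_vector_derivative_diff[OF d(1,2), of u] by (simp add: algebra_simps)
  from has_vector_derivative_zero_constant[OF convex_UNIV this]
  obtain a where "\<And>u. cos (\<Theta> u) *\<^sub>R G 0 u - sin (\<Theta> u) *\<^sub>R \<sigma> u = a" by auto
  from this[of u] this[of 0] show "cos (\<Theta> u) *\<^sub>R G 0 u - sin (\<Theta> u) *\<^sub>R \<sigma> u = G 0 0" by (simp add: \<Theta>_0)
  have "((\<lambda>u. sin (\<Theta> u) *\<^sub>R G 0 u + cos (\<Theta> u) *\<^sub>R \<sigma> u) has_vector_derivative 0) (at u)" for u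
    using has_vector_derivative_add[OF d(3,4), of u] by (simp add: algebra_simps)
  from has_vector_derivative_zero_constant[OF convex_UNIV this]
  obtain a where "\<And>u. sin (\<Theta> u) *\<^sub>R G 0 u + cos (\<Theta> u) *\<^sub>R \<sigma> u = a" by auto
  from this[of u] this[of 0] show "sin (\<Theta> u) *\<^sub>R G 0 u + cos (\<Theta> u) *\<^sub>R \<sigma> u = \<sigma> 0" by (simp add: \<Theta>_0)
qed

lemma G0_circle: "G 0 u = cos (\<Theta> u) *\<^sub>R G 0 0 + sin (\<Theta> u) *\<^sub>R \<sigma> 0"
proof -
  have "cos (\<Theta> u) *\<^sub>R G 0 0 + sin (\<Theta> u) *\<^sub>R \<sigma> 0 =
      ((cos (\<Theta> u))\<^sup>2 + (sin (\<Theta> u))\<^sup>2) *\<^sub>R G 0 u"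
    unfolding rotated_frame[of u, symmetric]
    by (simp only: scaleR_diff_right scaleR_add_right scaleR_scaleR scaleR_add_left power2_eq_square
        mult.commute[of "sin _" "cos _"]) (simp only: add_diff_eq diff_add_cancel add_diff_add algebra_simps)
  then show ?thesis by simp
qed

end

section \<open>The limit is traversed once\<close>

text \<open>The increments over \<open>d\<close> consecutive steps of length \<open>a\<close> add up to zero, so they
  cannot all have the same strict sign.\<close>

lemma periodic_increment_vanishes:
  fixes H :: "real \<Rightarrow> real"
  assumes c: "continuous_on UNIV H" and p: "H (a * real d) = H 0" and d: "d \<ge> 1"
  obtains x where "H (x + a) = H x"
proof -
  define D where "D x = H (x + a) - H x" for x
  have cD: "continuous_on A D" for A
    unfolding D_def by (intro continuous_intros continuous_on_compose2[OF c]) auto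
  have "(\<Sum>j<d. D (a * real j)) = H (a * real d) - H 0"
    by (induction d) (auto simp: D_def algebra_simps)
  then have sum: "(\<Sum>j<d. D (a * real j)) = 0" using p by simp
  have "\<exists>y z. D y \<le> 0 \<and> 0 \<le> D z"
  proof (rule ccontr)
    assume "\<not> ?thesis"
    then have "(\<forall>y. D y > 0) \<or> (\<forall>y. D y < 0)" by (meson linorder_not_less less_imp_le)
    then show False
      using sum sum_pos[of "{..<d}" "\<lambda>j. D (a * real j)"] sum_pos[of "{..<d}" "\<lambda>j. - D (a * real j)"] d
      by (auto simp: sum_negf lessThan_empty_iff)
  qed
  then obtain y z where yz: "D y \<le> 0" "0 \<le> D z" by blast
  have "\<exists>x. D x = 0"
  proof (cases "y \<le> z")
    case True
    then show ?thesis using IVT'[of D y 0 z] yz cD by blast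
  next
    case False
    then show ?thesis using IVT2'[of D y 0 z] yz cD by (metis linear)
  qed
  then show ?thesis using that by (auto simp: D_def)
qed

locale embedded_flow = convex_flow +
  assumes embedded: "t < 0 \<Longrightarrow> F (t, u) = F (t, w) \<Longrightarrow> cis u = cis w"
begin

lemma embedded_period:
  assumes "t < 0" "F (t, u) = F (t, w)" "u < w" "w < u + 2 * pi"
  shows False
proof -
  have "cis (w - u) = 1"
    using embedded[OF assms(1,2)] by (simp add: cis_divide[symmetric])
  then have "cos (w - u) = 1" by (simp add: complex_eq_iff)
  then obtain n :: int where n: "w - u = of_int n * 2 * pi" using cos_one_2pi_int by auto
  then have "0 < of_int n * (2 * pi)" "of_int n * (2 * pi) < 1 * (2 * pi)"
    using assms by (simp_all add: mult.assoc[symmetric] n[symmetric])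
  then have "0 < (of_int n :: real)" "(of_int n :: real) < 1"
    using mult_less_cancel_right_pos[of "2 * pi" "of_int n" 1] zero_less_mult_pos2[of "of_int n" "2 * pi"] pi_gt_zero
    by linarith+
  then show False by simp
qed

text \<open>The number \<open>d\<close> counts how often the limit runs around the equator.\<close>

lemma \<Theta>_period: "\<exists>d::nat. 1 \<le> d \<and> \<Theta> (2 * pi) = 2 * pi * real d"
proof -
  have "G 0 (2 * pi) = G 0 0" using G_periodic[of 0 0] by simp
  then have "cos (\<Theta> (2 * pi)) = 1"
    using arg_cong[OF G0_circle[of "2 * pi"], of "\<lambda>x. x \<bullet> G 0 0"] frame_limit(1,2,4,5,6)[of 0] frame_limit(3)
    by (simp add: inner_add_left inner_add_right inner_commute)
  then obtain n :: int where n: "\<Theta> (2 * pi) = of_int n * 2 * pi" using cos_one_2pi_int by auto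
  have "0 < \<Theta> (2 * pi)" using \<Theta>_strict_mono[of 0 "2 * pi"] by (simp add: \<Theta>_0)
  then have "0 < n" using n by (simp add: zero_less_mult_iff)
  then have "1 \<le> nat n \<and> \<Theta> (2 * pi) = 2 * pi * real (nat n)" using n by simp
  then show ?thesis by blast
qed

lemma close_time:
  assumes "e > 0"
  shows "\<exists>t<0. \<forall>u. norm (F (t, u) - G 0 u) < e \<and> norm (Du F (t, u) - G 1 u) < e"
proof -
  have "\<forall>\<^sub>F t in at_bot. \<forall>u\<in>UNIV. dist ((Du ^^ 0) F (t, u)) (G 0 u) < e"
    "\<forall>\<^sub>F t in at_bot. \<forall>u\<in>UNIV. dist ((Du ^^ 1) F (t, u)) (G 1 u) < e"
    using G_limit assms unfolding uniform_limit_iff by blast+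
  then have "\<forall>\<^sub>F t in at_bot. t < 0 \<and> (\<forall>u. norm (F (t, u) - G 0 u) < e \<and> norm (Du F (t, u) - G 1 u) < e)"
    using eventually_past by eventually_elim (simp add: dist_norm)
  from eventually_happens[OF this] show ?thesis by (auto simp: trivial_limit_at_bot_linorder)
qed

lemma speed_bounds: "\<exists>c V. 0 < c \<and> 0 < V \<and> (\<forall>u. c \<le> norm (G 1 u) \<and> norm (G 1 u) \<le> V)"
proof -
  have cont: "continuous_on {0..2*pi} (\<lambda>u. norm (G 1 u))"
    using Ck_on_continuous[of 0 UNIV "G 1"] G_smooth[of 1] unfolding smooth_on_def
    by (intro continuous_on_norm) (meson continuous_on_subset subset_UNIV)
  have "\<exists>x\<in>{0..2*pi}. \<forall>y\<in>{0..2*pi}. norm (G 1 x) \<le> norm (G 1 y)"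
    by (rule continuous_attains_inf[OF compact_Icc _ cont]) simp
  then obtain x where x: "\<And>y. y \<in> {0..2*pi} \<Longrightarrow> norm (G 1 x) \<le> norm (G 1 y)" by blast
  have "\<exists>z\<in>{0..2*pi}. \<forall>y\<in>{0..2*pi}. norm (G 1 y) \<le> norm (G 1 z)"
    by (rule continuous_attains_sup[OF compact_Icc _ cont]) simp
  then obtain z where z: "\<And>y. y \<in> {0..2*pi} \<Longrightarrow> norm (G 1 y) \<le> norm (G 1 z)" by blast
  have "norm (G 1 x) \<le> norm (G 1 u) \<and> norm (G 1 u) \<le> norm (G 1 z)" for u
    using periodic_value[of "G 1" u] G_periodic x z by metis
  then show ?thesis using G1_nonzero by blast
qed

text \<open>Far in the past the curve lies near the equator and moves around it monotonically. Relative to the moving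
  frame \<open>G 0 u, \<sigma> u\<close> its projection to the plane of the equator has coordinates
  \<open>(p, q)\<close> near \<open>(1, 0)\<close>, so \<open>a = \<Theta> + arctan (q / p)\<close> is an
  angle function for the projection, and its derivative is close to \<open>\<Theta>'\<close>.\<close>

lemma nearly_limit_angle:
  obtains t a a' where "t < 0" "\<And>u. (a has_real_derivative a' u) (at u)" "\<And>u. a' u > 0"
    "\<And>u. a (u + 2 * pi) = a u + \<Theta> (2 * pi)"
    "\<And>u. F (t, u) = (sqrt (1 - (F (t, u) \<bullet> limit_normal)\<^sup>2)) *\<^sub>R (cos (a u) *\<^sub>R G 0 0 + sin (a u) *\<^sub>R \<sigma> 0) +
        (F (t, u) \<bullet> limit_normal) *\<^sub>R limit_normal"
proof -
  obtain c V where cV: "0 < c" "0 < V" "\<And>u. c \<le> norm (G 1 u)" "\<And>u. norm (G 1 u) \<le> V"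
    using speed_bounds by blast
  \<comment> \<open>A perturbation of this size keeps \<open>p\<close> above \<open>3/4\<close> and changes the angular speed by less than \<open>c\<close>.\<close>
  define e where "e = min (1 / 4) (c / (12 * (1 + V)))"
  have e: "0 < e" "e \<le> 1 / 4" using cV unfolding e_def by (auto simp only: min.cobounded1 min_less_iff_conj intro!: divide_pos_pos mult_pos_pos add_pos_pos)
  have eV: "6 * (e * (1 + V)) < c"
  proof -
    have "e \<le> c / (12 * (1 + V))" unfolding e_def by (rule min.cobounded2)
    then have "e * (12 * (1 + V)) \<le> c" using cV by (simp add: pos_le_divide_eq)
    moreover have "e * (12 * (1 + V)) = 12 * (e * (1 + V))" by simp
    moreover have "0 < e * (1 + V)" using cV e by simp
    ultimately show ?thesis by linarith
  qed
  obtain t where t: "t < 0" "\<And>u. norm (F (t, u) - G 0 u) < e" "\<And>u. norm (Du F (t, u) - G 1 u) < e"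
    using close_time[OF e(1)] by blast
  define p q where "p u = F (t, u) \<bullet> G 0 u" and "q u = F (t, u) \<bullet> \<sigma> u" for u
  define p' q' where "p' u = Du F (t, u) \<bullet> G 0 u + F (t, u) \<bullet> (norm (G 1 u) *\<^sub>R \<sigma> u)"
    and "q' u = Du F (t, u) \<bullet> \<sigma> u - F (t, u) \<bullet> (norm (G 1 u) *\<^sub>R G 0 u)" for u
  define a where "a u = \<Theta> u + arctan (q u / p u)" for u
  \<comment> \<open>The derivative of \<open>arctan (q / p)\<close>.\<close>
  define b where "b u = (q' u * p u - q u * p' u) / ((p u)\<^sup>2 + (q u)\<^sup>2)" for u
  have G1: "G 1 u = norm (G 1 u) *\<^sub>R \<sigma> u" for u using G1_nonzero[of u] by (simp add: \<sigma>_def)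
  have ip: "\<bar>x \<bullet> y\<bar> \<le> norm x" if "y \<bullet> y = 1" for x y :: "real^3"
  proof -
    have "norm y = 1" using that by (simp add: norm_eq_1)
    then show ?thesis using Cauchy_Schwarz_ineq2[of x y] by simp
  qed
  have pq: "\<bar>p u - 1\<bar> \<le> e" "\<bar>q u\<bar> \<le> e" "\<bar>p' u\<bar> \<le> e * (1 + V)" "\<bar>q' u\<bar> \<le> e * (1 + V)" for u
  proof -
    note fr = frame_limit(1,2,4,5,6)[of u] frame_limit(3)
    let ?x = "F (t, u) - G 0 u" and ?y = "Du F (t, u) - G 1 u" and ?w = "norm (G 1 u)"
    have p: "p u - 1 = ?x \<bullet> G 0 u" and q: "q u = ?x \<bullet> \<sigma> u"
      using frame_limit(1,2,4,5,6)[of u] frame_limit(3) by (simp_all add: p_def q_def inner_diff_left)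
    have "G 1 u \<bullet> y = (?w *\<^sub>R \<sigma> u) \<bullet> y" for y by (simp only: G1[symmetric])
    then have g: "G 1 u \<bullet> G 0 u = 0" "G 1 u \<bullet> \<sigma> u = ?w" using fr by (simp_all add: inner_commute)
    have p': "p' u = ?y \<bullet> G 0 u + ?w * (?x \<bullet> \<sigma> u)"
      using frame_limit(1,2,4,5,6)[of u] frame_limit(3) g by (simp add: p'_def inner_diff_left inner_diff_right inner_commute)
    have q': "q' u = ?y \<bullet> \<sigma> u - ?w * (?x \<bullet> G 0 u)"
      using frame_limit(1,2,4,5,6)[of u] frame_limit(3) g by (simp add: q'_def inner_diff_left algebra_simps)
    have x: "\<bar>?x \<bullet> G 0 u\<bar> \<le> e" "\<bar>?x \<bullet> \<sigma> u\<bar> \<le> e" and y: "\<bar>?y \<bullet> G 0 u\<bar> \<le> e" "\<bar>?y \<bullet> \<sigma> u\<bar> \<le> e"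
      using ip[OF frame_limit(1)] ip[OF frame_limit(2)] t(2)[of u] t(3)[of u] by (meson less_imp_le order_trans)+
    show "\<bar>p u - 1\<bar> \<le> e" "\<bar>q u\<bar> \<le> e" using x by (simp_all add: p q)
    have w: "\<bar>?w * z\<bar> \<le> V * e" if "\<bar>z\<bar> \<le> e" for z
      unfolding abs_mult using that cV by (intro mult_mono) (auto simp: less_imp_le)
    show "\<bar>p' u\<bar> \<le> e * (1 + V)" "\<bar>q' u\<bar> \<le> e * (1 + V)"
      unfolding p' q' using w[OF x(1)] w[OF x(2)] y by (simp_all add: algebra_simps)
  qed
  have p34: "3 / 4 \<le> p u" "p u \<le> 5 / 4" for u using pq(1)[of u] e by linarith+
  have dp: "(p has_real_derivative p' u) (at u)" and dq: "(q has_real_derivative q' u) (at u)" for u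
  proof -
    note d = bounded_bilinear.has_vector_derivative[OF bounded_bilinear_inner Du_has_vector_derivative[OF F t(1)]]
    show "(p has_real_derivative p' u) (at u)"
      using d[OF G0_deriv, of u] by (simp add: p_def[abs_def] p'_def has_real_derivative_iff_has_vector_derivative add.commute)
    show "(q has_real_derivative q' u) (at u)"
      using d[OF \<sigma>_deriv, of u] by (simp add: q_def[abs_def] q'_def has_real_derivative_iff_has_vector_derivative)
  qed
  have da: "(a has_real_derivative norm (G 1 u) + b u) (at u)" for u
  proof -
    have p0: "p u \<noteq> 0" using p34[of u] by auto
    have "((\<lambda>u. q u / p u) has_real_derivative (q' u * p u - q u * p' u) / (p u * p u)) (at u)"
      by (rule DERIV_divide[OF dq dp p0])
    from DERIV_chain2[OF DERIV_arctan this]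
    have "((\<lambda>u. arctan (q u / p u)) has_real_derivative b u) (at u)"
    proof (rule DERIV_cong)
      have pos: "(p u)\<^sup>2 + (q u)\<^sup>2 \<noteq> 0" using p0 by (simp add: sum_power2_eq_zero_iff)
      have "1 + (q u / p u)\<^sup>2 = ((p u)\<^sup>2 + (q u)\<^sup>2) / (p u)\<^sup>2"
        using p0 by (simp add: field_simps)
      then show "inverse (1 + (q u / p u)\<^sup>2) * ((q' u * p u - q u * p' u) / (p u * p u)) = b u"
        using p0 pos by (simp add: b_def power2_eq_square)
    qed
    then show ?thesis unfolding a_def[abs_def] by (intro DERIV_add \<Theta>_deriv)
  qed
  have bpos: "norm (G 1 u) + b u > 0" for u
  proof -
    have "\<bar>q' u * p u - q u * p' u\<bar> \<le> \<bar>q' u\<bar> * \<bar>p u\<bar> + \<bar>q u\<bar> * \<bar>p' u\<bar>"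
      using abs_triangle_ineq4[of "q' u * p u" "q u * p' u"] by (simp add: abs_mult)
    also have "\<dots> \<le> (e * (1 + V)) * (5 / 4) + (1 / 4) * (e * (1 + V))"
      using pq[of u] p34[of u] e cV by (intro add_mono mult_mono) auto
    also have "\<dots> \<le> 2 * (e * (1 + V))" using e cV by simp
    finally have num: "\<bar>q' u * p u - q u * p' u\<bar> \<le> 2 * (e * (1 + V))" .
    have "(3 / 4)\<^sup>2 \<le> (p u)\<^sup>2" using p34[of u] by (intro power_mono) auto
    moreover have "(3 / 4)\<^sup>2 = (9 / 16 :: real)" by (simp add: power_divide)
    ultimately have den: "1 / 2 \<le> (p u)\<^sup>2 + (q u)\<^sup>2" using zero_le_power2[of "q u"] by linarith
    have "\<bar>b u\<bar> = \<bar>q' u * p u - q u * p' u\<bar> / ((p u)\<^sup>2 + (q u)\<^sup>2)" by (simp add: b_def)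
    also have "\<dots> \<le> (2 * (e * (1 + V))) / (1 / 2)"
      using num den e cV by (intro frac_le) auto
    finally have "\<bar>b u\<bar> < c" using eV e cV mult_pos_pos[of e "1 + V"] by simp
    then show ?thesis using cV(3)[of u] by linarith
  qed
  have per: "a (u + 2 * pi) = a u + \<Theta> (2 * pi)" for u
    by (simp add: a_def p_def q_def \<Theta>_shift G_periodic \<sigma>_def psmooth_periodic[OF F t(1)])
  have rep: "F (t, u) = (sqrt (1 - (F (t, u) \<bullet> limit_normal)\<^sup>2)) *\<^sub>R (cos (a u) *\<^sub>R G 0 0 + sin (a u) *\<^sub>R \<sigma> 0) +
        (F (t, u) \<bullet> limit_normal) *\<^sub>R limit_normal" for u
  proof -
    let ?f = "F (t, u)" and ?r = "sqrt ((p u)\<^sup>2 + (q u)\<^sup>2)" and ?\<alpha> = "arctan (q u / p u)"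
    have ex: "?f = p u *\<^sub>R G 0 u + q u *\<^sub>R \<sigma> u + (?f \<bullet> limit_normal) *\<^sub>R limit_normal"
      unfolding p_def q_def by (rule limit_frame_expand)
    have "?f \<bullet> ?f = (p u)\<^sup>2 + (q u)\<^sup>2 + (?f \<bullet> limit_normal)\<^sup>2"
      using arg_cong[OF ex, of "\<lambda>x. ?f \<bullet> x"] by (simp add: inner_add_right p_def q_def power2_eq_square)
    then have r: "1 - (?f \<bullet> limit_normal)\<^sup>2 = (p u)\<^sup>2 + (q u)\<^sup>2" using FF[of "(t, u)"] t(1) by simp
    have p0: "p u > 0" using p34[of u] by auto
    have sq: "sqrt (1 + (q u / p u)\<^sup>2) = ?r / p u"
    proof -
      have "1 + (q u / p u)\<^sup>2 = ((p u)\<^sup>2 + (q u)\<^sup>2) / (p u)\<^sup>2" using p0 by (simp add: field_simps)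
      then show ?thesis using p0 by (simp add: real_sqrt_divide)
    qed
    have r0: "?r > 0" using p0 by (intro real_sqrt_gt_zero add_pos_nonneg) auto
    have pc: "?r * cos ?\<alpha> = p u" and qs: "?r * sin ?\<alpha> = q u"
      unfolding cos_arctan sin_arctan sq using p0 r0 by simp_all
    have "?r *\<^sub>R (cos (a u) *\<^sub>R G 0 0 + sin (a u) *\<^sub>R \<sigma> 0) =
        (?r * cos ?\<alpha>) *\<^sub>R (cos (\<Theta> u) *\<^sub>R G 0 0 + sin (\<Theta> u) *\<^sub>R \<sigma> 0) +
        (?r * sin ?\<alpha>) *\<^sub>R (cos (\<Theta> u) *\<^sub>R \<sigma> 0 - sin (\<Theta> u) *\<^sub>R G 0 0)"
      by (simp add: a_def cos_add sin_add algebra_simps)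
    also have "cos (\<Theta> u) *\<^sub>R \<sigma> 0 - sin (\<Theta> u) *\<^sub>R G 0 0 = \<sigma> u"
    proof -
      have "cos (\<Theta> u) *\<^sub>R \<sigma> 0 - sin (\<Theta> u) *\<^sub>R G 0 0 = (cos (\<Theta> u) * cos (\<Theta> u) + sin (\<Theta> u) * sin (\<Theta> u)) *\<^sub>R \<sigma> u"
        unfolding rotated_frame[of u, symmetric]
        by (simp only: scaleR_diff_right scaleR_add_right scaleR_scaleR scaleR_add_left
            mult.commute[of "sin _" "cos _"]) (simp only: algebra_simps)
      then show ?thesis by simp
    qed
    also note G0_circle[of u, symmetric]
    finally have "?r *\<^sub>R (cos (a u) *\<^sub>R G 0 0 + sin (a u) *\<^sub>R \<sigma> 0) = p u *\<^sub>R G 0 u + q u *\<^sub>R \<sigma> u"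
      unfolding pc qs .
    then show ?thesis using ex unfolding r by simp
  qed
  show ?thesis by (rule that[OF t(1) da bpos per rep])
qed

text \<open>Let \<open>\<psi>\<close> be the inverse of the angle function and consider the height of the curve above
  the plane of the equator as a function of the angle. If the limit ran around more than once, two points with
  angles \<open>x\<close> and \<open>x + 2\<pi>\<close> and the same height would be different points of the
  circle with the same image.\<close>

lemma total_angle: "\<Theta> (2 * pi) = 2 * pi"
proof -
  obtain d :: nat where d: "1 \<le> d" "\<Theta> (2 * pi) = 2 * pi * real d" using \<Theta>_period by blast
  have "d = 1"
  proof (rule ccontr)
    assume "d \<noteq> 1"
    then have d2: "2 \<le> d" using d by simp
    obtain t a a' where t: "t < 0" and da: "\<And>u. (a has_real_derivative a' u) (at u)" "\<And>u. a' u > 0"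
      and per: "\<And>u. a (u + 2 * pi) = a u + \<Theta> (2 * pi)"
      and rep: "\<And>u. F (t, u) = (sqrt (1 - (F (t, u) \<bullet> limit_normal)\<^sup>2)) *\<^sub>R (cos (a u) *\<^sub>R G 0 0 + sin (a u) *\<^sub>R \<sigma> 0) +
        (F (t, u) \<bullet> limit_normal) *\<^sub>R limit_normal"
      using nearly_limit_angle by metis
    have mono: "a x < a y" if "x < y" for x y
      using DERIV_pos_imp_increasing[OF that, of a] da by blast
    have cont: "continuous_on A a" for A
      using da(1) by (intro continuous_at_imp_continuous_on) (auto intro: DERIV_isCont)
    have shift: "a (u + 2 * pi * real m) = a u + real m * \<Theta> (2 * pi)" for u m
    proof (induction m)
      case (Suc m)
      have eq: "u + 2 * pi * real (Suc m) = (u + 2 * pi * real m) + 2 * pi" by (simp add: algebra_simps)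
      show ?case unfolding eq per Suc.IH by (simp add: algebra_simps)
    qed simp
    have surj: "\<exists>u. a u = x" for x
    proof -
      define m where "m = nat \<lceil>\<bar>x - a 0\<bar>\<rceil>"
      have m: "\<bar>x - a 0\<bar> \<le> real m" unfolding m_def by linarith
      have "real m * 1 \<le> real m * \<Theta> (2 * pi)"
      proof (intro mult_left_mono)
        have "1 * 1 \<le> 2 * pi * real d" using d(1) pi_ge_two by (intro mult_mono) auto
        then show "1 \<le> \<Theta> (2 * pi)" using d(2) by simp
      qed simp
      then have "a (- 2 * pi * real m) \<le> x" "x \<le> a (2 * pi * real m)"
        using shift[of 0 m] shift[of "- 2 * pi * real m" m] m by auto
      then show ?thesis
        using IVT'[of a "- 2 * pi * real m" x "2 * pi * real m"] cont by (auto simp: mult_nonneg_nonneg)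
    qed
    define \<psi> where "\<psi> x = (THE u. a u = x)" for x
    have inj: "a x = a y \<Longrightarrow> x = y" for x y using mono by (metis less_irrefl linorder_neqE)
    have \<psi>a: "\<psi> (a u) = u" for u unfolding \<psi>_def using inj by (intro the_equality) auto
    have a\<psi>: "a (\<psi> x) = x" for x using surj[of x] \<psi>a by metis
    have \<psi>mono: "\<psi> x \<le> \<psi> y" if "x \<le> y" for x y
      using mono a\<psi> that by (metis leD linorder_not_le)
    have "continuous_on UNIV \<psi>"
    proof (rule continuous_onI_mono)
      have "\<psi> ` UNIV = UNIV" using \<psi>a by (metis surjI)
      then show "open (\<psi> ` UNIV)" by simp
    qed (use \<psi>mono in auto)
    then have cH: "continuous_on UNIV (\<lambda>x. F (t, \<psi> x) \<bullet> limit_normal)"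
      by (intro continuous_intros continuous_on_compose2[OF psmooth_continuous_slice[OF F t]]) auto
    have \<psi>per: "\<psi> (x + \<Theta> (2 * pi)) = \<psi> x + 2 * pi" for x
      using per[of "\<psi> x"] \<psi>a[of "\<psi> x + 2 * pi"] a\<psi> by simp
    have "F (t, \<psi> (2 * pi * real d)) \<bullet> limit_normal = F (t, \<psi> 0) \<bullet> limit_normal"
      using \<psi>per[of 0] psmooth_periodic[OF F t, of "\<psi> 0"] d(2) by simp
    then obtain x where x: "F (t, \<psi> (x + 2 * pi)) \<bullet> limit_normal = F (t, \<psi> x) \<bullet> limit_normal"
      using periodic_increment_vanishes[OF cH _ d(1), of "2 * pi"] by blast
    have "F (t, \<psi> x) = F (t, \<psi> (x + 2 * pi))"
      using rep[of "\<psi> x"] rep[of "\<psi> (x + 2 * pi)"] x by (simp add: a\<psi>)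
    moreover have "\<psi> x < \<psi> (x + 2 * pi)"
      using \<psi>mono[of x "x + 2 * pi"] a\<psi>[of x] a\<psi>[of "x + 2 * pi"] by (auto simp: le_less)
    moreover have "\<psi> (x + 2 * pi) < \<psi> x + 2 * pi"
    proof -
      have "2 * pi * 1 < 2 * pi * real d" using d2 by (intro mult_strict_left_mono) auto
      then have "x + 2 * pi < x + \<Theta> (2 * pi)" using d(2) by simp
      then have "\<psi> (x + 2 * pi) < \<psi> (x + \<Theta> (2 * pi))"
        using \<psi>mono[of "x + 2 * pi" "x + \<Theta> (2 * pi)"] a\<psi>[of "x + 2 * pi"] a\<psi>[of "x + \<Theta> (2 * pi)"]
        by (metis le_less less_irrefl less_imp_le)
      then show ?thesis by (simp add: \<psi>per)
    qed
    ultimately show False using embedded_period[OF t] by blast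
  qed
  then show ?thesis using d by simp
qed

lemma limit_injective:
  assumes "u \<in> {0..<2*pi}" "w \<in> {0..<2*pi}" "G 0 u = G 0 w"
  shows "u = w"
proof -
  have rng: "0 \<le> \<Theta> x \<and> \<Theta> x < 2 * pi" if "x \<in> {0..<2*pi}" for x
    using \<Theta>_strict_mono[of 0 x] \<Theta>_strict_mono[of x "2 * pi"] that total_angle \<Theta>_0
    by (cases "x = 0") auto
  have co: "G 0 x \<bullet> G 0 0 = cos (\<Theta> x)" "G 0 x \<bullet> \<sigma> 0 = sin (\<Theta> x)" for x
    unfolding G0_circle[of x] using frame_limit(1,2,4,5,6)[of 0] frame_limit(3) by (simp_all add: inner_add_left inner_add_right inner_commute)
  have "sin (\<Theta> u) = sin (\<Theta> w) \<and> cos (\<Theta> u) = cos (\<Theta> w)" using co[of u] co[of w] assms(3) by simp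
  then obtain m :: int where m: "\<Theta> u = \<Theta> w + 2 * pi * of_int m" using sin_cos_eq_iff by blast
  define X where "X = 2 * pi * of_int m"
  have "X < 2 * pi" "- (2 * pi) < X"
    unfolding X_def using m
    using conjunct1[OF rng[OF assms(1)]] conjunct2[OF rng[OF assms(1)]]
      conjunct1[OF rng[OF assms(2)]] conjunct2[OF rng[OF assms(2)]] by linarith+
  then have "(of_int m :: real) < 1" "-1 < (of_int m :: real)"
    using mult_less_cancel_left_pos[of "2 * pi" "of_int m" 1]
      mult_less_cancel_left_pos[of "2 * pi" "-1" "of_int m"] by (simp_all add: X_def)
  then have "m = 0" by linarith
  then have "\<Theta> u = \<Theta> w" using m by simp
  then show ?thesis using \<Theta>_strict_mono by (metis less_irrefl linorder_neqE)
qed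

lemma limit_image: "range (G 0) = {x \<in> S2. limit_normal \<bullet> x = 0}"
proof (intro equalityI subsetI)
  fix x assume "x \<in> range (G 0)"
  then show "x \<in> {x \<in> S2. limit_normal \<bullet> x = 0}" using G0_norm frame_limit(5) by (auto simp: inner_commute)
next
  fix x :: "real^3" assume "x \<in> {x \<in> S2. limit_normal \<bullet> x = 0}"
  then have x: "x \<bullet> x = 1" "x \<bullet> limit_normal = 0" by (auto simp: dot_square_norm inner_commute)
  have ex: "x = (x \<bullet> G 0 0) *\<^sub>R G 0 0 + (x \<bullet> \<sigma> 0) *\<^sub>R \<sigma> 0"
    using limit_frame_expand[of x 0] x(2) by simp
  have "(x \<bullet> G 0 0)\<^sup>2 + (x \<bullet> \<sigma> 0)\<^sup>2 = 1"
    using arg_cong[OF ex, of "\<lambda>y. x \<bullet> y"] x(1) by (simp add: inner_add_right power2_eq_square)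
  then obtain s where s: "0 \<le> s" "s \<le> 2 * pi" "x \<bullet> G 0 0 = cos s" "x \<bullet> \<sigma> 0 = sin s"
    using sincos_total_2pi_le by blast
  obtain u where "\<Theta> u = s"
    using IVT'[of \<Theta> 0 s "2 * pi"] s(1,2) \<Theta>_0 total_angle \<Theta>_continuous by auto
  then have "x = G 0 u" using ex s G0_circle[of u] by simp
  then show "x \<in> range (G 0)" by blast
qed

end

section \<open>From the circle to the line and back\<close>

lemma circle_deriv_cis:
  assumes "((\<lambda>u. f (cis u)) has_vector_derivative d) (at u)"
  shows "circle_deriv f (cis u) = d"
proof -
  have "(((\<lambda>u. f (cis u)) \<circ> (\<lambda>x. u + x)) has_vector_derivative 1 *\<^sub>R d) (at 0)"
    by (rule vector_diff_chain_at) (use assms in \<open>auto intro!: derivative_eq_intros\<close>)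
  then have "((\<lambda>x. f (cis u * cis x)) has_vector_derivative d) (at 0)"
    by (simp add: o_def cis_mult)
  then show ?thesis unfolding circle_deriv_def by (rule vector_derivative_at)
qed

text \<open>Iterated derivatives on the circle are the iterated parameter derivatives of the pullback.\<close>

lemma circle_deriv_funpow_cis:
  assumes "\<And>j u. (g j has_vector_derivative g (Suc j) u) (at u)" "\<And>u. f (cis u) = g 0 u"
  shows "(circle_deriv ^^ m) f (cis u) = g m u"
proof (induction m arbitrary: u)
  case (Suc m)
  have "((\<lambda>u. (circle_deriv ^^ m) f (cis u)) has_vector_derivative g (Suc m) u) (at u)"
    unfolding Suc.IH using assms(1) .
  then show ?case by (simp add: circle_deriv_cis)
qed (simp add: assms)

lemma S1_cis: "z \<in> S1 \<Longrightarrow> z = cis (Arg2pi z)"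
  using Arg2pi_eq[of z] by (simp add: cis_conv_exp)

lemma cis_S1: "cis u \<in> S1" by simp

lemma circle_diffeo_ident: "circle_diffeo (\<lambda>z. z)"
proof -
  have "Ck_on m UNIV (\<lambda>u::real. c * cis u)" for m c
  proof (induction m arbitrary: c)
    case (Suc m)
    show ?case
    proof (rule Ck_on_SucI[where f'="\<lambda>u h. h *\<^sub>R ((c * \<i>) * cis u)"])
      show "((\<lambda>u. c * cis u) has_derivative (\<lambda>h. h *\<^sub>R ((c * \<i>) * cis u))) (at u)" for u
        by (auto intro!: derivative_eq_intros simp: scaleR_conv_of_real algebra_simps)
      show "Ck_on m UNIV (\<lambda>u. h *\<^sub>R ((c * \<i>) * cis u))" for h
        by (intro Ck_on_bilinear[OF bounded_bilinear_scaleR] Ck_on_const Suc.IH open_UNIV)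
    qed simp
  qed (auto simp: cis_conv_exp intro!: continuous_intros)
  from this[of _ 1] have "circle_smooth (\<lambda>z. z)"
    by (simp add: circle_smooth_def smooth_on_def)
  moreover have "inv_into S1 (\<lambda>z. z) (cis u) = cis u" for u
    by (rule inv_into_f_f[of "\<lambda>z. z" S1 "cis u"]) auto
  ultimately show ?thesis by (simp add: circle_diffeo_def circle_smooth_def bij_betw_def)
qed

lemma continuous_nonzero_one_sign:
  fixes s :: "real \<Rightarrow> real"
  assumes "continuous_on UNIV s" "\<And>u. s u \<noteq> 0"
  shows "(\<forall>u. 0 < s u) \<or> (\<forall>u. s u < 0)"
proof (rule ccontr)
  assume "\<not> ?thesis"
  then obtain y z where yz: "s y \<le> 0" "0 \<le> s z" by (meson linorder_not_less)
  have c: "continuous_on A s" for A using assms(1) by (rule continuous_on_subset) simp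
  have "\<exists>x. s x = 0"
  proof (cases "y \<le> z")
    case True
    then show ?thesis using IVT'[of s y 0 z] yz c by blast
  next
    case False
    then show ?thesis using IVT2'[of s y 0 z] yz c by (metis linear)
  qed
  then show False using assms(2) by blast
qed

text \<open>The given normal \<open>\<nu>\<close> is \<open>s N\<close> with a continuous function \<open>s\<close>
  along the curve that has no zeros, so \<open>k\<close>, which is \<open>s\<close> times the given curvature,
  has one sign. The flow equation for \<open>N\<close> follows because \<open>\<kappa> \<nu>\<close> is the
  tangential part of \<open>F\<^sub>s\<^sub>s\<close>.\<close>

lemma convex_solution_embedded_flow:
  assumes flow: "curve_shortening_flow J F \<nu>" and J: "{..<0} \<subseteq> J"
    and convex: "\<And>t z. t \<in> J \<Longrightarrow> z \<in> S1 \<Longrightarrow> geodesic_curvature (F t) (\<nu> t) z \<ge> 0"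
  shows "embedded_flow (\<lambda>p. F (fst p) (cis (snd p)))"
proof -
  define H where "H p = F (fst p) (cis (snd p))" for p :: "real \<times> real"
  have tJ: "t \<in> J" if "t < 0" for t using J that by auto
  have emb: "smooth_embedding (F t)" and normal: "unit_normal_field (F t) (\<nu> t)" if "t < 0" for t
    using flow tJ[OF that] by (auto simp: curve_shortening_flow_def interior_normal_def)
  have H: "psmooth H"
  proof -
    have "smooth_on (J \<times> UNIV) H"
      using flow by (simp add: curve_shortening_flow_def H_def[abs_def] case_prod_beta')
    moreover have "past \<subseteq> J \<times> UNIV" using J by (auto simp: past_def)
    ultimately have "smooth_on past H" unfolding smooth_on_def using Ck_on_subset by blast
    moreover have "cis (u + 2 * pi) = cis u" for u by (simp add: cis_mult[symmetric])
    ultimately show ?thesis by (simp add: psmooth_def H_def)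
  qed
  have cd: "circle_deriv (F t) (cis u) = Du H (t, u)" if "t < 0" for t u
    using circle_deriv_cis Du_has_vector_derivative[OF H that, of u] by (simp add: H_def)
  interpret spherical_curves H
  proof
    show "psmooth H" by (rule H)
    fix p assume "p \<in> past"
    then obtain t u where p: "p = (t, u)" "t < 0" by (cases p) auto
    show "norm (H p) = 1" using emb[OF p(2)] p(1) cis_S1[of u]
      by (auto simp: smooth_embedding_def H_def image_subset_iff)
    show "Du H p \<noteq> 0" using emb[OF p(2)] cis_S1[of u]
      unfolding p(1) cd[OF p(2), symmetric] smooth_embedding_def by blast
  qed
  have ut: "unit_tangent (F t) (cis u) = T (t, u)" if "t < 0" for t u
    unfolding unit_tangent_def cd[OF that] by (simp add: T_def arc_deriv_def speed_def)
  have dt: "Dt H (t, u) = geodesic_curvature (F t) (\<nu> t) (cis u) *\<^sub>R \<nu> t (cis u)" if "t < 0" for t u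
    using flow tJ[OF that] cis_S1[of u] DtI[OF H that, of u]
    by (simp add: curve_shortening_flow_def H_def)
  have dk: "Dt H (t, u) = k (t, u) *\<^sub>R N (t, u)" if t: "t < 0" for t u
  proof -
    have p: "(t, u) \<in> past" using t by simp
    have "circle_deriv (unit_tangent (F t)) (cis u) = Du T (t, u)"
      using Du_has_vector_derivative[OF psmooth_T t, of u] by (intro circle_deriv_cis) (simp add: ut[OF t])
    then have "Dt H (t, u) = tangential_part (H (t, u)) (Ds T (t, u))"
      unfolding dt[OF t] nabla_tau_unit_tangent[OF emb[OF t] normal[OF t] cis_S1, symmetric]
      by (simp add: nabla_tau_def cd[OF t] arc_deriv_def speed_def H_def)
    also have "\<dots> = k (t, u) *\<^sub>R N (t, u)"
      unfolding tangential_part_def Ds_T[OF p] using NF[of "(t, u)"] FF[OF p] by (simp add: inner_diff_left)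
    finally show ?thesis .
  qed
  interpret spherical_flow H
  proof
    fix p assume p: "p \<in> past"
    then obtain t u where tu: "p = (t, u)" "t < 0" by (cases p) auto
    show "Dt H p = Ds (Ds H) p + H p"
      using dk[OF tu(2), of u] Ds_T[OF p] by (simp add: T_def tu(1))
  qed
  have "embedded_flow H"
  proof
    fix t :: real assume t: "t < 0"
    define s where "s u = \<nu> t (cis u) \<bullet> N (t, u)" for u
    have p: "(t, u) \<in> past" for u using t by simp
    have nu: "norm (\<nu> t (cis u)) = 1" "\<nu> t (cis u) \<bullet> H (t, u) = 0" "\<nu> t (cis u) \<bullet> T (t, u) = 0" for u
      using normal[OF t, unfolded unit_normal_field_def, THEN conjunct2, rule_format, OF cis_S1, of u] cd[OF t, of u]
      by (simp_all add: H_def T_def arc_deriv_def)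
    have nuN: "\<nu> t (cis u) = s u *\<^sub>R N (t, u)" for u
      using frame_expand[OF p, of "\<nu> t (cis u)" u] nu by (simp add: s_def)
    have "s u \<noteq> 0" for u using nuN[of u] nu(1)[of u] by auto
    moreover have "continuous_on UNIV s"
    proof -
      have "continuous_on UNIV (\<lambda>u. \<nu> t (cis u))"
        using normal[OF t] Ck_on_continuous[of 0 UNIV "\<lambda>u. \<nu> t (cis u)"]
        by (auto simp: unit_normal_field_def circle_smooth_def smooth_on_def)
      then show ?thesis unfolding s_def
        by (intro continuous_intros psmooth_continuous_slice[OF psmooth_N t])
    qed
    ultimately have sign: "(\<forall>u. 0 < s u) \<or> (\<forall>u. s u < 0)" by (intro continuous_nonzero_one_sign)
    have k: "k (t, u) = geodesic_curvature (F t) (\<nu> t) (cis u) * s u" for u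
    proof -
      have "k (t, u) = (k (t, u) *\<^sub>R N (t, u)) \<bullet> N (t, u)" using NN[OF p] by simp
      then show ?thesis unfolding dk[OF t, symmetric] dt[OF t] by (simp add: s_def)
    qed
    show "(\<forall>u. 0 \<le> k (t, u)) \<or> (\<forall>u. k (t, u) \<le> 0)"
      using sign convex[OF tJ[OF t] cis_S1] unfolding k
      by (meson less_imp_le mult_nonneg_nonneg mult_nonneg_nonpos)
  next
    fix t u w :: real assume t: "t < 0" and "H (t, u) = H (t, w)"
    then show "cis u = cis w"
      using emb[OF t] cis_S1[of u] cis_S1[of w] by (auto simp: smooth_embedding_def H_def inj_on_def)
  qed
  then show ?thesis by (simp add: H_def[abs_def])
qed

text \<open>The normalisation of the final time excludes \<open>T = -\<infinity>\<close> and all finite values except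
  \<open>0\<close>.\<close>

lemma ancient_solution_past: "ancient_solution T F \<nu> \<Longrightarrow> {..<0} \<subseteq> before T"
  by (cases T) (auto simp: ancient_solution_def before_def zero_ereal_def)

section \<open>Convergence of ancient convex solutions\<close>

theorem theorem4p6:
  fixes F :: "real \<Rightarrow> complex \<Rightarrow> real^3"
    and \<nu> :: "real \<Rightarrow> complex \<Rightarrow> real^3"
    and T :: ereal
  assumes "ancient_solution T F \<nu>"
    and "convex_solution T F \<nu>"
  shows "\<exists>E. is_equator E \<and> Cinf_limit_up_to_diffeo_at_bot T F E"
proof -
  define H where "H p = F (fst p) (cis (snd p))" for p :: "real \<times> real"
  interpret f: embedded_flow H
    unfolding H_def[abs_def] using assms ancient_solution_past[OF assms(1)]
    by (intro convex_solution_embedded_flow[where J="before T"])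
      (auto simp: ancient_solution_def convex_solution_def)
  define L where "L z = Lim at_bot (\<lambda>t. F t z)" for z
  have L: "L (cis u) = f.G 0 u" for u
    unfolding L_def using f.G_tendsto[of 0 u]
    by (intro tendsto_Lim) (auto simp: H_def trivial_limit_at_bot_linorder)
  have dL: "(circle_deriv ^^ m) L (cis u) = f.G m u" for m u
    by (rule circle_deriv_funpow_cis[OF f.G_deriv L])
  have dF: "(circle_deriv ^^ m) (F t) (cis u) = (Du ^^ m) H (t, u)" if "t < 0" for m t u
    by (rule circle_deriv_funpow_cis[where g="\<lambda>j u. (Du ^^ j) H (t, u)"])
      (use Du_has_vector_derivative[OF f.psmooth_Du_funpow[OF f.F] that] in \<open>auto simp: H_def\<close>)
  have "uniform_limit S1 (\<lambda>t. (circle_deriv ^^ m) (F t)) ((circle_deriv ^^ m) L) at_bot" for m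
    unfolding uniform_limit_iff
  proof (intro allI impI)
    fix e :: real assume "0 < e"
    then have "\<forall>\<^sub>F t in at_bot. \<forall>u\<in>UNIV. dist ((Du ^^ m) H (t, u)) (f.G m u) < e"
      using f.G_limit unfolding uniform_limit_iff by blast
    then show "\<forall>\<^sub>F t in at_bot. \<forall>z\<in>S1. dist ((circle_deriv ^^ m) (F t) z) ((circle_deriv ^^ m) L z) < e"
      using f.eventually_past
    proof eventually_elim
      case (elim t)
      show ?case
      proof
        fix z assume z: "z \<in> S1"
        show "dist ((circle_deriv ^^ m) (F t) z) ((circle_deriv ^^ m) L z) < e"
          using elim by (subst (1 2) S1_cis[OF z]) (simp add: dL dF)
      qed
    qed
  qed
  then have lim: "Cinf_limit (\<lambda>t. F t \<circ> (\<lambda>z. z)) L at_bot" by (simp add: Cinf_limit_def o_def)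
  have im: "L ` S1 = {x \<in> S2. f.limit_normal \<bullet> x = 0}"
  proof -
    have "L ` S1 = range (f.G 0)"
      using L cis_S1 S1_cis by (metis (no_types, opaque_lifting) equalityI image_subsetI rangeI image_eqI)
    then show ?thesis by (simp add: f.limit_image)
  qed
  have "smooth_embedding L"
    unfolding smooth_embedding_def
  proof (intro conjI ballI inj_onI)
    show "circle_smooth L" unfolding circle_smooth_def L by (rule f.G_smooth)
    show "L ` S1 \<subseteq> S2" unfolding im by auto
    fix z assume z: "z \<in> S1"
    show "circle_deriv L z \<noteq> 0"
      using dL[of 1 "Arg2pi z"] f.G1_nonzero[of "Arg2pi z"] S1_cis[OF z] by auto
  next
    fix z w assume zw: "z \<in> S1" "w \<in> S1" "L z = L w"
    have "f.G 0 (Arg2pi z) = f.G 0 (Arg2pi w)"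
      using zw S1_cis L by metis
    then have "Arg2pi z = Arg2pi w"
      by (intro f.limit_injective) (auto simp: Arg2pi_ge_0 Arg2pi_lt_2pi)
    then show "z = w" using S1_cis zw by metis
  qed
  then have "Cinf_limit_up_to_diffeo_at_bot T F {x \<in> S2. f.limit_normal \<bullet> x = 0}"
    unfolding Cinf_limit_up_to_diffeo_at_bot_def
    using circle_diffeo_ident im lim by (intro exI[of _ "\<lambda>_ z. z"] exI[of _ L]) auto
  moreover have "is_equator {x \<in> S2. f.limit_normal \<bullet> x = 0}"
    unfolding is_equator_def using f.frame_limit(3) by (intro exI[of _ f.limit_normal]) auto
  ultimately show ?thesis by blast
qed

end
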